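(* Let $d\ge1$, $r\ge1$, let $0<q<2$ satisfy $d+q-2\ge0$, let $K(z)=-|z|^q$, set $p_c:=d/(d+q-2)$ if $d+q-2>0$ and $p_c:=\infty$ if $d+q-2=0$, and let $p_c\le p\le\infty$ with $p>p_c$ if $d+q-2>0$. Let $\mu,\rho_0\in\mathcal P_r(\mathbb R^d)\cap L^p(\mathbb R^d)$ be probability densities, let $\rho_t$ be the corresponding unique global weak solution of $$\partial_t\rho_t=-\nabla\cdot(\rho_tv_t),\qquad v_t=-\nabla K*(\rho_t-\mu),$$ with initial datum $\rho_0$, and set $$\mathscr D_q(\rho_t\mid\mu):=\int_{\mathbb R^d}|\nabla K*(\rho_t-\mu)|^2\,\mathrm d\rho_t.$$ Then $t\mapsto\mathrm{MMD}_q^2(\rho_t,\mu)$ is continuously differentiable and, for every $0\le s\le t$, $$\mathrm{MMD}_q^2(\rho_t,\mu)+\int_s^t\mathscr D_q(\rho_\tau\mid\mu)\,\mathrm d\tau=\mathrm{MMD}_q^2(\rho_s,\mu).$$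
   Context: $\mathcal P_s(\mathbb R^d)$: Borel probability measures with finite $s$-th moment; absolutely continuous measures are identified with densities. $\nabla K(z)=-q|z|^{q-2}z$ for $z\ne0$. $\mathrm{MMD}_q^2(\rho,\mu):=\frac12\iint(|x|^q+|y|^q-|x-y|^q)\,\mathrm d(\rho-\mu)(x)\,\mathrm d(\rho-\mu)(y)$. The corresponding solution is the unique global weak solution in the following class. For every $T>0$, on $[0,T]$: $v_t=-\nabla K*(\rho_t-\mu)$ belongs to $L^\infty([0,T];W^{1,\infty}(\mathbb R^d))\cap C([0,T]\times\mathbb R^d)$; $\int_0^T\int(\partial_t\varphi+v_t\cdot\nabla\varphi)\rho_t\,\mathrm dx\,\mathrm dt+\int\varphi(0,x)\rho_0(x)\,\mathrm dx=0$ for all $\varphi\in C_c^\infty([0,T)\times\mathbb R^d)$; $\sup_{0\le t\le T}\int|x|^r\,\mathrm d\rho_t<\infty$; and if $p<\infty$, $\rho\in C([0,T];\mathcal P_1)\cap C([0,T];L^p)\cap C^1([0,T];W^{-1,p})$ ($\mathcal P_1$ with the $W_1$ topology), while if $p=\infty$, $\rho\in C([0,T];\mathcal P_1)\cap C_{w^*}([0,T];L^\infty)\cap\bigcap_{1\le s<\infty}C([0,T];L^s)$ and $\rho\in L^\infty((0,T)\times\mathbb R^d)$. Under the stated hypotheses such a solution exists and is unique. *)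

theory Defs
  imports "HOL-Probability.Probability"
begin

text \<open>
  Throughout, the Euclidean space is a type \<open>'a::euclidean_space\<close> of dimension \<open>d = DIM('a)\<close>, and
  integrability exponents \<open>p \<in> [1, \<infinity>]\<close> are of type \<^typ>\<open>ennreal\<close>.
\<close>

section \<open>Smooth functions and test functions\<close>

primrec Ck :: "nat \<Rightarrow> ('a::euclidean_space \<Rightarrow> 'b::euclidean_space) \<Rightarrow> bool" where
  "Ck 0 f \<longleftrightarrow> continuous_on UNIV f"
| "Ck (Suc k) f \<longleftrightarrow> (\<forall>x. f differentiable (at x)) \<and>
     (\<forall>v. Ck k (\<lambda>x. frechet_derivative f (at x) v))"

definition smooth :: "('a::euclidean_space \<Rightarrow> 'b::euclidean_space) \<Rightarrow> bool" where
  "smooth f \<longleftrightarrow> (\<forall>k. Ck k f)"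

definition test_functions :: "('a::euclidean_space \<Rightarrow> real) set" where
  "test_functions = {\<phi>. smooth \<phi> \<and> compact (closure {x. \<phi> x \<noteq> 0})}"

text \<open>
  An element of \<open>C\<^sub>c\<^sup>\<infinity>([0,T) \<times> \<real>\<^sup>d)\<close> is smooth up to and including \<open>t = 0\<close> and need not vanish there.
  It is represented by an extension in \<open>C\<^sub>c\<^sup>\<infinity>((-\<infinity>,T) \<times> \<real>\<^sup>d)\<close>, of which only the restriction to
  \<open>t \<ge> 0\<close> is used below.
\<close>
definition spacetime_test_functions :: "real \<Rightarrow> (real \<times> 'a::euclidean_space \<Rightarrow> real) set" where
  "spacetime_test_functions T =
     {\<phi> \<in> test_functions. closure {z. \<phi> z \<noteq> 0} \<subseteq> {..<T} \<times> UNIV}"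

definition grad :: "('a::euclidean_space \<Rightarrow> real) \<Rightarrow> 'a \<Rightarrow> 'a" where
  "grad f x = (\<Sum>b\<in>Basis. frechet_derivative f (at x) b *\<^sub>R b)"


section \<open>Lebesgue and Sobolev spaces on the whole space\<close>

definition Lp_norm :: "ennreal \<Rightarrow> ('a::euclidean_space \<Rightarrow> 'b::euclidean_space) \<Rightarrow> ennreal" where
  "Lp_norm p f =
     (if p = \<infinity> then esssup lborel (\<lambda>x. ennreal (norm (f x)))
      else let I = (\<integral>\<^sup>+ x. ennreal (norm (f x) powr enn2real p) \<partial>lborel)
           in if I = \<infinity> then \<infinity> else ennreal (enn2real I powr (1 / enn2real p)))"

definition Lp :: "ennreal \<Rightarrow> ('a::euclidean_space \<Rightarrow> 'b::euclidean_space) set" where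
  "Lp p = {f. f \<in> borel_measurable lborel \<and> Lp_norm p f < \<infinity>}"

definition locally_integrable :: "('a::euclidean_space \<Rightarrow> 'b::euclidean_space) \<Rightarrow> bool" where
  "locally_integrable f \<longleftrightarrow> (\<forall>C. compact C \<longrightarrow> set_integrable lborel C f)"

text \<open>\<open>G b\<close> is the weak partial derivative of \<open>u\<close> in the direction \<open>b \<in> Basis\<close>.\<close>
definition has_weak_partials ::
    "('a::euclidean_space \<Rightarrow> 'b::euclidean_space) \<Rightarrow> ('a \<Rightarrow> 'a \<Rightarrow> 'b) \<Rightarrow> bool" where
  "has_weak_partials u G \<longleftrightarrow> locally_integrable u \<and>
     (\<forall>b\<in>Basis. locally_integrable (G b) \<and>
        (\<forall>\<phi>\<in>test_functions.
           (LINT x|lborel. frechet_derivative \<phi> (at x) b *\<^sub>R u x) = - (LINT x|lborel. \<phi> x *\<^sub>R G b x)))"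

text \<open>
  Weak partial derivatives are unique almost everywhere, so the infimum ranges over at most one
  value; it is \<open>\<infinity>\<close> if there are no weak derivatives.
\<close>
definition W1p_norm :: "ennreal \<Rightarrow> ('a::euclidean_space \<Rightarrow> 'b::euclidean_space) \<Rightarrow> ennreal" where
  "W1p_norm p u = (INF G\<in>{G. has_weak_partials u G}. Lp_norm p u + (\<Sum>b\<in>Basis. Lp_norm p (G b)))"

definition W1p :: "ennreal \<Rightarrow> ('a::euclidean_space \<Rightarrow> 'b::euclidean_space) set" where
  "W1p p = {u. W1p_norm p u < \<infinity>}"

text \<open>
  For \<open>1 < p < \<infinity>\<close>, the space \<open>W\<^sup>-\<^sup>1\<^sup>,\<^sup>p\<close> is the dual of \<open>W\<^sup>1\<^sup>,\<^sup>p\<^sup>'\<close>.  Its elements are functionals on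
  functions; boundedness makes them insensitive to changes on null sets.
\<close>
definition conj_exponent :: "ennreal \<Rightarrow> ennreal" where
  "conj_exponent p = ennreal (enn2real p / (enn2real p - 1))"

definition Wm1p_norm :: "ennreal \<Rightarrow> (('a::euclidean_space \<Rightarrow> real) \<Rightarrow> real) \<Rightarrow> ennreal" where
  "Wm1p_norm p l = (SUP \<phi>\<in>{\<phi>. W1p_norm (conj_exponent p) \<phi> \<le> 1}. ennreal \<bar>l \<phi>\<bar>)"

definition Wm1p :: "ennreal \<Rightarrow> (('a::euclidean_space \<Rightarrow> real) \<Rightarrow> real) set" where
  "Wm1p p = {l. (\<forall>\<phi>\<in>W1p (conj_exponent p). \<forall>\<psi>\<in>W1p (conj_exponent p). \<forall>a b.
                   l (\<lambda>x. a * \<phi> x + b * \<psi> x) = a * l \<phi> + b * l \<psi>) \<and> Wm1p_norm p l < \<infinity>}"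

definition functional_of :: "('a::euclidean_space \<Rightarrow> real) \<Rightarrow> ('a \<Rightarrow> real) \<Rightarrow> real" where
  "functional_of f \<phi> = (LINT x|lborel. f x * \<phi> x)"


section \<open>Probability measures and the Wasserstein distance\<close>

definition prob_moment :: "real \<Rightarrow> 'a::euclidean_space measure set" where
  "prob_moment s = {M. prob_space M \<and> sets M = sets borel \<and>
                       (\<integral>\<^sup>+ x. ennreal (norm x powr s) \<partial>M) < \<infinity>}"

text \<open>\<^term>\<open>law f\<close> is the measure \<open>f dx\<close>; for it to determine \<open>f\<close> almost everywhere, \<open>f\<close> has to be
  nonnegative almost everywhere.\<close>
definition law :: "('a::euclidean_space \<Rightarrow> real) \<Rightarrow> 'a measure" where
  "law f = density lborel (\<lambda>x. ennreal (f x))"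

definition prob_density_moment :: "real \<Rightarrow> ('a::euclidean_space \<Rightarrow> real) set" where
  "prob_density_moment s =
     {f. f \<in> borel_measurable lborel \<and> (AE x in lborel. 0 \<le> f x) \<and> law f \<in> prob_moment s}"

definition couplings ::
    "'a::euclidean_space measure \<Rightarrow> 'a measure \<Rightarrow> ('a \<times> 'a) measure set" where
  "couplings M N = {P. sets P = sets borel \<and> distr P borel fst = M \<and> distr P borel snd = N}"

definition Wasserstein1 :: "'a::euclidean_space measure \<Rightarrow> 'a measure \<Rightarrow> ennreal" where
  "Wasserstein1 M N = (INF P\<in>couplings M N. \<integral>\<^sup>+ z. ennreal (norm (fst z - snd z)) \<partial>P)"


section \<open>Curves in function spaces on a time interval\<close>

definition continuous_wrt :: "('x \<Rightarrow> 'x \<Rightarrow> ennreal) \<Rightarrow> real \<Rightarrow> (real \<Rightarrow> 'x) \<Rightarrow> bool" where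
  "continuous_wrt dst T f \<longleftrightarrow>
     (\<forall>t\<in>{0..T}. ((\<lambda>s. dst (f s) (f t)) \<longlongrightarrow> 0) (at t within {0..T}))"

definition in_C_P1 :: "real \<Rightarrow> (real \<Rightarrow> 'a::euclidean_space \<Rightarrow> real) \<Rightarrow> bool" where
  "in_C_P1 T \<rho> \<longleftrightarrow> (\<forall>t\<in>{0..T}. \<rho> t \<in> prob_density_moment 1) \<and>
     continuous_wrt Wasserstein1 T (\<lambda>t. law (\<rho> t))"

definition in_C_Lp :: "ennreal \<Rightarrow> real \<Rightarrow> (real \<Rightarrow> 'a::euclidean_space \<Rightarrow> real) \<Rightarrow> bool" where
  "in_C_Lp p T \<rho> \<longleftrightarrow> (\<forall>t\<in>{0..T}. \<rho> t \<in> Lp p) \<and>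
     continuous_wrt (\<lambda>f g. Lp_norm p (\<lambda>x. f x - g x)) T \<rho>"

definition in_Cwstar_Linf :: "real \<Rightarrow> (real \<Rightarrow> 'a::euclidean_space \<Rightarrow> real) \<Rightarrow> bool" where
  "in_Cwstar_Linf T \<rho> \<longleftrightarrow> (\<forall>t\<in>{0..T}. \<rho> t \<in> Lp \<infinity>) \<and>
     (\<forall>g\<in>Lp 1. continuous_on {0..T} (\<lambda>t. LINT x|lborel. \<rho> t x * g x))"

definition in_C1_Wm1p :: "ennreal \<Rightarrow> real \<Rightarrow> (real \<Rightarrow> 'a::euclidean_space \<Rightarrow> real) \<Rightarrow> bool" where
  "in_C1_Wm1p p T \<rho> \<longleftrightarrow> (\<forall>t\<in>{0..T}. functional_of (\<rho> t) \<in> Wm1p p) \<and>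
     (\<exists>\<rho>'. (\<forall>t\<in>{0..T}. \<rho>' t \<in> Wm1p p) \<and>
        (\<forall>t\<in>{0..T}. ((\<lambda>s. Wm1p_norm p (\<lambda>\<phi>.
              (functional_of (\<rho> s) \<phi> - functional_of (\<rho> t) \<phi>) / (s - t) - \<rho>' t \<phi>)) \<longlongrightarrow> 0)
           (at t within {0..T})) \<and>
        continuous_wrt (\<lambda>k l. Wm1p_norm p (\<lambda>\<phi>. k \<phi> - l \<phi>)) T \<rho>')"

text \<open>
  A curve of densities is only determined up to null sets at each time, so membership in
  \<open>L\<^sup>\<infinity>((0,T) \<times> \<real>\<^sup>d)\<close> is stated for a jointly measurable representative.
\<close>
definition in_Linf_spacetime :: "real \<Rightarrow> (real \<Rightarrow> 'a::euclidean_space \<Rightarrow> real) \<Rightarrow> bool" where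
  "in_Linf_spacetime T \<rho> \<longleftrightarrow>
     (\<exists>g. (\<lambda>z. indicator ({0<..<T} \<times> UNIV) z * g z) \<in> Lp \<infinity> \<and>
        (AE t in lborel. t \<in> {0<..<T} \<longrightarrow> (AE x in lborel. g (t, x) = \<rho> t x)))"

text \<open>
  \<open>L\<^sup>\<infinity>([0,T]; W\<^sup>1\<^sup>,\<^sup>\<infinity>)\<close> means an essential bound on the norm.  Strong (Bochner) measurability is not
  imposed, because \<open>W\<^sup>1\<^sup>,\<^sup>\<infinity>\<close> is not separable.
\<close>
definition in_Linf_W1inf ::
    "real \<Rightarrow> (real \<Rightarrow> 'a::euclidean_space \<Rightarrow> 'b::euclidean_space) \<Rightarrow> bool" where
  "in_Linf_W1inf T v \<longleftrightarrow>
     (\<exists>C::real. AE t in lborel. t \<in> {0..T} \<longrightarrow> W1p_norm \<infinity> (v t) \<le> ennreal C)"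


section \<open>The interaction kernel and the energy\<close>

definition K :: "real \<Rightarrow> 'a::euclidean_space \<Rightarrow> real" where
  "K q z = - (norm z powr q)"

definition gradK :: "real \<Rightarrow> 'a::euclidean_space \<Rightarrow> 'a" where
  "gradK q z = - ((q * norm z powr (q - 2)) *\<^sub>R z)"

lemma gradK_is_gradient:
  fixes z :: "'a::euclidean_space"
  assumes "z \<noteq> 0"
  shows "GDERIV (K q) z :> gradK q z"
proof -
  have n: "norm z > 0" using assms by simp
  have "((\<lambda>u. - (u powr q)) has_real_derivative - (q * norm z powr (q - 1))) (at (norm z))"
    using n by (auto intro!: derivative_eq_intros simp: powr_diff)
  with GDERIV_norm[OF assms]
  have "GDERIV (\<lambda>z. - (norm z powr q)) z :> - (q * norm z powr (q - 1)) *\<^sub>R sgn z"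
    by (rule GDERIV_DERIV_compose)
  moreover have "- (q * norm z powr (q - 1)) *\<^sub>R sgn z = gradK q z"
    using n by (simp add: gradK_def sgn_div_norm powr_diff powr_numeral power2_eq_square divide_inverse)
  ultimately show ?thesis
    unfolding K_def[abs_def] by simp
qed

definition conv_vec ::
    "('a::euclidean_space \<Rightarrow> 'b::euclidean_space) \<Rightarrow> ('a \<Rightarrow> real) \<Rightarrow> 'a \<Rightarrow> 'b" where
  "conv_vec k f x = (LINT y|lborel. f y *\<^sub>R k (x - y))"

definition velocity ::
    "real \<Rightarrow> ('a::euclidean_space \<Rightarrow> real) \<Rightarrow> ('a \<Rightarrow> real) \<Rightarrow> 'a \<Rightarrow> 'a" where
  "velocity q \<rho> \<mu> x = - conv_vec (gradK q) (\<lambda>y. \<rho> y - \<mu> y) x"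

definition MMD_sq :: "real \<Rightarrow> ('a::euclidean_space \<Rightarrow> real) \<Rightarrow> ('a \<Rightarrow> real) \<Rightarrow> real" where
  "MMD_sq q \<rho> \<mu> = 1 / 2 * (LINT (x, y)|(lborel \<Otimes>\<^sub>M lborel).
     (norm x powr q + norm y powr q - norm (x - y) powr q) * (\<rho> x - \<mu> x) * (\<rho> y - \<mu> y))"

definition dissipation :: "real \<Rightarrow> ('a::euclidean_space \<Rightarrow> real) \<Rightarrow> ('a \<Rightarrow> real) \<Rightarrow> real" where
  "dissipation q \<rho> \<mu> = (LINT x|law \<rho>. (norm (conv_vec (gradK q) (\<lambda>y. \<rho> y - \<mu> y) x))\<^sup>2)"


section \<open>Global weak solutions\<close>

definition critical_exponent :: "nat \<Rightarrow> real \<Rightarrow> ennreal" where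
  "critical_exponent d q =
     (if real d + q - 2 > 0 then ennreal (real d / (real d + q - 2)) else \<infinity>)"

definition weak_equation ::
    "real \<Rightarrow> real \<Rightarrow> ('a::euclidean_space \<Rightarrow> real) \<Rightarrow> ('a \<Rightarrow> real) \<Rightarrow> (real \<Rightarrow> 'a \<Rightarrow> real) \<Rightarrow> bool" where
  "weak_equation q T \<mu> \<rho>0 \<rho> \<longleftrightarrow>
     (\<forall>\<phi>\<in>spacetime_test_functions T.
        (LINT t:{0..T}|lborel. LINT x|lborel.
           (deriv (\<lambda>s. \<phi> (s, x)) t + inner (velocity q (\<rho> t) \<mu> x) (grad (\<lambda>y. \<phi> (t, y)) x)) * \<rho> t x)
        + (LINT x|lborel. \<phi> (0, x) * \<rho>0 x) = 0)"

definition global_weak_solution ::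
    "real \<Rightarrow> real \<Rightarrow> ennreal \<Rightarrow> ('a::euclidean_space \<Rightarrow> real) \<Rightarrow> ('a \<Rightarrow> real) \<Rightarrow>
     (real \<Rightarrow> 'a \<Rightarrow> real) \<Rightarrow> bool" where
  "global_weak_solution q r p \<mu> \<rho>0 \<rho> \<longleftrightarrow> (\<forall>T>0.
     in_Linf_W1inf T (\<lambda>t. velocity q (\<rho> t) \<mu>) \<and>
     continuous_on ({0..T} \<times> UNIV) (\<lambda>(t, x). velocity q (\<rho> t) \<mu> x) \<and>
     weak_equation q T \<mu> \<rho>0 \<rho> \<and>
     (SUP t\<in>{0..T}. \<integral>\<^sup>+ x. ennreal (norm x powr r) \<partial>law (\<rho> t)) < \<infinity> \<and>
     in_C_P1 T \<rho> \<and>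
     (if p < \<infinity>
      then in_C_Lp p T \<rho> \<and> in_C1_Wm1p p T \<rho>
      else in_Cwstar_Linf T \<rho> \<and> (\<forall>s. 1 \<le> s \<and> s < \<infinity> \<longrightarrow> in_C_Lp s T \<rho>) \<and> in_Linf_spacetime T \<rho>))"

end

theory Submission
  imports Defs
begin

text \<open>
  Write \<open>\<sigma>\<^sub>t = \<rho>\<^sub>t - \<mu>\<close>, a signed density of total mass zero, and let
  \<open>\<phi>\<^sub>t(x) = \<integral> (|x|\<^sup>q + |y|\<^sup>q - |x - y|\<^sup>q) \<sigma>\<^sub>t(y) dy\<close> be its potential.  The energy is the quadratic form
  \<open>E(t) = 1/2 \<integral> \<phi>\<^sub>t \<sigma>\<^sub>t\<close>, and the kernel is symmetric, so the polarization identity gives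
  \<open>E(t) - E(s) = 1/2 \<integral> (\<phi>\<^sub>s + \<phi>\<^sub>t) d(\<rho>\<^sub>t - \<rho>\<^sub>s)\<close>.
  Because \<open>\<sigma>\<^sub>t\<close> is neutral, the terms \<open>|x|\<^sup>q\<close> and \<open>|y|\<^sup>q\<close> do not contribute to the gradient, and
  \<open>\<nabla>\<phi>\<^sub>t = \<nabla>K * \<sigma>\<^sub>t = -v\<^sub>t\<close>, which is continuous and bounded.  Thus \<open>\<phi>\<^sub>s + \<phi>\<^sub>t\<close> is a Lipschitz function
  of class \<open>C\<^sup>1\<close>, and testing the continuity equation with it yields
  \<open>E(t) - E(s) = - 1/2 \<integral>\<^sub>s\<^sup>t (Q(s,\<tau>) + Q(t,\<tau>)) d\<tau>\<close>, where \<open>Q(a,\<tau>) = \<integral> v\<^sub>\<tau> \<cdot> v\<^sub>a d\<rho>\<^sub>\<tau>\<close>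
  (lemma \<open>MMD_increment\<close>).  The function \<open>Q\<close> is jointly continuous, and \<open>Q(t,t)\<close> is the dissipation.
  Dividing by \<open>t - s\<close> and letting \<open>s\<close> tend to \<open>t\<close> shows \<open>E' = - Q(t,t)\<close>, and integrating this gives the energy
  identity.  The point of the argument is that the increment of \<open>E\<close> is tested with the potentials at the
  two end points, which are fixed in time, so \<open>\<phi>\<^sub>t\<close> is never differentiated in \<open>t\<close>.

  Three facts carry the proof.

  The continuity equation holds for every Lipschitz \<open>C\<^sup>1\<close> function (\<open>duality_Lipschitz\<close>).  In time, a test
  function \<open>\<theta>(s)\<psi>(x)\<close> with \<open>\<theta>\<close> decreasing steeply to \<open>0\<close> right after \<open>t\<close> turns the space-time weak form
  into an identity at time \<open>t\<close>.  In space, the class of functions for which the identity holds is closed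
  under dominated convergence, which reaches Lipschitz \<open>C\<^sup>1\<close> functions from test functions by
  mollification and cut-off.

  The pairing \<open>\<integral> u(\<tau>,x) d\<rho>\<^sub>\<tau>(x)\<close> is continuous in \<open>\<tau>\<close> for bounded continuous \<open>u\<close>
  (\<open>continuous_on_pairing\<close>); this is read off from a coupling of \<open>\<rho>\<^sub>\<tau>\<close> and \<open>\<rho>\<^sub>t\<close> with small transport cost.

  The potential is differentiable with gradient \<open>\<nabla>K * \<sigma>\<close> as soon as the latter is continuous
  (\<open>potential_gradient\<close>).  The function \<open>|z|\<^sup>q\<^sup>-\<^sup>1\<close> is locally integrable, so for almost every \<open>x\<close> Fubini's theorem
  allows the increment of the potential from \<open>x\<close> to \<open>x + e\<close> to be written as the integral of
  \<open>(\<nabla>K * \<sigma>) \<cdot> e\<close> along the segment; both sides are continuous in \<open>x\<close>, so the formula holds everywhere.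
\<close>

section \<open>Functions of class \<open>C\<^sup>k\<close>\<close>

text \<open>
  Allows any known derivative in place of the Frechet derivative chosen by the definition of
  \<open>Ck\<close>; the closure properties below are inductions over this equivalence.
\<close>
lemma Ck_Suc_iff:
  assumes "\<And>x. (f has_derivative f' x) (at x)"
  shows "Ck (Suc k) f \<longleftrightarrow> (\<forall>v. Ck k (\<lambda>x. f' x v))"
proof -
  have "frechet_derivative f (at x) = f' x" for x
    using frechet_derivative_at[OF assms] by simp
  moreover have "f differentiable (at x)" for x
    using assms differentiable_def by blast
  ultimately show ?thesis by simp
qed

lemma Ck_has_derivative:
  "Ck (Suc k) f \<Longrightarrow> (f has_derivative frechet_derivative f (at x)) (at x)"
  by (simp add: frechet_derivative_works)

lemma Ck_mono: "Ck (Suc k) f \<Longrightarrow> Ck k f"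
proof (induction k arbitrary: f)
  case 0
  then show ?case
    by (auto intro!: continuous_at_imp_continuous_on differentiable_imp_continuous_within)
next
  case (Suc k)
  then show ?case by simp
qed

lemma Ck_const: "Ck k (\<lambda>_. c)"
proof (induction k arbitrary: c)
  case (Suc k)
  then show ?case using Ck_Suc_iff[of "\<lambda>_. c" "\<lambda>_ _. 0"] by simp
qed simp

lemma Ck_bounded_linear:
  assumes "bounded_linear L" shows "Ck k L"
proof (cases k)
  case 0
  then show ?thesis using assms by (simp add: linear_continuous_on)
next
  case (Suc k)
  then show ?thesis
    using Ck_Suc_iff[of L "\<lambda>_. L"] assms Ck_const bounded_linear_imp_has_derivative by blast
qed

lemma Ck_add: "Ck k f \<Longrightarrow> Ck k g \<Longrightarrow> Ck k (\<lambda>x. f x + g x)"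
proof (induction k arbitrary: f g)
  case 0
  then show ?case by (simp add: continuous_on_add)
next
  case (Suc k)
  have "((\<lambda>x. f x + g x) has_derivative
      (\<lambda>v. frechet_derivative f (at x) v + frechet_derivative g (at x) v)) (at x)" for x
    using Suc.prems by (intro has_derivative_add Ck_has_derivative)
  from Ck_Suc_iff[OF this] show ?case using Suc by auto
qed

lemma Ck_mult:
  fixes f g :: "'a::euclidean_space \<Rightarrow> real"
  shows "Ck k f \<Longrightarrow> Ck k g \<Longrightarrow> Ck k (\<lambda>x. f x * g x)"
proof (induction k arbitrary: f g)
  case 0
  then show ?case by (simp add: continuous_on_mult)
next
  case (Suc k)
  have "((\<lambda>x. f x * g x) has_derivative
      (\<lambda>v. f x * frechet_derivative g (at x) v + frechet_derivative f (at x) v * g x)) (at x)" for x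
    using Suc.prems by (intro has_derivative_mult Ck_has_derivative)
  note D = Ck_Suc_iff[OF this]
  have "Ck k f" "Ck k g"
    using Suc.prems by (auto intro: Ck_mono simp del: Ck.simps)
  then show ?case unfolding D using Suc.prems by (auto intro!: Ck_add Suc.IH)
qed

lemma Ck_comp_linear:
  assumes "bounded_linear L"
  shows "Ck k f \<Longrightarrow> Ck k (\<lambda>x. f (L x))"
proof (induction k arbitrary: f)
  case 0
  then show ?case
    using continuous_on_compose2[of UNIV f UNIV L] linear_continuous_on[OF assms] by auto
next
  case (Suc k)
  have "((\<lambda>x. f (L x)) has_derivative
      (\<lambda>v. frechet_derivative f (at (L x)) (L v))) (at x)" for x
    using has_derivative_compose[OF bounded_linear_imp_has_derivative[OF assms]
        Ck_has_derivative[OF Suc.prems, of "L x"]] by simp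
  from Ck_Suc_iff[OF this] show ?case using Suc by auto
qed

lemma Ck_shift: "Ck k f \<Longrightarrow> Ck k (\<lambda>x. f (x + c))"
proof (induction k arbitrary: f)
  case 0
  then show ?case
    by (auto intro!: continuous_on_compose2[of UNIV f] continuous_intros)
next
  case (Suc k)
  have "((\<lambda>x. f (x + c)) has_derivative
      (\<lambda>v. frechet_derivative f (at (x + c)) v)) (at x)" for x
    using has_derivative_compose[of "\<lambda>x. x + c" "\<lambda>v. v" x UNIV, OF _
        Ck_has_derivative[OF Suc.prems, of "x + c"]]
      has_derivative_add_const[OF has_derivative_ident, of c "at x"] by simp
  from Ck_Suc_iff[OF this] show ?case using Suc by auto
qed

text \<open>
  By the chain rule the derivative of \<open>f \<circ> g\<close> is \<open>(f' \<circ> g) \<cdot> Dg\<close>, so the induction hypothesis is needed for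
  \<open>f'\<close> instead of \<open>f\<close>; this is why \<open>f\<close> is assumed to be smooth and generalized in the induction.
\<close>
lemma Ck_comp_real:
  fixes f :: "real \<Rightarrow> real" and g :: "'a::euclidean_space \<Rightarrow> real"
  shows "(\<And>j. Ck j f) \<Longrightarrow> Ck k g \<Longrightarrow> Ck k (\<lambda>x. f (g x))"
proof (induction k arbitrary: f)
  case 0
  then have "continuous_on UNIV f" using Ck.simps(1) by blast
  with 0 show ?case
    by (auto intro!: continuous_on_compose2[of UNIV f])
next
  case (Suc k)
  define f' where "f' y = frechet_derivative f (at y) 1" for y
  have f'k: "Ck j f'" for j
    using Suc.prems(1)[of "Suc j"] unfolding f'_def by simp
  have f: "(f has_real_derivative f' y) (at y)" for y
  proof -
    have d: "(f has_derivative frechet_derivative f (at y)) (at y)"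
      by (rule Ck_has_derivative[OF Suc.prems(1)])
    have "frechet_derivative f (at y) v = f' y * v" for v
    proof -
      have "frechet_derivative f (at y) (v *\<^sub>R 1) = v *\<^sub>R frechet_derivative f (at y) 1"
        using has_derivative_bounded_linear[OF d] by (rule bounded_linear.linear[THEN linear_scale])
      then show ?thesis by (simp add: f'_def)
    qed
    with d show ?thesis unfolding has_field_derivative_def by (metis (no_types) ext)
  qed
  have "((\<lambda>x. f (g x)) has_derivative
      (\<lambda>v. f' (g x) * frechet_derivative g (at x) v)) (at x)" for x
    using has_derivative_compose[OF Ck_has_derivative[OF Suc.prems(2), of x]
        f[of "g x", unfolded has_field_derivative_def]] by simp
  from Ck_Suc_iff[OF this] Suc.prems(2) show ?case
    by (auto intro!: Ck_mult Suc.IH f'k Ck_mono[OF Suc.prems(2)])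
qed

lemma Ck_inverse:
  fixes u :: "'a::euclidean_space \<Rightarrow> real"
  assumes "\<And>x. u x \<noteq> 0"
  shows "Ck k u \<Longrightarrow> Ck k (\<lambda>x. inverse (u x))"
proof (induction k)
  case 0
  then show ?case using assms by (auto intro!: continuous_on_inverse)
next
  case (Suc k)
  have "((\<lambda>x. inverse (u x)) has_derivative
      (\<lambda>v. - (inverse (u x) * frechet_derivative u (at x) v * inverse (u x)))) (at x)" for x
    by (rule Deriv.has_derivative_inverse[OF assms Ck_has_derivative[OF Suc.prems]])
  note D = Ck_Suc_iff[OF this]
  have "Ck k (\<lambda>x. - (inverse (u x) * frechet_derivative u (at x) v * inverse (u x)))" for v
  proof -
    have "Ck k (\<lambda>x. (-1) * (inverse (u x) * frechet_derivative u (at x) v * inverse (u x)))"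
      using Suc.prems by (intro Ck_mult Ck_const Suc.IH Ck_mono[OF Suc.prems]) auto
    then show ?thesis by simp
  qed
  then show ?case unfolding D by blast
qed

lemma Ck_quadratic:
  fixes c :: real
  shows "Ck k (\<lambda>x::'a::euclidean_space. c - x \<bullet> x)"
proof (cases k)
  case 0
  then show ?thesis by (auto intro!: continuous_intros)
next
  case (Suc j)
  have "((\<lambda>x::'a. c - x \<bullet> x) has_derivative (\<lambda>v. - (x \<bullet> v + v \<bullet> x))) (at x)" for x
    by (auto intro!: derivative_eq_intros)
  note D = Ck_Suc_iff[OF this]
  have "Ck j (\<lambda>x::'a. - (x \<bullet> v + v \<bullet> x))" for v
    by (intro Ck_bounded_linear bounded_linear_minus bounded_linear_add
        bounded_linear_inner_left bounded_linear_inner_right)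
  then show ?thesis unfolding Suc D by blast
qed


lemma Ck_Suc_real:
  fixes f :: "real \<Rightarrow> real"
  assumes "\<And>x. (f has_real_derivative f' x) (at x)" and "Ck k f'"
  shows "Ck (Suc k) f"
  using Ck_Suc_iff[of f "\<lambda>x v. f' x * v"] assms
  by (auto simp: has_field_derivative_def simp del: Ck.simps intro: Ck_mult Ck_const)

lemma Ck_Suc_real_deriv:
  fixes f :: "real \<Rightarrow> real"
  assumes "Ck (Suc k) f"
  shows "(f has_real_derivative deriv f x) (at x)" and "Ck k (deriv f)"
proof -
  have d: "(f has_real_derivative frechet_derivative f (at x) 1) (at x)" for x
    unfolding has_field_derivative_def
  proof (rule has_derivative_eq_rhs[OF Ck_has_derivative[OF assms]])
    show "frechet_derivative f (at x) = (*) (frechet_derivative f (at x) 1)"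
    proof
      fix v
      have "frechet_derivative f (at x) (v *\<^sub>R 1) = v *\<^sub>R frechet_derivative f (at x) 1"
        using has_derivative_bounded_linear[OF Ck_has_derivative[OF assms]]
        by (rule bounded_linear.linear[THEN linear_scale])
      then show "frechet_derivative f (at x) v = frechet_derivative f (at x) 1 * v" by simp
    qed
  qed
  then have eq: "deriv f = (\<lambda>x. frechet_derivative f (at x) 1)"
    using DERIV_imp_deriv by blast
  show "(f has_real_derivative deriv f x) (at x)" using d eq by simp
  show "Ck k (deriv f)" unfolding eq using assms by simp
qed

section \<open>Cut-off functions\<close>

text \<open>
  For the constant polynomial \<open>1\<close> this is the classical smooth function \<open>exp(-1/x)\<close> extended by \<open>0\<close>.
  The polynomial factor is there because this family, unlike the single function, is closed under
  differentiation.
\<close>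
definition flat_exp :: "real poly \<Rightarrow> real \<Rightarrow> real" where
  "flat_exp P x = (if x > 0 then poly P (1 / x) * exp (- (1 / x)) else 0)"

lemma poly_exp_minus_tendsto_0:
  fixes P :: "real poly"
  shows "((\<lambda>u. poly P u * exp (- u)) \<longlongrightarrow> 0) at_top"
proof -
  have "((\<lambda>u. \<Sum>i\<le>degree P. coeff P i * (u ^ i / exp u)) \<longlongrightarrow> 0) at_top"
    by (intro tendsto_null_sum tendsto_mult_right_zero tendsto_power_div_exp_0)
  then show ?thesis
    by (simp add: poly_altdef sum_distrib_right exp_minus divide_inverse mult.assoc)
qed

text \<open>
  With \<open>u = 1/x\<close>, differentiating \<open>P(u) exp(-u)\<close> gives \<open>u\<^sup>2 (P - P')(u) exp(-u)\<close>.  At the origin the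
  difference quotient is \<open>u P(u) exp(-u)\<close>, which tends to \<open>0\<close> as \<open>u\<close> tends to infinity.
\<close>
lemma flat_has_derivative:
  "(flat_exp P has_real_derivative flat_exp ([:0, 0, 1:] * (P - pderiv P)) x) (at x)"
proof (cases x "0::real" rule: linorder_cases)
  case less
  have "((\<lambda>_. 0::real) has_real_derivative 0) (at x)" by simp
  then have "(flat_exp P has_real_derivative 0) (at x)"
    by (rule has_field_derivative_transform_within_open[where S = "{..<0}"])
      (use less in \<open>auto simp: flat_exp_def\<close>)
  then show ?thesis using less by (simp add: flat_exp_def)
next
  case equal
  have "((\<lambda>u. poly (pCons 0 P) u * exp (- u)) \<longlongrightarrow> 0) at_top"
    by (rule poly_exp_minus_tendsto_0)
  then have "((\<lambda>h. poly (pCons 0 P) (inverse h) * exp (- inverse h)) \<longlongrightarrow> 0) (at_right (0::real))"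
    by (rule filterlim_compose[OF _ filterlim_inverse_at_top_right])
  then have r: "((\<lambda>h. flat_exp P h / h) \<longlongrightarrow> 0) (at_right 0)"
    by (rule Lim_transform_eventually)
      (auto simp: eventually_at_filter flat_exp_def divide_inverse mult_ac)
  have l: "((\<lambda>h. flat_exp P h / h) \<longlongrightarrow> 0) (at_left 0)"
    by (rule tendsto_eventually) (auto simp: eventually_at_filter flat_exp_def)
  from r l have "((\<lambda>h. flat_exp P h / h) \<longlongrightarrow> 0) (at 0)"
    by (rule filterlim_split_at[rotated])
  then show ?thesis using equal by (simp add: has_field_derivative_iff flat_exp_def)
next
  case greater
  have "((\<lambda>x. poly P (1 / x) * exp (- (1 / x))) has_real_derivative
      flat_exp ([:0, 0, 1:] * (P - pderiv P)) x) (at x)"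
  proof -
    have i: "((\<lambda>x. 1 / x) has_real_derivative - (1 / x\<^sup>2)) (at x)"
      using greater by (auto intro!: derivative_eq_intros simp: power2_eq_square)
    have "((\<lambda>x. poly P (1 / x) * exp (- (1 / x))) has_real_derivative
        poly (pderiv P) (1 / x) * (- (1 / x\<^sup>2)) * exp (- (1 / x))
          + exp (- (1 / x)) * (- (- (1 / x\<^sup>2))) * poly P (1 / x)) (at x)"
      by (intro DERIV_mult DERIV_chain2[OF poly_DERIV] DERIV_chain2[OF DERIV_exp] DERIV_minus i)
    then show ?thesis
      using greater by (simp add: flat_exp_def algebra_simps power2_eq_square)
  qed
  then show ?thesis
    by (rule has_field_derivative_transform_within_open[where S = "{0<..}"])
      (use greater in \<open>auto simp: flat_exp_def\<close>)
qed

lemma Ck_flat: "Ck k (flat_exp P)"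
proof (induction k arbitrary: P)
  case 0
  then show ?case
    using flat_has_derivative by (auto intro!: continuous_at_imp_continuous_on DERIV_isCont)
next
  case (Suc k)
  show ?case by (rule Ck_Suc_real[OF flat_has_derivative Suc.IH])
qed

text \<open>
  The denominator is positive because \<open>x\<close> and \<open>1 - x\<close> are never both nonpositive.  The result increases
  from \<open>0\<close> on \<open>x \<le> 0\<close> to \<open>1\<close> on \<open>x \<ge> 1\<close>.
\<close>
definition smooth_step :: "real \<Rightarrow> real" where
  "smooth_step x = flat_exp 1 x * inverse (flat_exp 1 x + flat_exp 1 (1 - x))"

lemma flat_1_nonneg: "0 \<le> flat_exp 1 x" and flat_1_pos_iff: "0 < flat_exp 1 x \<longleftrightarrow> 0 < x"
  by (auto simp: flat_exp_def)

lemma step_denom_pos: "0 < flat_exp 1 x + flat_exp 1 (1 - x)"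
  using flat_1_nonneg[of x] flat_1_nonneg[of "1 - x"] flat_1_pos_iff[of x] flat_1_pos_iff[of "1 - x"]
  by linarith

lemma Ck_reflect: "Ck k f \<Longrightarrow> Ck k (\<lambda>x::real. f (c - a * x))"
  using Ck_comp_linear[of "\<lambda>x. - (a * x)" k "\<lambda>y. f (y + c)"] Ck_shift[of k f c]
  by (simp add: bounded_linear_minus bounded_linear_mult_right)

lemma Ck_smooth_step: "Ck k smooth_step"
  unfolding smooth_step_def[abs_def]
  using Ck_reflect[OF Ck_flat, of k 1 1 1]
  by (intro Ck_mult Ck_flat Ck_inverse Ck_add) (use step_denom_pos in \<open>auto simp: less_imp_neq[symmetric]\<close>)

lemma smooth_step_props:
  "0 \<le> smooth_step x" "smooth_step x \<le> 1" "x \<le> 0 \<Longrightarrow> smooth_step x = 0"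
  "1 \<le> x \<Longrightarrow> smooth_step x = 1"
  using flat_1_nonneg[of x] flat_1_nonneg[of "1 - x"] step_denom_pos[of x]
  by (auto simp: smooth_step_def divide_inverse[symmetric] divide_le_eq_1 flat_exp_def)

lemma smooth_step_mono: "mono smooth_step"
proof (rule monoI)
  have m: "flat_exp 1 x \<le> flat_exp 1 y" if "x \<le> y" for x y
    using that by (auto simp: flat_exp_def frac_le)
  fix x y :: real assume xy: "x \<le> y"
  have "flat_exp 1 x * flat_exp 1 (1 - y) \<le> flat_exp 1 y * flat_exp 1 (1 - x)"
    using xy by (intro mult_mono m flat_1_nonneg) auto
  then show "smooth_step x \<le> smooth_step y"
    using step_denom_pos[of x] step_denom_pos[of y]
    by (simp add: smooth_step_def divide_inverse[symmetric] divide_le_eq le_divide_eq algebra_simps)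
qed

lemma mono_deriv_nonneg:
  fixes f :: "real \<Rightarrow> real"
  assumes "mono f" "(f has_real_derivative D) (at x)" shows "0 \<le> D"
proof (rule tendsto_lowerbound)
  show "((\<lambda>h. (f (x + h) - f x) / h) \<longlongrightarrow> D) (at 0)" using assms(2) by (simp add: DERIV_def)
  show "\<forall>\<^sub>F h in at 0. 0 \<le> (f (x + h) - f x) / h"
  proof (intro always_eventually allI)
    fix h show "0 \<le> (f (x + h) - f x) / h"
      using monoD[OF assms(1), of x "x + h"] monoD[OF assms(1), of "x + h" x]
      by (cases "0 \<le> h") (auto simp: divide_nonneg_nonneg divide_nonpos_nonpos)
  qed
qed simp

text \<open>
  A smooth replacement for the indicator function of \<open>(-\<infinity>, t]\<close>.  On \<open>[0, \<infinity>)\<close> it is nonincreasing and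
  drops from \<open>1\<close> to \<open>0\<close> within \<open>[t, t + \<delta>]\<close>, so there \<open>- deriv \<theta>\<close> is a nonnegative approximation of the
  Dirac mass at \<open>t\<close>.
\<close>
lemma time_cutoff:
  fixes t \<delta> :: real
  assumes "0 \<le> t" "0 < \<delta>"
  obtains \<theta> where "smooth \<theta>" "{s. \<theta> s \<noteq> 0} \<subseteq> {-3..t + \<delta>}" "\<And>s. 0 \<le> s \<Longrightarrow> s \<le> t \<Longrightarrow> \<theta> s = 1"
    "\<And>s. 0 \<le> \<theta> s \<and> \<theta> s \<le> 1" "\<And>s. 0 \<le> s \<Longrightarrow> deriv \<theta> s \<le> 0"
    "\<And>s. 0 \<le> s \<Longrightarrow> s < t \<Longrightarrow> deriv \<theta> s = 0" "\<And>s. t + \<delta> < s \<Longrightarrow> deriv \<theta> s = 0"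
proof -
  \<comment> \<open>The second factor is \<open>1\<close> for \<open>s \<ge> -2\<close>; it only makes the support compact.\<close>
  define \<theta> where "\<theta> s = smooth_step ((t / \<delta> + 1) - (1 / \<delta>) * s) * smooth_step (s + 3)" for s
  have arg: "(t / \<delta> + 1) - (1 / \<delta>) * s = (t - s) / \<delta> + 1" for s by (simp add: field_simps diff_divide_distrib)
  have zero: "\<theta> s = 0" if "t + \<delta> \<le> s" for s
    using that assms unfolding \<theta>_def arg
    by (subst smooth_step_props(3)) (auto simp: field_simps)
  have one: "\<theta> s = 1" if "-1 \<le> s" "s \<le> t" for s
    using that assms unfolding \<theta>_def arg by (simp add: smooth_step_props(4))
  have k: "Ck k \<theta>" for k
    unfolding \<theta>_def[abs_def] by (intro Ck_mult Ck_reflect Ck_shift Ck_smooth_step)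
  have D: "(\<theta> has_real_derivative deriv \<theta> s) (at s)" for s
    by (rule Ck_Suc_real_deriv(1)[OF k])
  have "deriv \<theta> s \<le> 0" if "0 \<le> s" for s
  proof -
    have "((\<lambda>s. - smooth_step ((t / \<delta> + 1) - (1 / \<delta>) * s)) has_real_derivative - deriv \<theta> s) (at s)"
      by (rule has_field_derivative_transform_within_open[where S = "{-1<..}", OF DERIV_minus[OF D]])
        (use that in \<open>auto simp: \<theta>_def smooth_step_props(4)\<close>)
    moreover have "mono (\<lambda>s. - smooth_step ((t / \<delta> + 1) - (1 / \<delta>) * s))"
      using assms by (auto intro!: monoI monoD[OF smooth_step_mono] simp: divide_right_mono)
    ultimately show ?thesis using mono_deriv_nonneg by fastforce
  qed
  moreover have "deriv \<theta> s = 0" if "0 \<le> s" "s < t" for s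
  proof (rule DERIV_unique[OF D])
    have "((\<lambda>_. 1) has_real_derivative 0) (at s)" by simp
    then show "(\<theta> has_real_derivative 0) (at s)"
      by (rule has_field_derivative_transform_within_open[where S = "{-1<..<t}"])
        (use that one in auto)
  qed
  moreover have "deriv \<theta> s = 0" if "t + \<delta> < s" for s
  proof (rule DERIV_unique[OF D])
    have "((\<lambda>_. 0) has_real_derivative 0) (at s)" by simp
    then show "(\<theta> has_real_derivative 0) (at s)"
      by (rule has_field_derivative_transform_within_open[where S = "{t + \<delta><..}"])
        (use that zero in auto)
  qed
  moreover have "{s. \<theta> s \<noteq> 0} \<subseteq> {-3..t + \<delta>}"
  proof
    fix s assume s: "s \<in> {s. \<theta> s \<noteq> 0}"
    then have "smooth_step (s + 3) \<noteq> 0" by (simp add: \<theta>_def)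
    then have "\<not> s + 3 \<le> 0" using smooth_step_props(3) by blast
    moreover have "\<not> t + \<delta> \<le> s" using s zero by blast
    ultimately show "s \<in> {-3..t + \<delta>}" by simp
  qed
  moreover have "0 \<le> \<theta> s \<and> \<theta> s \<le> 1" for s
    by (auto simp: \<theta>_def smooth_step_props intro!: mult_le_one)
  ultimately show thesis using that[of \<theta>] k one by (auto simp: smooth_def)
qed

text \<open>
  The squared norm, unlike the norm, is a polynomial, so that smoothness at the origin needs no argument.
\<close>
definition bump :: "real \<Rightarrow> 'a::euclidean_space \<Rightarrow> real" where
  "bump \<delta> x = flat_exp 1 (\<delta>\<^sup>2 - x \<bullet> x)"

lemma Ck_bump: "Ck k (bump \<delta>)"
  unfolding bump_def[abs_def] by (rule Ck_comp_real[OF Ck_flat Ck_quadratic])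

lemma bump_nonneg: "0 \<le> bump \<delta> x"
  by (simp add: bump_def flat_1_nonneg)

lemma bump_nonzero_iff:
  assumes "0 < \<delta>" shows "bump \<delta> x \<noteq> 0 \<longleftrightarrow> norm x < \<delta>"
proof -
  have "bump \<delta> x \<noteq> 0 \<longleftrightarrow> x \<bullet> x < \<delta>\<^sup>2" by (simp add: bump_def flat_exp_def)
  also have "\<dots> \<longleftrightarrow> (norm x)\<^sup>2 < \<delta>\<^sup>2" by (simp only: power2_norm_eq_inner)
  also have "\<dots> \<longleftrightarrow> norm x < \<delta>"
  proof
    assume "(norm x)\<^sup>2 < \<delta>\<^sup>2" then show "norm x < \<delta>" by (rule power2_less_imp_less) (use assms in simp)
  next
    assume "norm x < \<delta>" then show "(norm x)\<^sup>2 < \<delta>\<^sup>2" by (intro power_strict_mono) auto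
  qed
  finally show ?thesis .
qed

section \<open>Approximation of \<open>C\<^sup>1\<close> functions by test functions\<close>

definition has_continuous_gradient :: "('a::euclidean_space \<Rightarrow> real) \<Rightarrow> ('a \<Rightarrow> 'a) \<Rightarrow> bool" where
  "has_continuous_gradient f G \<longleftrightarrow>
     (\<forall>x. (f has_derivative (\<lambda>v. G x \<bullet> v)) (at x)) \<and> continuous_on UNIV G"

lemma has_continuous_gradientD:
  assumes "has_continuous_gradient f G"
  shows "(f has_derivative (\<lambda>v. G x \<bullet> v)) (at x)" "continuous_on UNIV G" "continuous_on UNIV f"
  using assms unfolding has_continuous_gradient_def
  by (auto intro!: continuous_at_imp_continuous_on has_derivative_continuous)

lemma grad_eq:
  assumes "(f has_derivative (\<lambda>v. G \<bullet> v)) (at x)"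
  shows "grad f x = G"
  unfolding grad_def frechet_derivative_at[OF assms, symmetric] by (rule euclidean_representation)

lemma Ck_has_gradient:
  assumes "Ck (Suc k) f"
  shows "(f has_derivative (\<lambda>v. grad f x \<bullet> v)) (at x)"
proof -
  note d = Ck_has_derivative[OF assms, of x]
  have "frechet_derivative f (at x) v = grad f x \<bullet> v" for v
  proof -
    interpret bounded_linear "frechet_derivative f (at x)" using d by (rule has_derivative_bounded_linear)
    have "frechet_derivative f (at x) (\<Sum>b\<in>Basis. (v \<bullet> b) *\<^sub>R b) = grad f x \<bullet> v"
      unfolding grad_def inner_sum_left sum scaleR by (simp add: inner_commute mult.commute)
    then show ?thesis by (simp add: euclidean_representation)
  qed
  then have "frechet_derivative f (at x) = (\<lambda>v. grad f x \<bullet> v)" by blast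
  with d show ?thesis by simp
qed

lemma smooth_has_continuous_gradient:
  assumes "smooth f" shows "has_continuous_gradient f (grad f)"
proof -
  have k: "Ck k f" for k using assms by (simp add: smooth_def)
  have "Ck 0 (\<lambda>x. frechet_derivative f (at x) v)" for v using k[of "Suc 0"] by simp
  then have "continuous_on UNIV (grad f)"
    unfolding grad_def[abs_def] by (auto intro!: continuous_intros)
  then show ?thesis using Ck_has_gradient[OF k] by (simp add: has_continuous_gradient_def)
qed

text \<open>
  Differentiation under the integral sign; the Leibniz rule is applied to the functionals
  \<open>v \<mapsto> G x t \<bullet> v\<close>, and evaluation commutes with the integral.
\<close>
lemma gradient_integral:
  fixes g :: "'a::euclidean_space \<Rightarrow> 'b::euclidean_space \<Rightarrow> real"
  assumes g: "\<And>x t. ((\<lambda>x. g x t) has_derivative (\<lambda>v. G x t \<bullet> v)) (at x)"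
    and gc: "\<And>x. continuous_on (cbox a b) (g x)"
    and Gc: "continuous_on (UNIV \<times> cbox a b) (\<lambda>(x, t). G x t)"
  shows "((\<lambda>x. integral (cbox a b) (g x)) has_derivative (\<lambda>v. integral (cbox a b) (G x) \<bullet> v)) (at x)"
proof -
  have "continuous_on (cbox a b) (\<lambda>t. (\<lambda>(x, t). G x t) (x, t))"
    by (rule continuous_on_compose2[OF Gc]) (auto intro!: continuous_intros)
  then have Gi: "G x integrable_on cbox a b" by (auto intro: integrable_continuous)
  have "((\<lambda>x. integral (cbox a b) (g x)) has_derivative
      blinfun_apply (integral (cbox a b) (\<lambda>t. blinfun_inner_left (G x t)))) (at x within UNIV)"
  proof (rule leibniz_rule)
    show "((\<lambda>x. g x t) has_derivative blinfun_apply (blinfun_inner_left (G x t))) (at x within UNIV)" for x t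
      using g[of t x] by (simp add: inner_commute)
    show "g x integrable_on cbox a b" for x using gc by (rule integrable_continuous)
    have "(\<lambda>(x, t). blinfun_inner_left (G x t)) = (\<lambda>z. blinfun_inner_left ((\<lambda>(x, t). G x t) z))" by auto
    then show "continuous_on (UNIV \<times> cbox a b) (\<lambda>(x, t). blinfun_inner_left (G x t))"
      using bounded_linear.continuous_on[OF bounded_linear_blinfun_inner_left Gc] by simp
  qed auto
  also have "integral (cbox a b) (\<lambda>t. blinfun_inner_left (G x t)) = blinfun_inner_left (integral (cbox a b) (G x))"
    using integral_linear[OF Gi bounded_linear_blinfun_inner_left] by (simp add: o_def)
  finally show ?thesis by (simp add: inner_commute)
qed

text \<open>
  Every derivative of a convolution may be put on the smooth factor, so \<open>f\<close> need only be continuous.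
\<close>
lemma Ck_convolution:
  fixes f \<eta> :: "'a::euclidean_space \<Rightarrow> real"
  assumes f: "continuous_on UNIV f"
  shows "(\<And>j. Ck j \<eta>) \<Longrightarrow> Ck k (\<lambda>x. integral (cbox a b) (\<lambda>z. f z * \<eta> (x - z)))"
proof (induction k arbitrary: \<eta>)
  case 0
  have \<eta>: "continuous_on UNIV \<eta>" using 0 Ck.simps(1) by blast
  have "continuous_on UNIV (\<lambda>x. integral (cbox a b) (\<lambda>z. f z * \<eta> (x - z)))"
    by (rule integral_continuous_on_param)
      (auto simp: split_beta intro!: continuous_intros continuous_on_compose2[OF f] continuous_on_compose2[OF \<eta>])
  then show ?case by simp
next
  case (Suc k)
  have "smooth \<eta>" using Suc.prems by (simp add: smooth_def)
  note \<eta> = has_continuous_gradientD[OF smooth_has_continuous_gradient[OF this]]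
  have D: "((\<lambda>x. integral (cbox a b) (\<lambda>z. f z * \<eta> (x - z))) has_derivative
     (\<lambda>v. integral (cbox a b) (\<lambda>z. f z *\<^sub>R grad \<eta> (x - z)) \<bullet> v)) (at x)" for x
  proof (rule gradient_integral)
    show "((\<lambda>x. f z * \<eta> (x - z)) has_derivative (\<lambda>v. (f z *\<^sub>R grad \<eta> (x - z)) \<bullet> v)) (at x)" for x z
      using has_derivative_compose[OF has_derivative_diff[OF has_derivative_ident has_derivative_const] \<eta>(1),
          of z x UNIV, THEN has_derivative_mult_right, of "f z"] by simp
  qed (auto simp: split_beta intro!: continuous_intros continuous_on_compose2[OF f]
        continuous_on_compose2[OF \<eta>(2)] continuous_on_compose2[OF \<eta>(3)])
  have eq: "integral (cbox a b) (\<lambda>z. f z *\<^sub>R grad \<eta> (x - z)) \<bullet> v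
      = integral (cbox a b) (\<lambda>z. f z * (grad \<eta> (x - z) \<bullet> v))" for x v
  proof -
    have "(\<lambda>z. f z *\<^sub>R grad \<eta> (x - z)) integrable_on cbox a b"
      by (auto intro!: integrable_continuous continuous_intros continuous_on_subset[OF f]
        continuous_on_compose2[OF \<eta>(2)])
    from integral_linear[OF this bounded_linear_inner_left[of v]] show ?thesis by (simp add: o_def)
  qed
  have "Ck k (\<lambda>x. integral (cbox a b) (\<lambda>z. f z * (grad \<eta> (x - z) \<bullet> v)))" for v
  proof (rule Suc.IH)
    fix j
    have "frechet_derivative \<eta> (at x) = (\<lambda>v. grad \<eta> x \<bullet> v)" for x
      using frechet_derivative_at[OF \<eta>(1)] by simp
    then show "Ck j (\<lambda>x. grad \<eta> x \<bullet> v)" using Suc.prems[of "Suc j"] by simp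
  qed
  then show ?case unfolding Ck_Suc_iff[OF D] eq by blast
qed

lemma lborel_integral_reflect:
  fixes f :: "'a::euclidean_space \<Rightarrow> real"
  assumes "f \<in> borel_measurable borel"
  shows "(LINT z|lborel. f z) = (LINT w|lborel. f (x - w))"
proof -
  have "lborel = distr lborel borel (\<lambda>w::'a. x - w)"
    using lborel_affine[of "-1" x] by (simp add: density_1)
  then show ?thesis using assms integral_distr[of "\<lambda>w. x - w" lborel borel f] by simp
qed

lemma norm_le_imp_cbox: "norm x \<le> R \<Longrightarrow> x \<in> cbox (- (R *\<^sub>R One)) (R *\<^sub>R One)" for x :: "'a::euclidean_space"
  using Basis_le_norm[of _ x] by (force simp: mem_box abs_le_iff)

lemma integral_cbox_eq_lborel:
  fixes f :: "'a::euclidean_space \<Rightarrow> real"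
  assumes f: "continuous_on UNIV f" and z: "\<And>x. x \<notin> cbox a b \<Longrightarrow> f x = 0"
  shows "integral (cbox a b) f = (LINT x|lborel. f x)"
proof -
  have "set_integrable lborel (cbox a b) f"
    unfolding set_integrable_def
    by (rule borel_integrable_compact[OF compact_cbox continuous_on_subset[OF f]]) simp
  from set_borel_integral_eq_integral(2)[OF this]
  have "integral (cbox a b) f = (LINT x|lborel. indicator (cbox a b) x *\<^sub>R f x)"
    by (simp add: set_lebesgue_integral_def)
  also have "\<dots> = (LINT x|lborel. f x)"
    using z by (intro Bochner_Integration.integral_cong) (auto simp: indicator_def)
  finally show ?thesis .
qed

text \<open>
  Uniform continuity on a ball slightly larger than the support suffices: if \<open>x\<close> lies outside of it,
  then \<open>x\<close> and all points at distance less than \<open>1\<close> from \<open>x\<close> are outside the support.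
\<close>
lemma uniform_modulus:
  fixes h :: "'a::euclidean_space \<Rightarrow> 'b::real_normed_vector"
  assumes h: "continuous_on UNIV h" and z: "\<And>x. R < norm x \<Longrightarrow> h x = 0" and e: "0 < e"
  obtains d where "0 < d" "\<And>x w. norm w < d \<Longrightarrow> norm (h (x - w) - h x) \<le> e"
proof -
  have "uniformly_continuous_on (cball 0 (R + 2)) h"
    by (intro compact_uniformly_continuous continuous_on_subset[OF h] compact_cball) auto
  then obtain d where d: "0 < d" and u: "\<And>x y. x \<in> cball 0 (R + 2) \<Longrightarrow> y \<in> cball 0 (R + 2)
      \<Longrightarrow> dist y x < d \<Longrightarrow> dist (h y) (h x) < e"
    by (rule uniformly_continuous_onE[OF _ e]) blast
  show thesis
  proof (rule that[of "min 1 d"])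
    fix x w :: 'a assume w: "norm w < min 1 d"
    have n: "norm x \<le> norm (x - w) + norm w" "norm (x - w) \<le> norm x + norm w"
      using norm_triangle_ineq[of "x - w" w] norm_triangle_ineq4[of x w] by auto
    show "norm (h (x - w) - h x) \<le> e"
    proof (cases "norm x \<le> R + 1")
      case True
      then have "dist (h (x - w)) (h x) < e" using w n by (intro u) (auto simp: dist_norm norm_minus_commute)
      then show ?thesis by (simp add: dist_norm)
    next
      case False
      then show ?thesis using w n z[of x] z[of "x - w"] e by simp
    qed
  qed (use d in auto)
qed

text \<open>
  A weighted average of values that differ from \<open>h x\<close> by at most \<open>e\<close> differs from \<open>h x\<close> by at most \<open>e\<close>.
\<close>
lemma average_estimate:
  fixes h :: "'a::euclidean_space \<Rightarrow> 'b::euclidean_space"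
  assumes h: "continuous_on UNIV h" and \<eta>: "continuous_on UNIV \<eta>" "\<And>w. 0 \<le> \<eta> w"
    and e: "\<And>w. \<eta> w \<noteq> 0 \<Longrightarrow> norm (h (x - w) - h x) \<le> e"
    and c: "c = integral (cbox a b) \<eta>" "0 < c"
  shows "norm ((1 / c) *\<^sub>R integral (cbox a b) (\<lambda>w. \<eta> w *\<^sub>R h (x - w)) - h x) \<le> e"
proof -
  let ?S = "cbox a b"
  have hc: "continuous_on A (\<lambda>w. h (x - w))" for A
    by (auto intro!: continuous_on_compose2[OF h] continuous_intros)
  have \<eta>c: "continuous_on A \<eta>" for A using \<eta>(1) by (rule continuous_on_subset) simp
  have i: "(\<lambda>w. \<eta> w *\<^sub>R h (x - w)) integrable_on ?S" "(\<lambda>w. \<eta> w *\<^sub>R h x) integrable_on ?S"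
     "(\<lambda>w. \<eta> w *\<^sub>R (h (x - w) - h x)) integrable_on ?S" "(\<lambda>w. e * \<eta> w) integrable_on ?S" "\<eta> integrable_on ?S"
    by (intro integrable_continuous continuous_intros hc \<eta>c)+
  have "integral ?S (\<lambda>w. \<eta> w *\<^sub>R (h (x - w) - h x))
      = integral ?S (\<lambda>w. \<eta> w *\<^sub>R h (x - w)) - integral ?S (\<lambda>w. \<eta> w *\<^sub>R h x)"
    using integral_diff[OF i(1,2)] by (simp add: scaleR_diff_right)
  also have "integral ?S (\<lambda>w. \<eta> w *\<^sub>R h x) = c *\<^sub>R h x"
    using integral_linear[OF i(5) bounded_linear_scaleR_left[of "h x"]] by (simp add: o_def c)
  finally have eq: "(1 / c) *\<^sub>R integral ?S (\<lambda>w. \<eta> w *\<^sub>R h (x - w)) - h x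
      = (1 / c) *\<^sub>R integral ?S (\<lambda>w. \<eta> w *\<^sub>R (h (x - w) - h x))"
    using c(2) by (simp add: scaleR_diff_right)
  have "norm (integral ?S (\<lambda>w. \<eta> w *\<^sub>R (h (x - w) - h x))) \<le> integral ?S (\<lambda>w. e * \<eta> w)"
  proof (rule integral_norm_bound_integral[OF i(3,4)])
    fix w show "norm (\<eta> w *\<^sub>R (h (x - w) - h x)) \<le> e * \<eta> w"
      using e[of w] \<eta>(2)[of w] by (cases "\<eta> w = 0") (auto simp: mult.commute mult_right_mono)
  qed
  also have "\<dots> = e * c" by (simp add: c)
  finally show ?thesis unfolding eq using c(2) by (simp add: field_simps)
qed

lemma gradient_zero_outside_support:
  fixes f :: "'a::euclidean_space \<Rightarrow> real"
  assumes fG: "has_continuous_gradient f G" and z: "\<And>x. R < norm x \<Longrightarrow> f x = 0" and x: "R < norm x"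
  shows "G x = 0"
proof -
  have "open {x::'a. R < norm x}" by (intro open_Collect_less continuous_intros)
  have "(f has_derivative (\<lambda>_. 0)) (at x)"
    by (rule has_derivative_transform_within_open[OF has_derivative_const[of 0] \<open>open _\<close>])
      (use x z in auto)
  from has_derivative_unique[OF this has_continuous_gradientD(1)[OF fG]] have "G x \<bullet> G x = 0" by metis
  then show ?thesis by simp
qed

lemma bounded_if_compactly_supported:
  fixes h :: "'a::euclidean_space \<Rightarrow> 'b::real_normed_vector"
  assumes h: "continuous_on UNIV h" and z: "\<And>x. R < norm x \<Longrightarrow> h x = 0"
  obtains C where "0 \<le> C" "\<And>x. norm (h x) \<le> C"
proof -
  have "compact (h ` cball 0 R)"
    by (rule compact_continuous_image[OF continuous_on_subset[OF h] compact_cball]) simp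
  then obtain C where C: "\<And>y. y \<in> h ` cball 0 R \<Longrightarrow> norm y \<le> C"
    using compact_imp_bounded bounded_iff by metis
  have "norm (h x) \<le> max 0 C" for x
    using C[of "h x"] z[of x] by (cases "R < norm x") (auto simp: le_max_iff_disj)
  then show thesis using that[of "max 0 C"] by simp
qed

text \<open>
  The approximation is a mollification \<open>\<psi> = f * \<eta>\<close>.  Written as \<open>\<integral> f(z) \<eta>(x - z) dz\<close> it is smooth, because
  \<open>\<eta>\<close> is; written as \<open>\<integral> f(x - w) \<eta>(w) dw\<close> its gradient is seen to be \<open>G * \<eta>\<close>, so that function and gradient
  are averages of \<open>f\<close> and \<open>G\<close> over small balls and converge uniformly.
\<close>
lemma C1_approximation:
  fixes f :: "'a::euclidean_space \<Rightarrow> real"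
  assumes fG: "has_continuous_gradient f G" and z: "\<And>x. R < norm x \<Longrightarrow> f x = 0" and R: "0 \<le> R"
    and e: "0 < e"
  obtains \<psi> where "\<psi> \<in> test_functions" "\<And>x. \<bar>\<psi> x - f x\<bar> \<le> e" "\<And>x. norm (grad \<psi> x - G x) \<le> e"
proof -
  note f = has_continuous_gradientD[OF fG]
  have Gz: "\<And>x. R < norm x \<Longrightarrow> G x = 0"
    using gradient_zero_outside_support[of f G R] fG z by blast
  obtain d1 where d1: "0 < d1" "\<And>x w. norm w < d1 \<Longrightarrow> norm (f (x - w) - f x) \<le> e"
    using uniform_modulus[OF f(3) z e] by metis
  obtain d2 where d2: "0 < d2" "\<And>x w. norm w < d2 \<Longrightarrow> norm (G (x - w) - G x) \<le> e"
    using uniform_modulus[OF f(2) Gz e] by metis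
  define d where "d = min d1 d2"
  have d: "0 < d" using d1 d2 by (simp add: d_def)
  define \<eta> where "\<eta> = (bump d :: 'a \<Rightarrow> real)"
  have \<eta>k: "Ck k \<eta>" for k by (simp add: \<eta>_def Ck_bump)
  have \<eta>c: "continuous_on UNIV \<eta>" using \<eta>k[of 0] by simp
  have \<eta>0: "0 \<le> \<eta> w" for w by (simp add: \<eta>_def bump_nonneg)
  have \<eta>d: "\<eta> w \<noteq> 0 \<longleftrightarrow> norm w < d" for w using bump_nonzero_iff[OF d] by (simp add: \<eta>_def)
  define S where "S = cbox (- (d *\<^sub>R One)) (d *\<^sub>R One :: 'a)"
  define c where "c = integral S \<eta>"
  have c: "0 < c"
  proof -
    have i: "\<eta> integrable_on S" unfolding S_def
      by (rule integrable_continuous[OF continuous_on_subset[OF \<eta>c]]) simp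
    have "c \<noteq> 0"
    proof
      assume "c = 0"
      then have "(\<eta> has_integral 0) S" using i by (simp add: c_def has_integral_integral)
      then have "\<eta> 0 = 0" unfolding S_def
        by (rule has_integral_0_cbox_imp_0[OF continuous_on_subset[OF \<eta>c], rotated 2])
          (use \<eta>0 d in \<open>auto simp: mem_box box_ne_empty\<close>)
      with \<eta>d[of 0] d show False by simp
    qed
    moreover have "0 \<le> c" unfolding c_def using \<eta>0 by (intro integral_nonneg i)
    ultimately show ?thesis by simp
  qed
  define \<psi> where "\<psi> x = (1 / c) * integral (cbox (- (R *\<^sub>R One)) (R *\<^sub>R One)) (\<lambda>z. f z * \<eta> (x - z))" for x
  have \<psi>_eq: "\<psi> x = (1 / c) *\<^sub>R integral S (\<lambda>w. \<eta> w *\<^sub>R f (x - w))" for x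
  proof -
    have "integral (cbox (- (R *\<^sub>R One)) (R *\<^sub>R One)) (\<lambda>z. f z * \<eta> (x - z)) = (LINT z|lborel. f z * \<eta> (x - z))"
      using z norm_le_imp_cbox[of _ R]
      by (intro integral_cbox_eq_lborel continuous_intros f(3) continuous_on_compose2[OF \<eta>c])
        (auto simp: not_le[symmetric])
    also have "\<dots> = (LINT w|lborel. f (x - w) * \<eta> (x - (x - w)))"
      by (intro lborel_integral_reflect borel_measurable_continuous_onI continuous_intros f(3)
          continuous_on_compose2[OF \<eta>c]) auto
    also have "\<dots> = (LINT w|lborel. \<eta> w * f (x - w))" by (simp add: mult.commute)
    also have "\<dots> = integral S (\<lambda>w. \<eta> w * f (x - w))"
      unfolding S_def
    proof (intro integral_cbox_eq_lborel[symmetric] continuous_intros \<eta>c continuous_on_compose2[OF f(3)])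
      fix w assume "w \<notin> cbox (- (d *\<^sub>R One)) (d *\<^sub>R One :: 'a)"
      then have "\<not> norm w < d" using norm_le_imp_cbox[of w d] by auto
      then have "\<eta> w = 0" using \<eta>d[of w] by simp
      then show "\<eta> w * f (x - w) = 0" by simp
    qed auto
    finally show ?thesis by (simp add: \<psi>_def)
  qed
  have D: "(\<psi> has_derivative (\<lambda>v. ((1 / c) *\<^sub>R integral S (\<lambda>w. \<eta> w *\<^sub>R G (x - w))) \<bullet> v)) (at x)" for x
  proof -
    have "((\<lambda>x. integral S (\<lambda>w. \<eta> w *\<^sub>R f (x - w))) has_derivative
       (\<lambda>v. integral S (\<lambda>w. \<eta> w *\<^sub>R G (x - w)) \<bullet> v)) (at x)"
      unfolding S_def
    proof (rule gradient_integral)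
      show "((\<lambda>x. \<eta> w *\<^sub>R f (x - w)) has_derivative (\<lambda>v. (\<eta> w *\<^sub>R G (x - w)) \<bullet> v)) (at x)" for x w
        using has_derivative_compose[OF has_derivative_diff[OF has_derivative_ident has_derivative_const] f(1),
            of w x UNIV, THEN has_derivative_mult_right, of "\<eta> w"] by simp
    qed (auto simp: split_beta intro!: continuous_intros continuous_on_compose2[OF f(3)]
        continuous_on_compose2[OF \<eta>c] continuous_on_compose2[OF f(2)])
    from has_derivative_scaleR_right[OF this, of "1 / c"] show ?thesis
      unfolding \<psi>_eq[abs_def] by simp
  qed
  show thesis
  proof
    have "Ck k \<psi>" for k
      unfolding \<psi>_def[abs_def] by (intro Ck_mult Ck_const Ck_convolution f(3) \<eta>k)
    moreover have "\<psi> x = 0" if "R + d < norm x" for x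
    proof -
      have "\<eta> w *\<^sub>R f (x - w) = 0" for w
        using \<eta>d[of w] z[of "x - w"] that norm_triangle_ineq[of "x - w" w] by auto
      then have "(\<lambda>w. \<eta> w *\<^sub>R f (x - w)) = (\<lambda>_. 0)" by blast
      then show ?thesis by (simp add: \<psi>_eq)
    qed
    then have "{x. \<psi> x \<noteq> 0} \<subseteq> cball 0 (R + d)" by (auto simp: not_less[symmetric])
    then have "bounded {x. \<psi> x \<noteq> 0}" using bounded_cball bounded_subset by blast
    ultimately show "\<psi> \<in> test_functions" by (auto simp: test_functions_def smooth_def)
    show "\<bar>\<psi> x - f x\<bar> \<le> e" for x
      using average_estimate[OF f(3) \<eta>c \<eta>0 _ c_def[unfolded S_def] c, of x e] d1(2)[of _ x] \<eta>d
      by (auto simp: \<psi>_eq S_def d_def)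
    show "norm (grad \<psi> x - G x) \<le> e" for x
      using average_estimate[OF f(2) \<eta>c \<eta>0 _ c_def[unfolded S_def] c, of x e] d2(2)[of _ x] \<eta>d
      by (auto simp: grad_eq[OF D] S_def d_def)
  qed
qed

section \<open>Pairings along curves that are continuous in the Wasserstein distance\<close>

lemma prob_moment_1D:
  assumes "M \<in> prob_moment 1"
  shows "prob_space M" "sets M = sets borel" "integrable M norm"
proof -
  show ps: "prob_space M" and s: "sets M = sets borel" using assms by (auto simp: prob_moment_def)
  have "(\<integral>\<^sup>+ x. ennreal (norm x) \<partial>M) < \<infinity>"
    using assms by (simp add: prob_moment_def)
  moreover have "norm \<in> borel_measurable M"
    using s by (simp cong: measurable_cong_sets)
  ultimately show "integrable M norm" by (simp add: integrable_iff_bounded)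
qed

lemma continuous_on_slice:
  "continuous_on (S \<times> UNIV) (\<lambda>(p, x). u p x) \<Longrightarrow> p \<in> S \<Longrightarrow> continuous_on UNIV (u p)"
  by (rule continuous_on_compose2[of "S \<times> UNIV" "\<lambda>(p, x). u p x" UNIV "\<lambda>x. (p, x)", simplified])
    (auto intro!: continuous_intros)

text \<open>
  Integrate the pointwise bound \<open>fg\<close> against a coupling of \<open>M\<close> and \<open>N\<close> with cost below \<open>w\<close>.
\<close>
lemma coupling_estimate:
  fixes f g :: "'a::euclidean_space \<Rightarrow> real"
  assumes M: "M \<in> prob_moment 1" and N: "N \<in> prob_moment 1"
    and W: "Wasserstein1 M N < ennreal w"
    and f: "continuous_on UNIV f" "\<And>x. \<bar>f x\<bar> \<le> B" and g: "continuous_on UNIV g" "\<And>x. \<bar>g x\<bar> \<le> B"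
    and nonneg: "0 \<le> b"
    and fg: "\<And>x y. \<bar>f x - g y\<bar> \<le> a + b * norm (x - y) + c * norm y"
  shows "\<bar>(LINT x|M. f x) - (LINT x|N. g x)\<bar> \<le> a + b * w + c * (LINT y|N. norm y)"
proof -
  from W obtain P where P: "P \<in> couplings M N" and Pw: "(\<integral>\<^sup>+ z. ennreal (norm (fst z - snd z)) \<partial>P) < ennreal w"
    unfolding Wasserstein1_def INF_less_iff by blast
  have sP[measurable_cong]: "sets P = sets borel" and P1: "distr P borel fst = M" and P2: "distr P borel snd = N"
    using P by (auto simp: couplings_def)
  have m1[measurable]: "fst \<in> P \<rightarrow>\<^sub>M borel" and m2[measurable]: "snd \<in> P \<rightarrow>\<^sub>M borel"
    unfolding measurable_cong_sets[OF sP refl]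
    by (intro borel_measurable_continuous_onI continuous_intros)+
  have fm[measurable]: "f \<in> borel_measurable borel" and gm[measurable]: "g \<in> borel_measurable borel"
    using f g by (auto intro!: borel_measurable_continuous_onI)
  interpret P: prob_space P
    using prob_moment_1D(1)[OF M] P1 by (intro prob_space_distrD[OF m1]) simp
  have "integrable P (\<lambda>z. norm (fst z - snd z))"
    using Pw by (auto simp: integrable_iff_bounded less_top[symmetric] intro: order.strict_trans1)
  then have iw: "integrable P (\<lambda>z. norm (fst z - snd z))" and
    w: "(LINT z|P. norm (fst z - snd z)) \<le> w"
    using Pw by (auto simp: nn_integral_eq_integral ennreal_less_iff)
  have "integrable (distr P borel snd) norm" using prob_moment_1D(3)[OF N] P2 by simp
  then have in2: "integrable P (\<lambda>z. norm (snd z))" by (simp add: integrable_distr_eq)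
  have i1: "integrable P (\<lambda>z. f (fst z))" and i2: "integrable P (\<lambda>z. g (snd z))"
    using f g by (auto intro!: P.integrable_const_bound[of _ B])
  have "\<bar>(LINT x|M. f x) - (LINT x|N. g x)\<bar> = \<bar>LINT z|P. f (fst z) - g (snd z)\<bar>"
    using i1 i2 by (simp add: P1[symmetric] P2[symmetric] integral_distr)
  also have "\<dots> \<le> (LINT z|P. \<bar>f (fst z) - g (snd z)\<bar>)" by (rule integral_abs_bound)
  also have "\<dots> \<le> (LINT z|P. a + b * norm (fst z - snd z) + c * norm (snd z))"
    using i1 i2 iw in2 fg by (intro integral_mono) auto
  also have "\<dots> = a + b * (LINT z|P. norm (fst z - snd z)) + c * (LINT y|N. norm y)"
    using iw in2 by (simp add: P2[symmetric] integral_distr P.prob_space)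
  also have "\<dots> \<le> a + b * w + c * (LINT y|N. norm y)"
    using w nonneg by (simp add: mult_left_mono)
  finally show ?thesis .
qed

text \<open>
  The integrand and the measure vary simultaneously.  For \<open>p'\<close> close to \<open>p\<close>, the difference of
  \<open>u p' x\<close> and \<open>u p y\<close> is small by uniform continuity if \<open>x\<close> and \<open>y\<close> are close and \<open>y\<close> lies in a large
  ball; otherwise it is at most \<open>2B\<close>, which is dominated by a multiple of \<open>|x - y|\<close> or of \<open>|y|\<close>.  The
  coupling estimate then bounds the first by the transport cost and the second by the first moment of
  the limit measure.
\<close>
lemma continuous_on_pairing:
  fixes u :: "'b::metric_space \<Rightarrow> 'a::euclidean_space \<Rightarrow> real"
  assumes S: "compact S" and u: "continuous_on (S \<times> UNIV) (\<lambda>(p, x). u p x)"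
    and B: "\<And>p x. p \<in> S \<Longrightarrow> \<bar>u p x\<bar> \<le> B"
    and N: "\<And>p. p \<in> S \<Longrightarrow> N p \<in> prob_moment 1"
    and W: "\<And>p. p \<in> S \<Longrightarrow> ((\<lambda>p'. Wasserstein1 (N p') (N p)) \<longlongrightarrow> 0) (at p within S)"
  shows "continuous_on S (\<lambda>p. LINT x|N p. u p x)"
  unfolding continuous_on_def tendsto_iff
proof (intro ballI allI impI)
  fix p and e :: real assume p: "p \<in> S" and e: "0 < e"
  define m where "m = (LINT y|N p. norm y)"
  have m0: "0 \<le> m" by (simp add: m_def)
  have B0: "0 \<le> B" using B[OF p] by (rule order_trans[OF abs_ge_zero])
  \<comment> \<open>Beyond the radius \<open>R\<close> the first moment \<open>m\<close> of \<open>N p\<close> contributes at most \<open>e/4\<close>.\<close>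
  define R where "R = 1 + 8 * B * m / e"
  have R: "1 \<le> R" using B0 m0 e by (simp add: R_def)
  have Rm: "2 * B / R * m \<le> e / 4"
  proof -
    have "2 * B * m \<le> e / 4 * R" using e by (simp add: R_def field_simps)
    then show ?thesis using R by (simp add: field_simps)
  qed
  have "uniformly_continuous_on (S \<times> cball 0 (R + 1)) (\<lambda>(p, x). u p x)"
    by (rule compact_uniformly_continuous[OF continuous_on_subset[OF u] compact_Times[OF S compact_cball]]) auto
  then obtain d0 where d0: "0 < d0" and uc: "\<And>z z'. z \<in> S \<times> cball 0 (R + 1) \<Longrightarrow> z' \<in> S \<times> cball 0 (R + 1)
      \<Longrightarrow> dist z' z < d0 \<Longrightarrow> dist (case z' of (p, x) \<Rightarrow> u p x) (case z of (p, x) \<Rightarrow> u p x) < e / 4"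
    by (rule uniformly_continuous_onE[of _ _ "e / 4"]) (use e in auto)
  define d where "d = min 1 (d0 / 2)"
  have d: "0 < d" "d \<le> 1" "2 * d \<le> d0" using d0 by (auto simp: d_def)
  \<comment> \<open>A transport cost below \<open>w\<close> contributes at most \<open>e/4\<close>; the summand \<open>1\<close> covers \<open>B = 0\<close>.\<close>
  define w where "w = e * d / (8 * B + 1)"
  have w: "0 < w" using e d B0 by (auto simp: w_def intro!: divide_pos_pos)
  have wd: "2 * B / d * w \<le> e / 4"
    using e d B0 by (simp add: w_def field_simps)
  have "\<forall>\<^sub>F p' in at p within S. Wasserstein1 (N p') (N p) < ennreal w"
    using order_tendstoD(2)[OF W[OF p]] w by simp
  moreover have "\<forall>\<^sub>F p' in at p within S. p' \<in> S" by (simp add: eventually_at_filter)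
  moreover have "\<forall>\<^sub>F p' in at p within S. dist p' p < d"
    using d by (auto simp: eventually_at)
  ultimately show "\<forall>\<^sub>F p' in at p within S. dist (LINT x|N p'. u p' x) (LINT x|N p. u p x) < e"
  proof eventually_elim
    case (elim p')
    have "\<bar>(LINT x|N p'. u p' x) - (LINT x|N p. u p x)\<bar> \<le> e / 4 + 2 * B / d * w + 2 * B / R * m"
      unfolding m_def
    proof (rule coupling_estimate[of _ _ _ _ B])
      fix x y
      have bound: "\<bar>u p' x - u p y\<bar> \<le> 2 * B" using B[OF p, of y] B[OF elim(2), of x] by linarith
      consider "d \<le> norm (x - y)" | "R \<le> norm y" | "norm (x - y) < d" "norm y < R" by linarith
      then show "\<bar>u p' x - u p y\<bar> \<le> e / 4 + 2 * B / d * norm (x - y) + 2 * B / R * norm y"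
      proof cases
        case 1
        then have "2 * B * 1 \<le> 2 * B * (norm (x - y) / d)" using B0 d by (intro mult_left_mono) auto
        moreover have "0 \<le> 2 * B / R * norm y" using B0 R by auto
        ultimately show ?thesis using bound e by (simp add: algebra_simps)
      next
        case 2
        then have "2 * B * 1 \<le> 2 * B * (norm y / R)" using B0 R by (intro mult_left_mono) auto
        moreover have "0 \<le> 2 * B / d * norm (x - y)" using B0 d by auto
        ultimately show ?thesis using bound e by (simp add: algebra_simps)
      next
        case 3
        have "norm x \<le> R + 1" using 3 d norm_triangle_ineq2[of x y] by linarith
        moreover have "dist (p', x) (p, y) < d0"
        proof -
          have "dist (p', x) (p, y) \<le> dist p' p + dist x y" by (simp add: dist_Pair_Pair sqrt_sum_squares_le_sum)
          then show ?thesis using 3 elim(3) d by (simp add: dist_norm)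
        qed
        ultimately have "\<bar>u p' x - u p y\<bar> < e / 4"
          using uc[of "(p, y)" "(p', x)"] 3 p elim(2) by (simp add: dist_real_def)
        moreover have "0 \<le> 2 * B / d * norm (x - y)" "0 \<le> 2 * B / R * norm y" using B0 d R by auto
        ultimately show ?thesis by linarith
      qed
    qed (use elim N p B B0 d continuous_on_slice[OF u] in auto)
    then have "\<bar>(LINT x|N p'. u p' x) - (LINT x|N p. u p x)\<bar> \<le> 3 * e / 4" using Rm wd by linarith
    then show ?case using e by (simp add: dist_real_def)
  qed
qed

section \<open>The continuity equation tested with Lipschitz functions\<close>

lemma compact_supportD:
  assumes "\<psi> \<in> test_functions"
  shows "\<exists>R. \<forall>x. R < norm x \<longrightarrow> \<psi> x = 0"
proof -
  have "bounded {x. \<psi> x \<noteq> 0}"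
    using assms bounded_subset[OF compact_imp_bounded closure_subset] by (auto simp: test_functions_def)
  then obtain R where "\<And>x. \<psi> x \<noteq> 0 \<Longrightarrow> norm x \<le> R" by (auto simp: bounded_iff)
  then show ?thesis by (meson not_le)
qed

lemma compactly_supported_C1_bounded:
  assumes fG: "has_continuous_gradient f G" and "\<exists>R. \<forall>x. R < norm x \<longrightarrow> f x = 0"
  obtains C C' where "0 \<le> C" "\<And>x. norm (f x) \<le> C" "0 \<le> C'" "\<And>x. norm (G x) \<le> C'"
proof -
  note f = has_continuous_gradientD[OF fG]
  obtain R where R: "\<And>x. R < norm x \<Longrightarrow> f x = 0" using assms(2) by blast
  have gz: "\<And>x. R < norm x \<Longrightarrow> G x = 0"
    using gradient_zero_outside_support[of f G R] fG R by blast
  show thesis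
    using bounded_if_compactly_supported[OF f(3), of R] bounded_if_compactly_supported[OF f(2), of R] R gz that
    by metis
qed

lemma tensor_test_function:
  fixes \<theta> :: "real \<Rightarrow> real" and \<psi> :: "'a::euclidean_space \<Rightarrow> real"
  assumes \<theta>: "smooth \<theta>" "{s. \<theta> s \<noteq> 0} \<subseteq> {a..b}" and b: "b < T" and \<psi>: "\<psi> \<in> test_functions"
  shows "(\<lambda>(s, x). \<theta> s * \<psi> x) \<in> spacetime_test_functions T"
proof -
  let ?C = "{a..b} \<times> closure {x. \<psi> x \<noteq> 0}"
  have C: "compact ?C" using \<psi> by (auto simp: test_functions_def intro: compact_Times)
  have sub: "closure {z. (case z of (s, x) \<Rightarrow> \<theta> s * \<psi> x) \<noteq> 0} \<subseteq> ?C"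
  proof (rule closure_minimal)
    show "{z. (case z of (s, x) \<Rightarrow> \<theta> s * \<psi> x) \<noteq> 0} \<subseteq> ?C"
      using \<theta>(2) closure_subset[of "{x. \<psi> x \<noteq> 0}"] by fastforce
  qed (rule compact_imp_closed[OF C])
  then have "compact (closure {z. (case z of (s, x) \<Rightarrow> \<theta> s * \<psi> x) \<noteq> 0})"
    using C compact_eq_bounded_closed bounded_subset by blast
  moreover have "Ck k (\<lambda>(s, x). \<theta> s * \<psi> x)" for k
  proof -
    have "Ck k (\<lambda>z. \<theta> (fst z) * \<psi> (snd z))"
      using \<theta>(1) \<psi> by (intro Ck_mult Ck_comp_linear[OF bounded_linear_fst] Ck_comp_linear[OF bounded_linear_snd])
        (auto simp: smooth_def test_functions_def)
    then show ?thesis by (simp add: case_prod_unfold)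
  qed
  moreover have "?C \<subseteq> {..<T} \<times> UNIV" using b by auto
  ultimately show ?thesis
    using sub by (auto simp: spacetime_test_functions_def test_functions_def smooth_def)
qed

lemma abs_inner_le:
  assumes "norm a \<le> B" "norm b \<le> C"
  shows "\<bar>a \<bullet> b\<bar> \<le> B * C"
proof -
  have "\<bar>a \<bullet> b\<bar> \<le> norm a * norm b" by (rule Cauchy_Schwarz_ineq2)
  also have "\<dots> \<le> B * C" using assms by (intro mult_mono order_trans[OF norm_ge_zero]) auto
  finally show ?thesis .
qed

text \<open>
  What is needed of a solution of the continuity equation: a curve of probability measures that is
  continuous in the Wasserstein distance, and a velocity field that is continuous and bounded on finite
  time intervals.  The equation is assumed only for products of a function of time and a function of
  space.
\<close>
locale bounded_flow =
  fixes \<nu> :: "real \<Rightarrow> 'a::euclidean_space measure" and \<nu>0 :: "'a measure" and v :: "real \<Rightarrow> 'a \<Rightarrow> 'a"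
  assumes moment: "\<And>t. 0 \<le> t \<Longrightarrow> \<nu> t \<in> prob_moment 1"
    and W1_continuous: "\<And>T t. 0 \<le> t \<Longrightarrow> t \<le> T \<Longrightarrow> ((\<lambda>s. Wasserstein1 (\<nu> s) (\<nu> t)) \<longlongrightarrow> 0) (at t within {0..T})"
    and v_continuous: "\<And>T. continuous_on ({0..T} \<times> UNIV) (\<lambda>(t, x). v t x)"
    and v_bounded: "\<And>T. \<exists>B. \<forall>t\<in>{0..T}. \<forall>x. norm (v t x) \<le> B"
    and weak: "\<And>T \<theta> a b \<psi>. smooth \<theta> \<Longrightarrow> {s. \<theta> s \<noteq> 0} \<subseteq> {a..b} \<Longrightarrow> b < T \<Longrightarrow> 0 < T \<Longrightarrow> \<psi> \<in> test_functions \<Longrightarrow>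
      (LINT t:{0..T}|lborel. LINT x|\<nu> t. deriv \<theta> t * \<psi> x + \<theta> t * (v t x \<bullet> grad \<psi> x))
        + \<theta> 0 * (LINT x|\<nu>0. \<psi> x) = 0"
begin

lemma continuous_pairing:
  fixes u :: "real \<Rightarrow> 'a \<Rightarrow> real"
  assumes u: "continuous_on ({0..T} \<times> UNIV) (\<lambda>(t, x). u t x)"
    and B: "\<And>t x. 0 \<le> t \<Longrightarrow> t \<le> T \<Longrightarrow> \<bar>u t x\<bar> \<le> B"
  shows "continuous_on {0..T} (\<lambda>t. LINT x|\<nu> t. u t x)"
  by (rule continuous_on_pairing[OF compact_Icc u, of B]) (use B moment W1_continuous in auto)

lemma
  assumes "0 \<le> t"
  shows \<nu>_prob: "prob_space (\<nu> t)" and \<nu>_sets: "sets (\<nu> t) = sets borel" and \<nu>_moment: "integrable (\<nu> t) norm"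
  using prob_moment_1D[OF moment[OF assms]] by auto

lemma integrable_bounded_continuous:
  fixes f :: "'a \<Rightarrow> real"
  assumes "0 \<le> t" "continuous_on UNIV f" "\<And>x. \<bar>f x\<bar> \<le> B"
  shows "integrable (\<nu> t) f"
proof -
  interpret prob_space "\<nu> t" by (rule \<nu>_prob[OF assms(1)])
  show ?thesis
    using borel_measurable_continuous_onI[OF assms(2)] assms(3)
    by (intro integrable_const_bound[of _ B]) (auto simp: measurable_cong_sets[OF \<nu>_sets[OF assms(1)] refl])
qed

definition flux :: "('a \<Rightarrow> 'a) \<Rightarrow> real \<Rightarrow> real" where
  "flux G \<tau> = (LINT x|\<nu> \<tau>. v \<tau> x \<bullet> G x)"

lemma continuous_flux:
  assumes G: "continuous_on UNIV G" "\<And>x. norm (G x) \<le> C"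
  shows "continuous_on {0..T} (flux G)"
proof -
  obtain B where "\<And>t x. t \<in> {0..T} \<Longrightarrow> norm (v t x) \<le> B" using v_bounded by blast
  note B = this
  have b: "\<bar>v t x \<bullet> G x\<bar> \<le> B * C" if "t \<in> {0..T}" for t x using that by (intro abs_inner_le B G)
  have "continuous_on ({0..T} \<times> UNIV) (\<lambda>z. (case z of (t, x) \<Rightarrow> v t x) \<bullet> G (snd z))"
    by (intro continuous_intros v_continuous continuous_on_compose2[OF G(1)]) auto
  then show ?thesis unfolding flux_def[abs_def]
    by (intro continuous_pairing[of _ _ "B * C"]) (use b in \<open>auto simp: split_beta\<close>)
qed

lemma weak_tensor:
  assumes \<theta>: "smooth \<theta>" "{s. \<theta> s \<noteq> 0} \<subseteq> {a..b}" and b: "b < T" and T: "0 < T" and \<psi>: "\<psi> \<in> test_functions"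
  shows "integral {0..T} (\<lambda>t. deriv \<theta> t * (LINT x|\<nu> t. \<psi> x) + \<theta> t * flux (grad \<psi>) t)
     + \<theta> 0 * (LINT x|\<nu>0. \<psi> x) = 0"
proof -
  have "smooth \<psi>" using \<psi> by (simp add: test_functions_def)
  note s\<psi> = smooth_has_continuous_gradient[OF this]
  note g = has_continuous_gradientD[OF s\<psi>]
  obtain C C' where C: "\<And>x. norm (\<psi> x) \<le> C" and C': "\<And>x. norm (grad \<psi> x) \<le> C'"
    using compactly_supported_C1_bounded[OF s\<psi> compact_supportD[OF \<psi>]] by metis
  obtain B where B: "\<And>t x. t \<in> {0..T} \<Longrightarrow> norm (v t x) \<le> B" using v_bounded by blast
  have k: "Ck k \<theta>" for k using \<theta>(1) by (simp add: smooth_def)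
  note D = Ck_Suc_real_deriv(1)[OF k]
  have dc: "continuous_on A (deriv \<theta>)" for A
    using Ck_Suc_real_deriv(2)[OF k, of 0] continuous_on_subset by auto
  have tc: "continuous_on A \<theta>" for A using k[of 0] continuous_on_subset by auto
  have mc: "continuous_on {0..T} (\<lambda>t. LINT x|\<nu> t. \<psi> x)"
    by (rule continuous_pairing[of _ _ C])
      (use C in \<open>auto simp: split_beta intro!: continuous_on_compose2[OF g(3)] continuous_intros\<close>)
  let ?f = "\<lambda>t. deriv \<theta> t * (LINT x|\<nu> t. \<psi> x) + \<theta> t * flux (grad \<psi>) t"
  have inner: "(LINT x|\<nu> t. deriv \<theta> t * \<psi> x + \<theta> t * (v t x \<bullet> grad \<psi> x)) = ?f t" if t: "t \<in> {0..T}" for t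
  proof -
    have i1: "integrable (\<nu> t) \<psi>" using t C by (intro integrable_bounded_continuous[of _ _ C] g(3)) auto
    have i2: "integrable (\<nu> t) (\<lambda>x. v t x \<bullet> grad \<psi> x)"
      using t abs_inner_le[OF B[OF t] C'] by (intro integrable_bounded_continuous[of _ _ "B * C'"] continuous_intros g(2)
        continuous_on_slice[OF v_continuous[of T]]) auto
    show ?thesis using i1 i2 by (simp add: flux_def)
  qed
  have fc: "continuous_on {0..T} ?f"
    by (intro continuous_intros dc tc mc continuous_flux[OF g(2) C'])
  have si: "set_integrable lborel {0..T} ?f"
    unfolding set_integrable_def by (rule borel_integrable_compact[OF compact_Icc fc])
  have "(LINT t:{0..T}|lborel. LINT x|\<nu> t. deriv \<theta> t * \<psi> x + \<theta> t * (v t x \<bullet> grad \<psi> x))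
      = (LINT t:{0..T}|lborel. ?f t)"
    by (rule set_lebesgue_integral_cong) (use inner in auto)
  then have "(LINT t:{0..T}|lborel. ?f t) + \<theta> 0 * (LINT x|\<nu>0. \<psi> x) = 0"
    using weak[OF \<theta> b T \<psi>] by simp
  then show ?thesis using set_borel_integral_eq_integral(2)[OF si] by simp
qed

text \<open>
  Let \<open>m(t) = \<integral> \<psi> d\<nu>\<^sub>t\<close>, and choose for \<open>\<theta>\<close> the cut-off in time.  Since \<open>- deriv \<theta>\<close> is an
  approximate Dirac mass at \<open>t\<close> and \<open>\<theta>\<close> approximates the indicator function of \<open>[0, t]\<close>, the weak equation
  becomes \<open>- m(t) + \<integral>\<^sub>0\<^sup>t flux + m\<^sub>0 = 0\<close> up to an error controlled by the continuity of \<open>m\<close> at \<open>t\<close>.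
\<close>
lemma duality_test_function_initial:
  assumes \<psi>: "\<psi> \<in> test_functions" and t: "0 \<le> t"
  shows "(LINT x|\<nu> t. \<psi> x) = (LINT x|\<nu>0. \<psi> x) + integral {0..t} (flux (grad \<psi>))"
proof -
  have "smooth \<psi>" using \<psi> by (simp add: test_functions_def)
  note s\<psi> = smooth_has_continuous_gradient[OF this]
  note g = has_continuous_gradientD[OF s\<psi>]
  obtain C C' where C: "\<And>x. norm (\<psi> x) \<le> C" and C': "\<And>x. norm (grad \<psi> x) \<le> C'"
    using compactly_supported_C1_bounded[OF s\<psi> compact_supportD[OF \<psi>]] by metis
  \<comment> \<open>Any later time will do: the cut-off must be able to vanish between \<open>t\<close> and \<open>T\<close>.\<close>
  define T where "T = t + 1"
  define m where "m s = (LINT x|\<nu> s. \<psi> x)" for s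
  define m0 where "m0 = (LINT x|\<nu>0. \<psi> x)"
  define k where "k = flux (grad \<psi>)"
  have mc: "continuous_on {0..T} m" unfolding m_def[abs_def]
    by (rule continuous_pairing[of _ _ C])
      (use C in \<open>auto simp: split_beta intro!: continuous_on_compose2[OF g(3)] continuous_intros\<close>)
  have kc: "continuous_on {0..T} k" unfolding k_def by (rule continuous_flux[OF g(2) C'])
  have "compact (k ` {0..T})" using kc by (rule compact_continuous_image) simp
  then obtain Bk where Bk: "\<And>s. s \<in> {0..T} \<Longrightarrow> norm (k s) \<le> Bk"
    using compact_imp_bounded bounded_iff by (metis image_eqI)
  have Bk0: "0 \<le> Bk" using Bk[of 0] t norm_ge_zero[of "k 0"] by (auto simp: T_def simp del: norm_ge_zero)
  have "\<bar>m0 + integral {0..t} k - m t\<bar> \<le> e" if e: "0 < e" for e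
  proof -
    obtain d where d: "0 < d" and dm: "\<And>s. s \<in> {0..T} \<Longrightarrow> dist s t < d \<Longrightarrow> dist (m s) (m t) < e / 2"
      using mc[unfolded continuous_on_iff, rule_format, of t "e / 2"] t e by (auto simp: T_def)
    \<comment> \<open>Small enough for the cut-off to vanish before \<open>T\<close>, for \<open>m\<close> to be nearly constant on the transition
      interval, and for the flux through this interval to be at most \<open>e/2\<close>.\<close>
    define \<delta> where "\<delta> = min (min (1 / 2) (d / 2)) (e / (2 * (Bk + 1)))"
    have \<delta>: "0 < \<delta>" "\<delta> < 1" "\<delta> < d" "\<delta> * Bk \<le> e / 2"
    proof -
      show "0 < \<delta>" "\<delta> < 1" "\<delta> < d" using d e Bk0 by (auto simp: \<delta>_def intro!: divide_pos_pos)
      have "\<delta> * Bk \<le> e / (2 * (Bk + 1)) * Bk" using Bk0 by (intro mult_right_mono) (auto simp: \<delta>_def)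
      also have "\<dots> \<le> e / 2" using Bk0 e by (simp add: field_simps)
      finally show "\<delta> * Bk \<le> e / 2" .
    qed
    obtain \<theta> where \<theta>: "smooth \<theta>" "{s. \<theta> s \<noteq> 0} \<subseteq> {-3..t + \<delta>}" and one: "\<And>s. 0 \<le> s \<Longrightarrow> s \<le> t \<Longrightarrow> \<theta> s = 1"
      and \<theta>01: "\<And>s. 0 \<le> \<theta> s \<and> \<theta> s \<le> 1" and neg: "\<And>s. 0 \<le> s \<Longrightarrow> deriv \<theta> s \<le> 0"
      and flat: "\<And>s. 0 \<le> s \<Longrightarrow> s < t \<Longrightarrow> deriv \<theta> s = 0" "\<And>s. t + \<delta> < s \<Longrightarrow> deriv \<theta> s = 0"
      using time_cutoff[OF t \<delta>(1)] by metis
    have Ck: "Ck k \<theta>" for k using \<theta>(1) by (simp add: smooth_def)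
    note D = Ck_Suc_real_deriv(1)[OF Ck]
    have dc: "continuous_on A (deriv \<theta>)" for A
      using Ck_Suc_real_deriv(2)[OF Ck, of 0] continuous_on_subset by auto
    have tc: "continuous_on A \<theta>" for A using Ck[of 0] continuous_on_subset by auto
    have T: "0 < T" "t + \<delta> < T" "t < T" using t \<delta> by (auto simp: T_def)
    have \<theta>0: "\<theta> s = 0" if "t + \<delta> < s" for s using \<theta>(2) that by force
    have eq: "integral {0..T} (\<lambda>s. deriv \<theta> s * m s + \<theta> s * k s) + m0 = 0"
      using weak_tensor[OF \<theta> T(2,1) \<psi>] one[of 0] t by (simp add: m_def m0_def k_def)
    have cs: "continuous_on A k" if "A \<subseteq> {0..T}" for A using kc that by (rule continuous_on_subset)
    have i: "(\<lambda>s. deriv \<theta> s * m s) integrable_on {0..T}" "(\<lambda>s. \<theta> s * k s) integrable_on {0..T}"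
      "(\<lambda>s. deriv \<theta> s * m t) integrable_on {0..T}" "(\<lambda>s. deriv \<theta> s * (m s - m t)) integrable_on {0..T}"
      "(\<lambda>s. - deriv \<theta> s * (e / 2)) integrable_on {0..T}" "(\<lambda>s. \<theta> s * k s) integrable_on {t..T}"
      by (intro integrable_continuous_interval continuous_intros dc tc mc cs; use t in force)+
    have "(deriv \<theta> has_integral \<theta> T - \<theta> 0) {0..T}"
      using T D by (intro fundamental_theorem_of_calculus)
        (auto simp: has_real_derivative_iff_has_vector_derivative[symmetric] intro: has_field_derivative_at_within)
    then have I\<theta>: "(deriv \<theta> has_integral -1) {0..T}" using \<theta>0[OF T(2)] one[of 0] t by simp
    have A: "\<bar>integral {0..T} (\<lambda>s. deriv \<theta> s * m s) + m t\<bar> \<le> e / 2"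
    proof -
      have "integral {0..T} (\<lambda>s. deriv \<theta> s * (m s - m t))
          = integral {0..T} (\<lambda>s. deriv \<theta> s * m s) - integral {0..T} (\<lambda>s. deriv \<theta> s * m t)"
        using integral_diff[OF i(1,3)] by (simp add: right_diff_distrib)
      also have "integral {0..T} (\<lambda>s. deriv \<theta> s * m t) = - m t"
        by (simp add: integral_unique[OF I\<theta>])
      finally have "\<bar>integral {0..T} (\<lambda>s. deriv \<theta> s * m s) + m t\<bar> = norm (integral {0..T} (\<lambda>s. deriv \<theta> s * (m s - m t)))"
        by simp
      also have "\<dots> \<le> integral {0..T} (\<lambda>s. - deriv \<theta> s * (e / 2))"
      proof (rule integral_norm_bound_integral[OF i(4,5)])
        fix s assume s: "s \<in> {0..T}"
        show "norm (deriv \<theta> s * (m s - m t)) \<le> - deriv \<theta> s * (e / 2)"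
        proof (cases "t \<le> s \<and> s \<le> t + \<delta>")
          case True
          then have "dist (m s) (m t) < e / 2" using \<delta> s by (intro dm) (auto simp: dist_real_def)
          then have "\<bar>m s - m t\<bar> \<le> e / 2" by (simp add: dist_real_def)
          then have "\<bar>deriv \<theta> s\<bar> * \<bar>m s - m t\<bar> \<le> \<bar>deriv \<theta> s\<bar> * (e / 2)" by (rule mult_left_mono) simp
          then show ?thesis using neg[of s] s by (simp add: abs_mult)
        next
          case False
          then have "deriv \<theta> s = 0" using flat s by force
          then show ?thesis by simp
        qed
      qed
      also have "\<dots> = e / 2"
        by (simp add: integral_unique[OF I\<theta>])
      finally show ?thesis .
    qed
    have Bd: "\<bar>integral {0..T} (\<lambda>s. \<theta> s * k s) - integral {0..t} k\<bar> \<le> e / 2"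
    proof -
      have "integral {0..T} (\<lambda>s. \<theta> s * k s) = integral {0..t} (\<lambda>s. \<theta> s * k s) + integral {t..T} (\<lambda>s. \<theta> s * k s)"
        using Henstock_Kurzweil_Integration.integral_combine[OF t _ i(2)] T by simp
      also have "integral {0..t} (\<lambda>s. \<theta> s * k s) = integral {0..t} k"
        using one by (intro integral_cong) auto
      also have "integral {t..T} (\<lambda>s. \<theta> s * k s)
          = integral {t..t + \<delta>} (\<lambda>s. \<theta> s * k s) + integral {t + \<delta>..T} (\<lambda>s. \<theta> s * k s)"
        using Henstock_Kurzweil_Integration.integral_combine[OF _ _ i(6), of "t + \<delta>"] T \<delta> by simp
      also have "integral {t + \<delta>..T} (\<lambda>s. \<theta> s * k s) = 0"
      proof -
        have "\<theta> s * k s = 0" if "s \<in> {t + \<delta>..T} - {t + \<delta>}" for s using \<theta>0 that by simp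
        then have "((\<lambda>s. \<theta> s * k s) has_integral 0) {t + \<delta>..T}"
          using has_integral_spike_finite[of "{t + \<delta>}" "{t + \<delta>..T}" "\<lambda>s. \<theta> s * k s" "\<lambda>_. 0" 0]
          by (auto simp: has_integral_0)
        then show ?thesis by (rule integral_unique)
      qed
      finally have "\<bar>integral {0..T} (\<lambda>s. \<theta> s * k s) - integral {0..t} k\<bar> = norm (integral {t..t + \<delta>} (\<lambda>s. \<theta> s * k s))"
        by simp
      also have "\<dots> \<le> Bk * (t + \<delta> - t)"
      proof (rule integral_bound)
        show "continuous_on {t..t + \<delta>} (\<lambda>s. \<theta> s * k s)"
          by (intro continuous_intros tc cs) (use t T in auto)
        fix s assume s: "s \<in> {t..t + \<delta>}"
        have "\<bar>\<theta> s\<bar> * \<bar>k s\<bar> \<le> 1 * Bk"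
          using \<theta>01[of s] Bk[of s] s t T by (intro mult_mono) auto
        then show "norm (\<theta> s * k s) \<le> Bk" by (simp add: abs_mult)
      qed (use \<delta> in simp)
      also have "\<dots> \<le> e / 2" using \<delta>(4) by (simp add: mult.commute)
      finally show ?thesis .
    qed
    have "integral {0..T} (\<lambda>s. deriv \<theta> s * m s + \<theta> s * k s)
        = integral {0..T} (\<lambda>s. deriv \<theta> s * m s) + integral {0..T} (\<lambda>s. \<theta> s * k s)"
      by (rule Henstock_Kurzweil_Integration.integral_add[OF i(1,2)])
    with eq A Bd show ?thesis by linarith
  qed
  then have "\<bar>m0 + integral {0..t} k - m t\<bar> \<le> 0" by (rule field_le_epsilon) simp
  then show ?thesis by (simp add: m_def m0_def k_def)
qed

text \<open>
  The continuity equation tested with \<open>f\<close>, whose gradient is \<open>G\<close>, and integrated in time.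
\<close>
definition duality :: "('a \<Rightarrow> real) \<Rightarrow> ('a \<Rightarrow> 'a) \<Rightarrow> bool" where
  "duality f G \<longleftrightarrow> (\<forall>s t. 0 \<le> s \<longrightarrow> s \<le> t \<longrightarrow>
     (LINT x|\<nu> t. f x) - (LINT x|\<nu> s. f x) = integral {s..t} (flux G))"

lemma duality_test_function:
  assumes \<psi>: "\<psi> \<in> test_functions"
  shows "duality \<psi> (grad \<psi>)"
  unfolding duality_def
proof (intro allI impI)
  fix s t :: real assume st: "0 \<le> s" "s \<le> t"
  have "smooth \<psi>" using \<psi> by (simp add: test_functions_def)
  note s\<psi> = smooth_has_continuous_gradient[OF this]
  obtain C' where C': "\<And>x. norm (grad \<psi> x) \<le> C'"
    using compactly_supported_C1_bounded[OF s\<psi> compact_supportD[OF \<psi>]] by metis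
  have "flux (grad \<psi>) integrable_on {0..t}"
    by (intro integrable_continuous_interval continuous_flux[OF has_continuous_gradientD(2)[OF s\<psi>] C'])
  from Henstock_Kurzweil_Integration.integral_combine[OF st this]
  show "(LINT x|\<nu> t. \<psi> x) - (LINT x|\<nu> s. \<psi> x) = integral {s..t} (flux (grad \<psi>))"
    using duality_test_function_initial[OF \<psi>, of t] duality_test_function_initial[OF \<psi>, of s] st by simp
qed

text \<open>
  The bounds are those that survive integration: \<open>\<nu>\<^sub>t\<close> has a first moment, so \<open>f\<close> may grow linearly, and
  the velocity is bounded, so bounded gradients have bounded flux.
\<close>
lemma duality_dominated_limit:
  assumes dual: "\<And>n. duality (f n) (G n)"
    and c: "\<And>n. continuous_on UNIV (f n)" "\<And>n. continuous_on UNIV (G n)"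
    and lim: "\<And>x. (\<lambda>n. f n x) \<longlonglongrightarrow> F x" "\<And>x. (\<lambda>n. G n x) \<longlonglongrightarrow> H x"
    and b: "\<And>n x. \<bar>f n x\<bar> \<le> C * (1 + norm x)" "\<And>n x. norm (G n x) \<le> C"
    and cl: "continuous_on UNIV F" "continuous_on UNIV H"
  shows "duality F H"
  unfolding duality_def
proof (intro allI impI)
  fix s t :: real assume st: "0 \<le> s" "s \<le> t"
  have L: "(\<lambda>n. LINT x|\<nu> r. f n x) \<longlonglongrightarrow> (LINT x|\<nu> r. F x)" if r: "0 \<le> r" for r
  proof (rule integral_dominated_convergence[where w = "\<lambda>x. C * (1 + norm x)"])
    interpret prob_space "\<nu> r" by (rule \<nu>_prob[OF r])
    show "integrable (\<nu> r) (\<lambda>x. C * (1 + norm x))" using \<nu>_moment[OF r] by simp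
  qed (use lim b c cl \<nu>_sets[OF r] in \<open>auto simp: measurable_cong_sets[OF \<nu>_sets[OF r] refl] intro!: borel_measurable_continuous_onI\<close>)
  obtain B where B: "\<And>r x. r \<in> {0..t} \<Longrightarrow> norm (v r x) \<le> B" using v_bounded by blast
  have Fl: "(\<lambda>n. flux (G n) r) \<longlonglongrightarrow> flux H r" if r: "r \<in> {0..t}" for r
    unfolding flux_def
  proof (rule integral_dominated_convergence[where w = "\<lambda>x. B * C"])
    have r0: "0 \<le> r" using r by simp
    interpret prob_space "\<nu> r" by (rule \<nu>_prob[OF r0])
    show "integrable (\<nu> r) (\<lambda>x. B * C)" by simp
    have vc: "continuous_on UNIV (v r)" by (rule continuous_on_slice[OF v_continuous r])
    show "(\<lambda>x. v r x \<bullet> H x) \<in> borel_measurable (\<nu> r)" "(\<lambda>x. v r x \<bullet> G n x) \<in> borel_measurable (\<nu> r)" for n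
      unfolding measurable_cong_sets[OF \<nu>_sets[OF r0] refl]
      by (intro borel_measurable_continuous_onI continuous_intros vc c cl)+
    show "AE x in \<nu> r. norm (v r x \<bullet> G n x) \<le> B * C" for n
      using abs_inner_le[OF B[OF r] b(2)] by auto
    show "AE x in \<nu> r. (\<lambda>n. v r x \<bullet> G n x) \<longlonglongrightarrow> v r x \<bullet> H x"
      by (intro always_eventually allI tendsto_intros lim)
  qed
  have "(\<lambda>n. integral {s..t} (flux (G n))) \<longlonglongrightarrow> integral {s..t} (flux H)"
  proof (rule dominated_convergence(2)[where h = "\<lambda>_. B * C"])
    show "flux (G n) integrable_on {s..t}" for n
      using continuous_on_subset[OF continuous_flux[OF c(2) b(2)], of "{s..t}" t n] st
      by (intro integrable_continuous_interval) auto
    show "norm (flux (G n) r) \<le> B * C" if "r \<in> {s..t}" for n r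
    proof -
      have r: "r \<in> {0..t}" using that st by simp
      then interpret prob_space "\<nu> r" using \<nu>_prob by simp
      have "integrable (\<nu> r) (\<lambda>x. v r x \<bullet> G n x)"
        using r abs_inner_le[OF B[OF r] b(2)] by (intro integrable_bounded_continuous[of _ _ "B * C"] continuous_intros c
          continuous_on_slice[OF v_continuous[of t]]) auto
      then have "\<bar>flux (G n) r\<bar> \<le> (LINT x|\<nu> r. B * C)"
        unfolding flux_def using abs_inner_le[OF B[OF r] b(2)]
        by (intro order_trans[OF integral_abs_bound] integral_mono) auto
      then show ?thesis by (simp add: prob_space)
    qed
    show "(\<lambda>n. flux (G n) r) \<longlonglongrightarrow> flux H r" if "r \<in> {s..t}" for r using Fl that st by simp
  qed auto
  moreover have "(\<lambda>n. (LINT x|\<nu> t. f n x) - (LINT x|\<nu> s. f n x)) \<longlonglongrightarrow> (LINT x|\<nu> t. F x) - (LINT x|\<nu> s. F x)"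
    using st by (intro tendsto_diff L) auto
  moreover have "(LINT x|\<nu> t. f n x) - (LINT x|\<nu> s. f n x) = integral {s..t} (flux (G n))" for n
    using dual st by (simp add: duality_def)
  ultimately show "(LINT x|\<nu> t. F x) - (LINT x|\<nu> s. F x) = integral {s..t} (flux H)"
    using LIMSEQ_unique by auto
qed

lemma duality_compactly_supported_C1:
  assumes fG: "has_continuous_gradient f G" and z: "\<And>x. R < norm x \<Longrightarrow> f x = 0" and R: "0 \<le> R"
  shows "duality f G"
proof -
  note f = has_continuous_gradientD[OF fG]
  have "\<exists>\<psi>. \<psi> \<in> test_functions \<and> (\<forall>x. \<bar>\<psi> x - f x\<bar> \<le> inverse (real (Suc n)))
      \<and> (\<forall>x. norm (grad \<psi> x - G x) \<le> inverse (real (Suc n)))" for n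
    by (rule C1_approximation[OF fG z R, of "inverse (real (Suc n))"]) auto
  then obtain \<psi> where \<psi>: "\<And>n. \<psi> n \<in> test_functions" "\<And>n x. \<bar>\<psi> n x - f x\<bar> \<le> inverse (real (Suc n))"
      "\<And>n x. norm (grad (\<psi> n) x - G x) \<le> inverse (real (Suc n))"
    by metis
  have "\<exists>R. \<forall>x. R < norm x \<longrightarrow> f x = 0" using z by blast
  from compactly_supported_C1_bounded[OF fG this]
  obtain C C' where C: "0 \<le> C" "\<And>x. norm (f x) \<le> C" and C': "0 \<le> C'" "\<And>x. norm (G x) \<le> C'" by metis
  have s: "has_continuous_gradient (\<psi> n) (grad (\<psi> n))" for n
    using \<psi>(1) by (intro smooth_has_continuous_gradient) (simp add: test_functions_def)
  have inv: "inverse (real (Suc n)) \<le> 1" for n by (simp add: field_simps)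
  show ?thesis
  proof (rule duality_dominated_limit[where C = "C + C' + 1"])
    show "duality (\<psi> n) (grad (\<psi> n))" for n by (rule duality_test_function[OF \<psi>(1)])
    show "(\<lambda>n. \<psi> n x) \<longlonglongrightarrow> f x" for x
      by (rule LIM_zero_cancel, rule Lim_null_comparison[OF _ LIMSEQ_inverse_real_of_nat]) (use \<psi>(2) in auto)
    show "(\<lambda>n. grad (\<psi> n) x) \<longlonglongrightarrow> G x" for x
      by (rule LIM_zero_cancel, rule Lim_null_comparison[OF _ LIMSEQ_inverse_real_of_nat]) (use \<psi>(3) in auto)
    show "\<bar>\<psi> n x\<bar> \<le> (C + C' + 1) * (1 + norm x)" for n x
    proof -
      have "\<bar>\<psi> n x\<bar> \<le> C + C' + 1" using \<psi>(2)[of n x] inv[of n] C(2)[of x] C'(1) by auto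
      also have "\<dots> \<le> (C + C' + 1) * (1 + norm x)" using C(1) C'(1) by (simp add: mult_le_cancel_left1)
      finally show ?thesis .
    qed
    show "norm (grad (\<psi> n) x) \<le> C + C' + 1" for n x
      using norm_triangle_ineq2[of "grad (\<psi> n) x" "G x"] \<psi>(3)[of n x] inv[of n] C'(2)[of x] C(1) by linarith
  qed (use has_continuous_gradientD[OF s] f in auto)
qed

text \<open>
  Multiply \<open>f\<close> by \<open>\<kappa>(x/n)\<close> with \<open>\<kappa>\<close> a bump function equal to \<open>1\<close> at the origin.  The cut-off contributes
  \<open>f(x) \<nabla>\<kappa>(x/n) / n\<close> to the gradient; it is bounded uniformly in \<open>n\<close>, because \<open>f\<close> grows at most linearly and \<open>|x| \<le> n\<close>
  on the support, and it tends to \<open>0\<close> pointwise.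
\<close>
theorem duality_Lipschitz:
  assumes fG: "has_continuous_gradient f G" and L: "\<And>x. norm (G x) \<le> L"
  shows "duality f G"
proof -
  note f = has_continuous_gradientD[OF fG]
  have L0: "0 \<le> L" using L norm_ge_zero order_trans by blast
  have fb: "\<bar>f x\<bar> \<le> \<bar>f 0\<bar> + L * norm x" for x
  proof -
    have "norm (f x - f 0) \<le> L * norm (x - 0)"
    proof (rule differentiable_bound[OF convex_UNIV])
      show "(f has_derivative (\<lambda>v. G x \<bullet> v)) (at x within UNIV)" for x using f(1) by simp
      show "onorm (\<lambda>v. G x \<bullet> v) \<le> L" for x
        using L[of x] by (intro onorm_bound) (auto intro!: order_trans[OF Cauchy_Schwarz_ineq2] mult_right_mono L0)
    qed auto
    then show ?thesis by simp
  qed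
  define \<kappa> where "\<kappa> x = bump 1 x / bump 1 (0::'a)" for x :: 'a
  have b0: "bump 1 (0::'a) \<noteq> 0" by (simp add: bump_nonzero_iff)
  have "Ck k \<kappa>" for k
    unfolding \<kappa>_def[abs_def] divide_inverse by (intro Ck_mult Ck_const Ck_bump)
  then have s: "has_continuous_gradient \<kappa> (grad \<kappa>)" by (intro smooth_has_continuous_gradient) (simp add: smooth_def)
  note \<kappa> = has_continuous_gradientD[OF s]
  have z: "\<kappa> x = 0" if "1 < norm x" for x using that bump_nonzero_iff[of 1 x] by (simp add: \<kappa>_def)
  have \<kappa>1: "\<kappa> 0 = 1" using b0 by (simp add: \<kappa>_def)
  have gz: "\<And>x. 1 < norm x \<Longrightarrow> grad \<kappa> x = 0"
    using gradient_zero_outside_support[of \<kappa> "grad \<kappa>" 1] s z by blast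
  have "\<exists>R. \<forall>x. R < norm x \<longrightarrow> \<kappa> x = 0" using z by blast
  from compactly_supported_C1_bounded[OF s this]
  obtain C C' where C: "0 \<le> C" "\<And>x. norm (\<kappa> x) \<le> C" and C': "0 \<le> C'" "\<And>x. norm (grad \<kappa> x) \<le> C'" by metis
  define r where "r n = inverse (real (Suc n))" for n
  have r: "0 < r n" "r n \<le> 1" for n by (auto simp: r_def field_simps)
  have r0: "r \<longlonglongrightarrow> 0" unfolding r_def by (rule LIMSEQ_inverse_real_of_nat)
  define fn where "fn n x = f x * \<kappa> (r n *\<^sub>R x)" for n x
  define Gn where "Gn n x = \<kappa> (r n *\<^sub>R x) *\<^sub>R G x + (r n * f x) *\<^sub>R grad \<kappa> (r n *\<^sub>R x)" for n x
  have "(fn n has_derivative (\<lambda>v. Gn n x \<bullet> v)) (at x)" for n x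
  proof -
    have "((\<lambda>x. \<kappa> (r n *\<^sub>R x)) has_derivative (\<lambda>v. grad \<kappa> (r n *\<^sub>R x) \<bullet> (r n *\<^sub>R v))) (at x)"
      by (rule has_derivative_compose[OF has_derivative_scaleR_right[OF has_derivative_ident] \<kappa>(1)])
    from has_derivative_mult[OF f(1) this] show ?thesis
      unfolding fn_def[abs_def] Gn_def by (rule has_derivative_eq_rhs) (auto simp: inner_add_left algebra_simps)
  qed
  moreover have "continuous_on UNIV (Gn n)" for n
    unfolding Gn_def[abs_def]
    by (intro continuous_intros f continuous_on_compose2[OF \<kappa>(2)] continuous_on_compose2[OF \<kappa>(3)]) auto
  ultimately have g: "has_continuous_gradient (fn n) (Gn n)" for n by (simp add: has_continuous_gradient_def)
  let ?D = "C * (\<bar>f 0\<bar> + L) + (\<bar>f 0\<bar> + L) * C'"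
  show ?thesis
  proof (rule duality_dominated_limit[where C = ?D])
    show "duality (fn n) (Gn n)" for n
    proof (rule duality_compactly_supported_C1[OF g])
      fix x :: 'a assume "real (Suc n) < norm x"
      then have "1 < norm (r n *\<^sub>R x)" by (simp add: r_def field_simps)
      then show "fn n x = 0" using z by (simp add: fn_def)
    qed simp
    have cl: "(\<lambda>n. r n *\<^sub>R x) \<longlonglongrightarrow> 0" for x :: 'a using tendsto_scaleR[OF r0 tendsto_const, of x] by simp
    have \<kappa>l: "(\<lambda>n. \<kappa> (r n *\<^sub>R x)) \<longlonglongrightarrow> 1" for x
      using continuous_on_tendsto_compose[OF \<kappa>(3) cl] \<kappa>1 by auto
    have gl: "(\<lambda>n. grad \<kappa> (r n *\<^sub>R x)) \<longlonglongrightarrow> grad \<kappa> 0" for x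
      using continuous_on_tendsto_compose[OF \<kappa>(2) cl] by auto
    show "(\<lambda>n. fn n x) \<longlonglongrightarrow> f x" for x
      unfolding fn_def using tendsto_mult[OF tendsto_const \<kappa>l, of "f x"] by simp
    show "(\<lambda>n. Gn n x) \<longlonglongrightarrow> G x" for x
    proof -
      have "(\<lambda>n. Gn n x) \<longlonglongrightarrow> 1 *\<^sub>R G x + (0 * f x) *\<^sub>R grad \<kappa> 0"
        unfolding Gn_def by (intro tendsto_intros \<kappa>l gl r0)
      then show ?thesis by simp
    qed
    show "\<bar>fn n x\<bar> \<le> ?D * (1 + norm x)" for n x
    proof -
      have "\<bar>fn n x\<bar> \<le> (\<bar>f 0\<bar> + L * norm x) * C"
        unfolding fn_def abs_mult using fb[of x] C(2)[of "r n *\<^sub>R x"] by (intro mult_mono) auto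
      also have "\<dots> \<le> ((\<bar>f 0\<bar> + L) * (1 + norm x)) * C"
        using L0 C(1) by (intro mult_right_mono) (auto simp: algebra_simps)
      also have "\<dots> = C * (\<bar>f 0\<bar> + L) * (1 + norm x)" by (simp only: mult_ac)
      also have "\<dots> \<le> ?D * (1 + norm x)"
        using L0 C' by (intro mult_right_mono) auto
      finally show ?thesis .
    qed
    show "norm (Gn n x) \<le> ?D" for n x
    proof -
      have 1: "norm (\<kappa> (r n *\<^sub>R x) *\<^sub>R G x) \<le> C * L"
        using C L by (auto intro!: mult_mono)
      have 2: "norm ((r n * f x) *\<^sub>R grad \<kappa> (r n *\<^sub>R x)) \<le> (\<bar>f 0\<bar> + L) * C'"
      proof (cases "1 < norm (r n *\<^sub>R x)")
        case True
        then show ?thesis using gz L0 C' by simp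
      next
        case False
        have "\<bar>r n * f x\<bar> \<le> r n * (\<bar>f 0\<bar> + L * norm x)"
          using fb[of x] r[of n] by (simp add: abs_mult)
        also have "\<dots> = r n * \<bar>f 0\<bar> + L * norm (r n *\<^sub>R x)"
          using r[of n] by (simp add: algebra_simps)
        also have "\<dots> \<le> 1 * \<bar>f 0\<bar> + L * 1"
          using False r[of n] L0 by (intro add_mono mult_right_mono mult_left_mono) auto
        finally have "\<bar>r n * f x\<bar> \<le> \<bar>f 0\<bar> + L" by simp
        then show ?thesis using C' L0 by (auto intro!: mult_mono)
      qed
      have "norm (Gn n x) \<le> C * L + (\<bar>f 0\<bar> + L) * C'"
        unfolding Gn_def by (rule norm_triangle_le[OF add_mono[OF 1 2]])
      also have "\<dots> \<le> ?D" using C(1) by (simp add: distrib_left)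
      finally show ?thesis .
    qed
  qed (use has_continuous_gradientD[OF g] f in auto)
qed

end

section \<open>Estimates for the kernel\<close>

definition energy_kernel :: "real \<Rightarrow> 'a::euclidean_space \<Rightarrow> 'a \<Rightarrow> real" where
  "energy_kernel q x y = norm x powr q + norm y powr q - norm (x - y) powr q"

lemma powr_le_one_plus:
  fixes t s :: real assumes "0 \<le> t" "0 \<le> s" "s \<le> 1" shows "t powr s \<le> 1 + t"
proof (cases "t \<le> 1")
  case True
  then show ?thesis using assms powr_le1[of s t] by linarith
next
  case False
  then have "t powr s \<le> t powr 1" using assms by (intro powr_mono) auto
  then show ?thesis using False by simp
qed

text \<open>
  The mean value theorem for \<open>x powr q\<close>, whose derivative is nondecreasing for \<open>q \<ge> 1\<close>.
\<close>
lemma powr_diff_le: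
  fixes u w q :: real assumes uw: "0 \<le> u" "u \<le> w" and q: "1 \<le> q"
  shows "w powr q - u powr q \<le> q * (w - u) * w powr (q - 1)"
proof (cases "u = w")
  case False
  then have l: "u < w" using uw by simp
  have "\<exists>x\<in>{u<..<w}. w powr q - u powr q = (w - u) * (q * x powr (q - 1))"
  proof -
    have "\<exists>x\<in>{u<..<w}. w powr q - u powr q = (\<lambda>h. q * x powr (q - 1) * h) (w - u)"
    proof (rule mvt[OF l])
      show "continuous_on {u..w} (\<lambda>x. x powr q)"
        using q uw by (intro continuous_on_powr' continuous_intros) auto
      fix x assume "u < x" "x < w"
      then have "0 < x" using uw by simp
      then have "((\<lambda>x. x powr q) has_real_derivative q * x powr (q - 1)) (at x)"
        by (rule has_real_derivative_powr)
      then show "((\<lambda>x. x powr q) has_derivative (\<lambda>h. q * x powr (q - 1) * h)) (at x)"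
        by (simp add: has_field_derivative_def)
    qed (metis greaterThanLessThan_iff)
    then show ?thesis by (auto simp: mult_ac)
  qed
  then obtain x where x: "u < x" "x < w" "w powr q - u powr q = (w - u) * (q * x powr (q - 1))" by auto
  have "x powr (q - 1) \<le> w powr (q - 1)" using x uw q by (intro powr_mono2) auto
  then show ?thesis using x q by (auto simp: mult_ac intro!: mult_left_mono)
qed simp

lemma energy_kernel_sym: "energy_kernel q x y = energy_kernel q y x"
  by (simp add: energy_kernel_def norm_minus_commute)

text \<open>
  A single factor \<open>1 + |x|\<close> and \<open>1 + |y|\<close> makes the energy finite for measures with only a first moment.
  For \<open>q \<le> 1\<close> each summand satisfies the bound.  For \<open>q > 1\<close> the summands grow faster than linearly and
  their cancellation matters: if \<open>|y| \<le> |x|\<close>, then \<open>|x|\<^sup>q - |x - y|\<^sup>q\<close> is at most of order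
  \<open>|y| |x|\<^sup>q\<^sup>-\<^sup>1\<close>, and \<open>q - 1 < 1\<close>.
\<close>
lemma energy_kernel_bound:
  assumes q: "0 < q" "q < 2"
  shows "\<bar>energy_kernel q x y\<bar> \<le> 5 * (1 + norm x) * (1 + norm y)"
proof -
  have main: "\<bar>energy_kernel q x y\<bar> \<le> 5 * (1 + norm x) * (1 + norm y)"
    if le: "norm y \<le> norm x" for x y :: 'a
  proof -
    define a b c where abc: "a = norm x" "b = norm y" "c = norm (x - y)"
    have ab: "0 \<le> b" "b \<le> a" "0 \<le> c" "c \<le> a + b" "\<bar>a - c\<bar> \<le> b"
      using le norm_triangle_ineq4[of x y] norm_triangle_ineq3[of x "x - y"] by (auto simp: abc)
    have "\<bar>a powr q + b powr q - c powr q\<bar> \<le> 5 * (1 + a) * (1 + b)"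
    proof (cases "q \<le> 1")
      case True
      have "a powr q \<le> 1 + a" "b powr q \<le> 1 + b" "c powr q \<le> 1 + c"
        using ab q True by (auto intro!: powr_le_one_plus)
      moreover have "0 \<le> a powr q" "0 \<le> b powr q" "0 \<le> c powr q" by auto
      ultimately have "\<bar>a powr q + b powr q - c powr q\<bar> \<le> 3 + 2 * a + 2 * b" using ab by linarith
      also have "\<dots> \<le> 5 * (1 + a) * (1 + b)" using ab by (simp add: algebra_simps)
      finally show ?thesis .
    next
      case False
      have "\<bar>a powr q - c powr q\<bar> \<le> q * \<bar>a - c\<bar> * max a c powr (q - 1)"
        using powr_diff_le[of a c q] powr_diff_le[of c a q] False ab
          powr_mono2[of q a c] powr_mono2[of q c a]
        by (cases "a \<le> c") (auto simp: max_def)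
      also have "\<dots> \<le> 2 * b * (1 + 2 * a)"
      proof (intro mult_mono)
        have "max a c powr (q - 1) \<le> 1 + max a c" using ab q False by (intro powr_le_one_plus) auto
        then show "max a c powr (q - 1) \<le> 1 + 2 * a" using ab by simp
      qed (use ab q in auto)
      finally have 1: "\<bar>a powr q - c powr q\<bar> \<le> 2 * b * (1 + 2 * a)" .
      have "b powr q = b * b powr (q - 1)" using ab by (cases "b = 0") (auto simp: powr_diff)
      also have "\<dots> \<le> b * (1 + a)"
        using ab q False powr_le_one_plus[of b "q - 1"] by (intro mult_left_mono) auto
      finally have "b powr q \<le> b * (1 + a)" .
      moreover have "0 \<le> b powr q" by simp
      ultimately have "\<bar>a powr q + b powr q - c powr q\<bar> \<le> 2 * b * (1 + 2 * a) + b * (1 + a)" using 1 by linarith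
      also have "\<dots> \<le> 5 * (1 + a) * (1 + b)" using ab by (simp add: algebra_simps)
      finally show ?thesis .
    qed
    then show ?thesis by (simp add: energy_kernel_def abc)
  qed
  show ?thesis
  proof (cases "norm y \<le> norm x")
    case True then show ?thesis by (rule main)
  next
    case False
    then have "\<bar>energy_kernel q y x\<bar> \<le> 5 * (1 + norm y) * (1 + norm x)" by (intro main) simp
    then show ?thesis using energy_kernel_sym[of q x y] by (metis mult.assoc mult.commute)
  qed
qed

text \<open>
  For \<open>q < 1\<close> the ball is decomposed dyadically.  On the shell where \<open>|z|\<close> is of order \<open>2 powr - k\<close> the integrand is of
  order \<open>2 powr (k (1 - q))\<close>, and the volume is at most of order \<open>2 powr - k\<close> because the dimension is at least \<open>1\<close>; the products form a
  geometric series with ratio \<open>2 powr - q\<close>.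
\<close>
lemma nn_integral_singular_ball:
  assumes q: "0 < q"
  shows "(\<integral>\<^sup>+ (z::'a::euclidean_space). ennreal (norm z powr (q - 1)) * indicator (ball 0 1) z \<partial>lborel) < \<infinity>"
proof -
  define V where "V = unit_ball_vol (real DIM('a))"
  have V: "0 \<le> V" by (simp add: V_def unit_ball_vol_nonneg)
  show ?thesis
  proof (cases "1 \<le> q")
    case True
    have "(\<integral>\<^sup>+ (z::'a). ennreal (norm z powr (q - 1)) * indicator (ball 0 1) z \<partial>lborel)
        \<le> (\<integral>\<^sup>+ (z::'a). indicator (ball 0 1) z \<partial>lborel)"
      using True powr_le1[of "q - 1"] by (intro nn_integral_mono) (auto simp: indicator_def)
    also have "\<dots> < \<infinity>" by (simp add: emeasure_ball)
    finally show ?thesis .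
  next
    case False
    define b where "b k = 2 powr ((1 - q) * (real k + 1))" for k :: nat
    have pw: "ennreal (norm z powr (q - 1)) * indicator (ball 0 1) z
        \<le> (\<Sum>k. ennreal (b k) * indicator (ball 0 ((1/2)^k)) z)" for z :: 'a
    proof (cases "z \<noteq> 0 \<and> norm z < 1")
      case True
      then have nz: "0 < norm z" by simp
      have "\<exists>n. (1/2::real)^n \<le> norm z" using real_arch_pow_inv[OF nz, of "1/2"] by (auto intro: less_imp_le)
      \<comment> \<open>The shell that contains \<open>z\<close>: \<open>2 powr - (k + 1) \<le> norm z < 2 powr - k\<close> for \<open>n = k + 1\<close>.\<close>
      define n where "n = (LEAST n. (1/2::real)^n \<le> norm z)"
      have n: "(1/2::real)^n \<le> norm z" unfolding n_def by (rule LeastI_ex) fact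
      have "n \<noteq> 0" using n True by (metis less_le_not_le power_0)
      then obtain k where k: "n = Suc k" using not0_implies_Suc by blast
      have kk: "norm z < (1/2)^k"
        using not_less_Least[of k "\<lambda>n. (1/2::real)^n \<le> norm z"] k by (auto simp: n_def)
      have "norm z powr (q - 1) \<le> ((1/2)^n) powr (q - 1)"
        using n False by (intro powr_mono2') auto
      also have "((1/2::real)^n) = 2 powr (- real n)"
        by (simp add: powr_minus powr_realpow power_divide inverse_eq_divide)
      also have "(2 powr (- real n)) powr (q - 1) = b k"
        by (simp add: powr_powr b_def k algebra_simps)
      finally have "ennreal (norm z powr (q - 1)) \<le> ennreal (b k) * indicator (ball 0 ((1/2)^k)) z"
        using kk by (simp add: ennreal_leI)
      also have "\<dots> \<le> (\<Sum>k. ennreal (b k) * indicator (ball 0 ((1/2)^k)) z)"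
        using ennreal_suminf_lessD[of "\<lambda>k. ennreal (b k) * indicator (ball 0 ((1/2)^k)) z"] not_le by blast
      finally show ?thesis using True by simp
    next
      case False
      then show ?thesis by auto
    qed
    have summand: "(\<integral>\<^sup>+ (z::'a). ennreal (b k) * indicator (ball 0 ((1/2)^k)) z \<partial>lborel)
        \<le> ennreal (V * 2 powr (1 - q) * (2 powr (- q)) ^ k)" for k
    proof -
      have "(\<integral>\<^sup>+ (z::'a). ennreal (b k) * indicator (ball 0 ((1/2)^k)) z \<partial>lborel)
          = ennreal (b k) * ennreal (V * ((1/2)^k) ^ DIM('a))"
        by (subst nn_integral_cmult_indicator) (auto simp: emeasure_ball V_def)
      also have "\<dots> = ennreal (b k * (V * ((1/2)^k) ^ DIM('a)))"
        using V by (simp add: ennreal_mult b_def)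
      also have "\<dots> \<le> ennreal (b k * (V * (1/2)^k))"
      proof -
        have "((1/2::real)^k) ^ DIM('a) \<le> ((1/2)^k) ^ 1"
          by (intro power_decreasing) (auto simp: power_le_one Suc_leI)
        then show ?thesis using V by (intro ennreal_leI mult_left_mono) (auto simp: b_def)
      qed
      also have "b k * (V * (1/2)^k) = V * 2 powr (1 - q) * (2 powr (- q)) ^ k"
      proof -
        have "(1/2::real)^k = 2 powr (- real k)"
          by (simp add: powr_minus powr_realpow power_divide inverse_eq_divide)
        moreover have "(2 powr (- q)) ^ k = 2 powr (- q * real k)"
          by (simp add: powr_powr powr_realpow[symmetric])
        ultimately show ?thesis
          by (simp add: b_def powr_add[symmetric] algebra_simps)
      qed
      finally show ?thesis .
    qed
    have r: "2 powr (- q) < (1::real)" using q powr_less_mono[of "- q" 0 2] by simp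
    have "(\<integral>\<^sup>+ (z::'a). ennreal (norm z powr (q - 1)) * indicator (ball 0 1) z \<partial>lborel)
        \<le> (\<integral>\<^sup>+ (z::'a). (\<Sum>k. ennreal (b k) * indicator (ball 0 ((1/2)^k)) z) \<partial>lborel)"
      by (intro nn_integral_mono pw)
    also have "\<dots> = (\<Sum>k. \<integral>\<^sup>+ (z::'a). ennreal (b k) * indicator (ball 0 ((1/2)^k)) z \<partial>lborel)"
      by (intro nn_integral_suminf borel_measurable_times_ennreal borel_measurable_const borel_measurable_indicator) simp
    also have "\<dots> \<le> (\<Sum>k. ennreal (V * 2 powr (1 - q) * (2 powr (- q)) ^ k))"
      by (intro suminf_le summand) auto
    also have "\<dots> < \<infinity>"
    proof -
      have "summable (\<lambda>k. V * 2 powr (1 - q) * (2 powr (- q)) ^ k)"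
        using r by (intro summable_mult summable_geometric) simp
      then show ?thesis by (subst suminf_ennreal2) (use V in auto)
    qed
    finally show ?thesis .
  qed
qed

lemma nn_integral_lborel_shift:
  fixes f :: "'a::euclidean_space \<Rightarrow> ennreal"
  assumes [measurable]: "f \<in> borel_measurable borel"
  shows "(\<integral>\<^sup>+ x. f (x + a) \<partial>lborel) = (\<integral>\<^sup>+ x. f x \<partial>lborel)"
proof -
  have "(\<integral>\<^sup>+ x. f x \<partial>lborel) = (\<integral>\<^sup>+ x. f x \<partial>distr lborel borel ((+) a))" by (simp add: lborel_distr_plus)
  also have "\<dots> = (\<integral>\<^sup>+ x. f (a + x) \<partial>lborel)" by (rule nn_integral_distr) auto
  finally show ?thesis by (simp add: add.commute)
qed

text \<open>
  Where \<open>|z| \<ge> 1\<close>, the integrand \<open>|z|\<^sup>q\<^sup>-\<^sup>1\<close> is at most \<open>|z|\<close>, since \<open>q - 1 < 1\<close>, and this gives the factor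
  \<open>1 + |a|\<close>; the part where \<open>|z| < 1\<close> is bounded independently of \<open>a\<close>, by translation invariance.
\<close>
lemma local_potential_bound:
  assumes q: "0 < q" "q < 2" and R: "0 \<le> R"
  obtains C where "0 \<le> C" "\<And>a::'a::euclidean_space.
    (\<integral>\<^sup>+ x. indicator (cball 0 R) x * ennreal (norm (x + a) powr (q - 1)) \<partial>lborel) \<le> ennreal (C * (1 + norm a))"
proof -
  let ?g = "\<lambda>z::'a. ennreal (norm z powr (q - 1)) * indicator (ball 0 1) z"
  obtain I where I: "0 \<le> I" "(\<integral>\<^sup>+ z. ?g z \<partial>lborel) = ennreal I"
    using nn_integral_singular_ball[OF q(1), where 'a='a]
    by (cases "\<integral>\<^sup>+ z. ?g z \<partial>lborel" rule: ennreal_cases) auto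
  define V where "V = unit_ball_vol (real DIM('a)) * R ^ DIM('a)"
  have V0: "0 \<le> V" using R by (simp add: V_def unit_ball_vol_nonneg)
  have V: "emeasure lborel (cball (0::'a) R) = ennreal V" using R by (simp add: V_def emeasure_cball)
  have [measurable]: "cball (0::'a) R \<in> sets borel" "ball (0::'a) 1 \<in> sets borel" by auto
  show thesis
  proof
    show "0 \<le> V * (1 + R) + I" using V0 R I by simp
    fix a :: 'a
    have "(\<integral>\<^sup>+ x. indicator (cball 0 R) x * ennreal (norm (x + a) powr (q - 1)) \<partial>lborel)
        \<le> (\<integral>\<^sup>+ x. ennreal (1 + R + norm a) * indicator (cball 0 R) x + ?g (x + a) \<partial>lborel)"
    proof (rule nn_integral_mono)
      fix x :: 'a
      show "indicator (cball 0 R) x * ennreal (norm (x + a) powr (q - 1))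
          \<le> ennreal (1 + R + norm a) * indicator (cball 0 R) x + ?g (x + a)"
      proof (cases "norm x \<le> R")
        case True
        show ?thesis
        proof (cases "norm (x + a) < 1")
          case True
          have "ennreal (norm (x + a) powr (q - 1)) \<le> t + ennreal (norm (x + a) powr (q - 1))" for t
            by (simp add: add_increasing)
          then show ?thesis using True by (auto simp: indicator_def)
        next
          case False
          have "norm (x + a) powr (q - 1) \<le> norm (x + a) powr 1" using False q by (intro powr_mono) auto
          also have "\<dots> \<le> 1 + R + norm a" using norm_triangle_ineq[of x a] True by simp
          finally show ?thesis using True False by (auto simp: indicator_def intro: ennreal_leI)
        qed
      qed (simp add: indicator_def)
    qed
    also have "\<dots> = (\<integral>\<^sup>+ (x::'a). ennreal (1 + R + norm a) * indicator (cball 0 R) x \<partial>lborel) + (\<integral>\<^sup>+ x. ?g (x + a) \<partial>lborel)"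
      by (intro nn_integral_add) measurable
    also have "(\<integral>\<^sup>+ x. ?g (x + a) \<partial>lborel) = ennreal I"
      unfolding I(2)[symmetric] by (intro nn_integral_lborel_shift) measurable
    also have "(\<integral>\<^sup>+ (x::'a). ennreal (1 + R + norm a) * indicator (cball 0 R) x \<partial>lborel) = ennreal (1 + R + norm a) * ennreal V"
      using V by (subst nn_integral_cmult_indicator) auto
    also have "\<dots> + ennreal I = ennreal ((1 + R + norm a) * V + I)"
      using V0 I R by (simp add: ennreal_mult)
    also have "\<dots> \<le> ennreal ((V * (1 + R) + I) * (1 + norm a))"
    proof (rule ennreal_leI)
      have "0 \<le> V * R * norm a" "0 \<le> I * norm a" using V0 R I by auto
      then show "(1 + R + norm a) * V + I \<le> (V * (1 + R) + I) * (1 + norm a)" by (simp add: algebra_simps)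
    qed
    finally show "(\<integral>\<^sup>+ x. indicator (cball 0 R) x * ennreal (norm (x + a) powr (q - 1)) \<partial>lborel)
      \<le> ennreal ((V * (1 + R) + I) * (1 + norm a))" .
  qed
qed

lemma norm_gradK: "0 \<le> q \<Longrightarrow> norm (gradK q z) = q * norm z powr (q - 1)"
  by (cases "z = 0") (auto simp: gradK_def powr_diff powr_numeral power2_eq_square field_simps)

lemma borel_measurable_gradK[measurable]: "gradK q \<in> borel_measurable borel"
  unfolding gradK_def[abs_def] by measurable

text \<open>
  The segment may pass through the origin, where \<open>K\<close> need not be differentiable.  This happens for at most
  one parameter if \<open>e \<noteq> 0\<close>, and \<open>K\<close> is continuous, so the fundamental theorem of calculus with a finite
  exceptional set applies.
\<close>
lemma gradK_segment_integral:
  assumes q: "0 < q"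
  shows "((\<lambda>s. gradK q (a + s *\<^sub>R e) \<bullet> e) has_integral K q (a + e) - K q a) {0..1}"
proof (cases "e = 0")
  case False
  have fin: "finite {s. a + s *\<^sub>R e = 0}"
  proof (rule finite_subset)
    show "{s. a + s *\<^sub>R e = 0} \<subseteq> {- (a \<bullet> e) / (e \<bullet> e)}"
    proof
      fix s assume "s \<in> {s. a + s *\<^sub>R e = 0}"
      then have "(a + s *\<^sub>R e) \<bullet> e = 0" by simp
      then have "a \<bullet> e + s * (e \<bullet> e) = 0" by (simp add: inner_add_left)
      then show "s \<in> {- (a \<bullet> e) / (e \<bullet> e)}" using False by (simp add: field_simps)
    qed
  qed simp
  have "((\<lambda>s. gradK q (a + s *\<^sub>R e) \<bullet> e) has_integral K q (a + 1 *\<^sub>R e) - K q (a + 0 *\<^sub>R e)) {0..1}"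
  proof (rule fundamental_theorem_of_calculus_strong[OF fin])
    fix s assume s: "s \<in> {0..1} - {s. a + s *\<^sub>R e = 0}"
    then have nz: "a + s *\<^sub>R e \<noteq> 0" by simp
    have l: "((\<lambda>s. a + s *\<^sub>R e) has_derivative (\<lambda>h. h *\<^sub>R e)) (at s)"
      by (auto intro!: derivative_eq_intros)
    have "((\<lambda>s. K q (a + s *\<^sub>R e)) has_derivative (\<lambda>h. (h *\<^sub>R e) \<bullet> gradK q (a + s *\<^sub>R e))) (at s)"
      using has_derivative_compose[OF l] gradK_is_gradient[OF nz, of q, unfolded gderiv_def] by blast
    then show "((\<lambda>s. K q (a + s *\<^sub>R e)) has_vector_derivative gradK q (a + s *\<^sub>R e) \<bullet> e) (at s)"
      by (simp add: has_vector_derivative_def inner_commute)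
  next
    show "continuous_on {0..1} (\<lambda>s. K q (a + s *\<^sub>R e))"
      unfolding K_def using q by (intro continuous_intros continuous_on_powr') auto
  qed simp
  then show ?thesis by simp
qed simp

section \<open>Potentials of neutral charges\<close>

definition potential :: "real \<Rightarrow> ('a::euclidean_space \<Rightarrow> real) \<Rightarrow> 'a \<Rightarrow> real" where
  "potential q \<sigma> x = (LINT y|lborel. energy_kernel q x y * \<sigma> y)"

lemma borel_measurable_energy_kernel[measurable]:
  "(\<lambda>z. energy_kernel q (fst z) (snd z)) \<in> borel_measurable (borel \<Otimes>\<^sub>M borel)"
  "energy_kernel q x \<in> borel_measurable borel"
  unfolding energy_kernel_def[abs_def] by measurable

locale neutral_charge =
  fixes q :: real and \<sigma> :: "'a::euclidean_space \<Rightarrow> real"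
  assumes q: "0 < q" "q < 2"
    and integrable: "integrable lborel \<sigma>" and moment: "integrable lborel (\<lambda>y. norm y * \<sigma> y)"
    and neutral: "(LINT y|lborel. \<sigma> y) = 0"
begin

lemma measurable_\<sigma>[measurable]: "\<sigma> \<in> borel_measurable borel"
  using integrable by auto

lemma weight_integrable: "integrable lborel (\<lambda>y. (1 + norm y) * \<bar>\<sigma> y\<bar>)"
  using Bochner_Integration.integrable_add[OF integrable_abs[OF integrable] integrable_abs[OF moment]]
  by (simp add: algebra_simps abs_mult)

definition weight :: real where "weight = (LINT y|lborel. (1 + norm y) * \<bar>\<sigma> y\<bar>)"

lemma weight_nonneg: "0 \<le> weight"
  by (simp add: weight_def)

lemma kernel_charge_bound:
  "norm x \<le> M \<Longrightarrow> \<bar>energy_kernel q x y * \<sigma> y\<bar> \<le> 5 * (1 + M) * ((1 + norm y) * \<bar>\<sigma> y\<bar>)"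
proof -
  assume "norm x \<le> M"
  then have "5 * (1 + norm x) * (1 + norm y) \<le> 5 * (1 + M) * (1 + norm y)"
    by (intro mult_right_mono) auto
  then have "\<bar>energy_kernel q x y\<bar> \<le> 5 * (1 + M) * (1 + norm y)"
    using energy_kernel_bound[OF q, of x y] by linarith
  then have "\<bar>energy_kernel q x y\<bar> * \<bar>\<sigma> y\<bar> \<le> 5 * (1 + M) * (1 + norm y) * \<bar>\<sigma> y\<bar>"
    by (rule mult_right_mono) simp
  then show ?thesis by (simp only: abs_mult mult.assoc)
qed

lemma potential_integrable: "integrable lborel (\<lambda>y. energy_kernel q x y * \<sigma> y)"
proof (rule Bochner_Integration.integrable_bound)
  show "integrable lborel (\<lambda>y. 5 * (1 + norm x) * ((1 + norm y) * \<bar>\<sigma> y\<bar>))"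
    using weight_integrable by (rule integrable_mult_right)
  show "AE y in lborel. norm (energy_kernel q x y * \<sigma> y) \<le> norm (5 * (1 + norm x) * ((1 + norm y) * \<bar>\<sigma> y\<bar>))"
    using kernel_charge_bound[OF order_refl, of x] by (intro always_eventually allI) (auto intro: order_trans abs_ge_self)
qed measurable

lemma potential_bound: "\<bar>potential q \<sigma> x\<bar> \<le> 5 * (1 + norm x) * weight"
proof -
  have "\<bar>potential q \<sigma> x\<bar> \<le> (LINT y|lborel. \<bar>energy_kernel q x y * \<sigma> y\<bar>)"
    unfolding potential_def by (rule integral_abs_bound)
  also have "\<dots> \<le> (LINT y|lborel. 5 * (1 + norm x) * ((1 + norm y) * \<bar>\<sigma> y\<bar>))"
    using weight_integrable by (intro integral_mono kernel_charge_bound integrable_abs potential_integrable) auto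
  also have "\<dots> = 5 * (1 + norm x) * weight" by (simp add: weight_def)
  finally show ?thesis .
qed

lemma potential_continuous: "continuous_on UNIV (potential q \<sigma>)"
  unfolding continuous_on_sequentially
proof (intro ballI allI impI)
  fix x :: "nat \<Rightarrow> 'a" and a assume "(\<forall>n. x n \<in> UNIV) \<and> x \<longlonglongrightarrow> a"
  then have lim: "x \<longlonglongrightarrow> a" by simp
  then have "Bseq x" by (intro convergent_imp_Bseq convergentI)
  then obtain M where M: "\<And>n. norm (x n) \<le> M" by (auto simp: Bseq_def)
  have "(\<lambda>n. LINT y|lborel. energy_kernel q (x n) y * \<sigma> y) \<longlonglongrightarrow> (LINT y|lborel. energy_kernel q a y * \<sigma> y)"
  proof (rule integral_dominated_convergence)
    show "integrable lborel (\<lambda>y. 5 * (1 + M) * ((1 + norm y) * \<bar>\<sigma> y\<bar>))"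
      using weight_integrable by (rule integrable_mult_right)
    show "AE y in lborel. norm (energy_kernel q (x n) y * \<sigma> y) \<le> 5 * (1 + M) * ((1 + norm y) * \<bar>\<sigma> y\<bar>)" for n
      using kernel_charge_bound[OF M[of n]] by simp
    show "AE y in lborel. (\<lambda>n. energy_kernel q (x n) y * \<sigma> y) \<longlonglongrightarrow> energy_kernel q a y * \<sigma> y"
      unfolding energy_kernel_def using q
      by (intro always_eventually allI tendsto_intros tendsto_powr' lim) auto
  qed measurable
  then show "(potential q \<sigma> \<circ> x) \<longlonglongrightarrow> potential q \<sigma> a" by (simp add: potential_def o_def)
qed

text \<open>
  The summand \<open>|x|\<^sup>q\<close> of the kernel drops out because the charge is neutral, and \<open>|y|\<^sup>q\<close> cancels.
\<close>
lemma potential_difference: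
  "potential q \<sigma> (x + e) - potential q \<sigma> x = (LINT y|lborel. \<sigma> y * (K q (x - y + e) - K q (x - y)))"
proof -
  have "(LINT y|lborel. \<sigma> y * (K q (x - y + e) - K q (x - y)))
     = (LINT y|lborel. energy_kernel q (x + e) y * \<sigma> y - energy_kernel q x y * \<sigma> y
          - (norm (x + e) powr q - norm x powr q) * \<sigma> y)"
    by (intro Bochner_Integration.integral_cong) (auto simp: energy_kernel_def K_def algebra_simps)
  also have "\<dots> = potential q \<sigma> (x + e) - potential q \<sigma> x - (norm (x + e) powr q - norm x powr q) * 0"
    using potential_integrable[of "x + e"] potential_integrable[of x] integrable
    by (simp add: potential_def neutral)
  finally show ?thesis by simp
qed

text \<open>
  Integrate over \<open>x\<close> in a ball and apply Tonelli's theorem: the integral over \<open>x\<close> is bounded by a multiple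
  of \<open>1 + |y|\<close>, which is integrable against \<open>|\<sigma>|\<close>.
\<close>
lemma singular_integral_finite_AE:
  "AE x in lborel. (\<integral>\<^sup>+ z. ennreal (\<bar>\<sigma> (snd z)\<bar> * norm (x + fst z *\<^sub>R e - snd z) powr (q - 1))
      * indicator {0..1} (fst z) \<partial>(lborel :: (real \<times> 'a) measure)) < \<infinity>"
proof -
  define \<Phi> where "\<Phi> x z = ennreal (\<bar>\<sigma> (snd z)\<bar> * norm (x + fst z *\<^sub>R e - snd z) powr (q - 1))
      * indicator {0..1} (fst z)" for x :: 'a and z :: "real \<times> 'a"
  have [measurable]: "(\<lambda>(x, z). \<Phi> x z) \<in> borel_measurable (borel \<Otimes>\<^sub>M borel)"
    unfolding \<Phi>_def[abs_def] borel_prod[symmetric] by measurable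
  have "AE x in lborel. norm x \<le> real R \<longrightarrow> (\<integral>\<^sup>+ z. \<Phi> x z \<partial>lborel) < \<infinity>" for R :: nat
  proof -
    obtain C where C: "0 \<le> C" "\<And>a::'a. (\<integral>\<^sup>+ x. indicator (cball 0 (real R)) x * ennreal (norm (x + a) powr (q - 1)) \<partial>lborel)
        \<le> ennreal (C * (1 + norm a))"
      using local_potential_bound[OF q, of "real R"] by auto
    have [measurable]: "cball (0::'a) (real R) \<in> sets borel" by auto
    have inner: "(\<integral>\<^sup>+ x. indicator (cball 0 (real R)) x * \<Phi> x z \<partial>lborel)
        \<le> ennreal (C * (1 + norm e) * ((1 + norm (snd z)) * \<bar>\<sigma> (snd z)\<bar>)) * indicator {0..1} (fst z)" for z
    proof (cases "fst z \<in> {0..1}")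
      case True
      let ?a = "fst z *\<^sub>R e - snd z"
      have "(\<integral>\<^sup>+ x. indicator (cball 0 (real R)) x * \<Phi> x z \<partial>lborel)
          = (\<integral>\<^sup>+ x. ennreal \<bar>\<sigma> (snd z)\<bar> * (indicator (cball 0 (real R)) x * ennreal (norm (x + ?a) powr (q - 1))) \<partial>lborel)"
        using True by (intro nn_integral_cong) (auto simp: \<Phi>_def ennreal_mult mult_ac add_diff_eq)
      also have "\<dots> = ennreal \<bar>\<sigma> (snd z)\<bar> * (\<integral>\<^sup>+ x. indicator (cball 0 (real R)) x * ennreal (norm (x + ?a) powr (q - 1)) \<partial>lborel)"
        by (rule nn_integral_cmult) measurable
      also have "\<dots> \<le> ennreal \<bar>\<sigma> (snd z)\<bar> * ennreal (C * (1 + norm ?a))"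
        by (intro mult_left_mono C) auto
      also have "\<dots> = ennreal (\<bar>\<sigma> (snd z)\<bar> * (C * (1 + norm ?a)))"
        using C(1) by (simp add: ennreal_mult)
      also have "\<dots> \<le> ennreal (\<bar>\<sigma> (snd z)\<bar> * (C * ((1 + norm e) * (1 + norm (snd z)))))"
      proof (intro ennreal_leI mult_left_mono C(1))
        have "norm ?a \<le> norm (fst z *\<^sub>R e) + norm (snd z)" by (rule norm_triangle_ineq4)
        also have "norm (fst z *\<^sub>R e) \<le> 1 * norm e" unfolding norm_scaleR using True by (intro mult_right_mono) auto
        finally have "1 + norm ?a \<le> 1 + norm e + norm (snd z)" by simp
        also have "\<dots> \<le> (1 + norm e) * (1 + norm (snd z))" by (simp add: algebra_simps)
        finally show "1 + norm ?a \<le> (1 + norm e) * (1 + norm (snd z))" .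
      qed auto
      finally show ?thesis using True by (simp add: mult_ac)
    qed (simp add: \<Phi>_def)
    have "(\<integral>\<^sup>+ x. indicator (cball 0 (real R)) x * (\<integral>\<^sup>+ z. \<Phi> x z \<partial>lborel) \<partial>lborel)
        = (\<integral>\<^sup>+ x. (\<integral>\<^sup>+ z. indicator (cball 0 (real R)) x * \<Phi> x z \<partial>lborel) \<partial>lborel)"
      by (intro nn_integral_cong nn_integral_cmult[symmetric]) measurable
    also have "\<dots> = (\<integral>\<^sup>+ z. (\<integral>\<^sup>+ x. indicator (cball 0 (real R)) x * \<Phi> x z \<partial>lborel) \<partial>lborel)"
      by (rule lborel_pair.Fubini'[symmetric]) measurable
    also have "\<dots> \<le> (\<integral>\<^sup>+ z. ennreal (C * (1 + norm e) * ((1 + norm (snd z)) * \<bar>\<sigma> (snd z)\<bar>)) * indicator {0..1} (fst z)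
        \<partial>(lborel :: (real \<times> 'a) measure))"
      by (intro nn_integral_mono inner)
    also have "\<dots> = (\<integral>\<^sup>+ (s::real). (\<integral>\<^sup>+ y. ennreal (C * (1 + norm e) * ((1 + norm y) * \<bar>\<sigma> y\<bar>)) * indicator {0..1} s \<partial>lborel) \<partial>lborel)"
      unfolding lborel_prod[symmetric] by (subst lborel.nn_integral_fst[symmetric]) auto
    also have "\<dots> = (\<integral>\<^sup>+ s. ennreal (C * (1 + norm e) * weight) * indicator {0..1} (s::real) \<partial>lborel)"
    proof (rule nn_integral_cong)
      fix s :: real
      have "(\<integral>\<^sup>+ y. ennreal (C * (1 + norm e) * ((1 + norm y) * \<bar>\<sigma> y\<bar>)) * indicator {0..1} s \<partial>lborel)
          = (\<integral>\<^sup>+ y. ennreal (C * (1 + norm e) * ((1 + norm y) * \<bar>\<sigma> y\<bar>)) \<partial>lborel) * indicator {0..1} s"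
        by (rule nn_integral_multc) measurable
      also have "(\<integral>\<^sup>+ y. ennreal (C * (1 + norm e) * ((1 + norm y) * \<bar>\<sigma> y\<bar>)) \<partial>lborel) = ennreal (C * (1 + norm e) * weight)"
        using weight_integrable C(1) by (subst nn_integral_eq_integral) (auto simp: weight_def)
      finally show "(\<integral>\<^sup>+ y. ennreal (C * (1 + norm e) * ((1 + norm y) * \<bar>\<sigma> y\<bar>)) * indicator {0..1} s \<partial>lborel)
          = ennreal (C * (1 + norm e) * weight) * indicator {0..1} s" .
    qed
    also have "\<dots> < \<infinity>"
      by (subst nn_integral_cmult_indicator) (auto simp: ennreal_mult_less_top)
    finally have "AE x in lborel. indicator (cball 0 (real R)) x * (\<integral>\<^sup>+ z. \<Phi> x z \<partial>lborel) \<noteq> \<infinity>"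
      by (intro nn_integral_PInf_AE) auto
    then show ?thesis by eventually_elim (auto simp: indicator_def less_top)
  qed
  then have "AE x in lborel. \<forall>R::nat. norm x \<le> real R \<longrightarrow> (\<integral>\<^sup>+ z. \<Phi> x z \<partial>lborel) < \<infinity>"
    by (intro AE_all_countable[THEN iffD2] allI)
  then have "AE x in lborel. (\<integral>\<^sup>+ z. \<Phi> x z \<partial>lborel) < \<infinity>"
    by eventually_elim (use real_arch_simple in blast)
  then show ?thesis by (simp add: \<Phi>_def)
qed

text \<open>
  For the points \<open>x\<close> of the previous lemma the double integral over \<open>s\<close> and \<open>y\<close> converges absolutely.
  Integrating first over \<open>y\<close> gives the convolution along the segment, integrating first over \<open>s\<close> gives
  the increments of \<open>K\<close>, hence of the potential.
\<close>
lemma potential_segment_AE: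
  assumes V: "continuous_on UNIV (conv_vec (gradK q) \<sigma>)"
  shows "AE x in lborel. potential q \<sigma> (x + e) - potential q \<sigma> x
      = integral {0..1} (\<lambda>s. conv_vec (gradK q) \<sigma> (x + s *\<^sub>R e) \<bullet> e)"
  using singular_integral_finite_AE[of e]
proof eventually_elim
  case (elim x)
  \<comment> \<open>Vector-valued, since the convolution is a vector-valued integral: its component in the direction
    \<open>e\<close> is the integral of the component only where the whole integrand is integrable.\<close>
  define F where "F s y = indicator {0..1} s *\<^sub>R (\<sigma> y *\<^sub>R gradK q (x + s *\<^sub>R e - y))" for s :: real and y
  have Fm[measurable]: "(\<lambda>z. F (fst z) (snd z)) \<in> borel_measurable (borel \<Otimes>\<^sub>M borel)"
    unfolding F_def[abs_def] by measurable
  have "integrable (lborel \<Otimes>\<^sub>M lborel) (\<lambda>z. F (fst z) (snd z))"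
  proof (rule integrableI_bounded)
    have "(\<integral>\<^sup>+ z. ennreal (norm (F (fst z) (snd z))) \<partial>(lborel \<Otimes>\<^sub>M lborel))
        = (\<integral>\<^sup>+ z. ennreal q * (ennreal (\<bar>\<sigma> (snd z)\<bar> * norm (x + fst z *\<^sub>R e - snd z) powr (q - 1))
            * indicator {0..1} (fst z)) \<partial>(lborel \<Otimes>\<^sub>M lborel))"
      using q by (intro nn_integral_cong) (auto simp: F_def norm_gradK ennreal_mult mult_ac indicator_def)
    also have "\<dots> = ennreal q * (\<integral>\<^sup>+ z. ennreal (\<bar>\<sigma> (snd z)\<bar> * norm (x + fst z *\<^sub>R e - snd z) powr (q - 1))
            * indicator {0..1} (fst z) \<partial>(lborel \<Otimes>\<^sub>M lborel))"
      by (rule nn_integral_cmult) measurable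
    also have "\<dots> < \<infinity>" using elim by (simp add: lborel_prod ennreal_mult_less_top)
    finally show "(\<integral>\<^sup>+ z. ennreal (norm (F (fst z) (snd z))) \<partial>(lborel \<Otimes>\<^sub>M lborel)) < \<infinity>" .
  qed measurable
  then have Fi: "integrable (lborel \<Otimes>\<^sub>M lborel) (\<lambda>(s, y). F s y)" by (simp add: case_prod_unfold)
  then have Fe: "integrable (lborel \<Otimes>\<^sub>M lborel) (\<lambda>(s, y). F s y \<bullet> e)"
    using integrable_inner_left[of e "lborel \<Otimes>\<^sub>M lborel" "\<lambda>(s, y). F s y"] by (simp add: case_prod_unfold)
  have Vc: "continuous_on {0..1} (\<lambda>s. conv_vec (gradK q) \<sigma> (x + s *\<^sub>R e) \<bullet> e)"
    by (intro continuous_intros continuous_on_compose2[OF V]) auto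
  have Vi: "set_integrable lborel {0..1} (\<lambda>s. conv_vec (gradK q) \<sigma> (x + s *\<^sub>R e) \<bullet> e)"
    unfolding set_integrable_def by (rule borel_integrable_compact[OF compact_Icc Vc])
  have "(LINT s|lborel. LINT y|lborel. F s y \<bullet> e) = (LINT s:{0..1}|lborel. conv_vec (gradK q) \<sigma> (x + s *\<^sub>R e) \<bullet> e)"
    unfolding set_lebesgue_integral_def
  proof (rule integral_cong_AE)
    show "(\<lambda>s. indicator {0..1} s *\<^sub>R (conv_vec (gradK q) \<sigma> (x + s *\<^sub>R e) \<bullet> e)) \<in> borel_measurable lborel"
      using Vi unfolding set_integrable_def by (rule borel_measurable_integrable)
    show "(\<lambda>s. LINT y|lborel. F s y \<bullet> e) \<in> borel_measurable lborel"
      using lborel_pair.integrable_fst'[OF Fe] by auto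
    show "AE s in lborel. (LINT y|lborel. F s y \<bullet> e)
        = indicator {0..1} s *\<^sub>R (conv_vec (gradK q) \<sigma> (x + s *\<^sub>R e) \<bullet> e)"
      using lborel_pair.AE_integrable_fst'[OF Fi]
    proof eventually_elim
      case (elim s)
      then have "(LINT y|lborel. F s y \<bullet> e) = (LINT y|lborel. F s y) \<bullet> e" by simp
      also have "(LINT y|lborel. F s y) = indicator {0..1} s *\<^sub>R conv_vec (gradK q) \<sigma> (x + s *\<^sub>R e)"
        by (cases "s \<in> {0..1}") (auto simp: F_def conv_vec_def)
      finally show ?case by simp
    qed
  qed
  also have "\<dots> = integral {0..1} (\<lambda>s. conv_vec (gradK q) \<sigma> (x + s *\<^sub>R e) \<bullet> e)"
    by (rule set_borel_integral_eq_integral(2)[OF Vi])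
  finally have L: "(LINT s|lborel. LINT y|lborel. F s y \<bullet> e)
      = integral {0..1} (\<lambda>s. conv_vec (gradK q) \<sigma> (x + s *\<^sub>R e) \<bullet> e)" .
  have "(LINT y|lborel. LINT s|lborel. F s y \<bullet> e) = (LINT y|lborel. \<sigma> y * (K q (x - y + e) - K q (x - y)))"
  proof (rule integral_cong_AE)
    show "(\<lambda>y. LINT s|lborel. F s y \<bullet> e) \<in> borel_measurable lborel"
      using lborel_pair.integrable_snd[OF Fe] by auto
    show "(\<lambda>y. \<sigma> y * (K q (x - y + e) - K q (x - y))) \<in> borel_measurable lborel"
      unfolding K_def by measurable
    show "AE y in lborel. (LINT s|lborel. F s y \<bullet> e) = \<sigma> y * (K q (x - y + e) - K q (x - y))"
      using lborel_pair.AE_integrable_snd[OF Fe]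
    proof eventually_elim
      case (elim y)
      let ?g = "\<lambda>s. gradK q ((x - y) + s *\<^sub>R e) \<bullet> e"
      have Fg: "F s y \<bullet> e = \<sigma> y * (indicator {0..1} s *\<^sub>R ?g s)" for s
        by (simp add: F_def algebra_simps)
      show ?case
      proof (cases "\<sigma> y = 0")
        case True
        then show ?thesis by (simp add: F_def)
      next
        case False
        then have "set_integrable lborel {0..1} ?g"
          using elim unfolding Fg set_integrable_def by simp
        from set_borel_integral_eq_integral(2)[OF this]
        have "(LINT s|lborel. indicator {0..1} s *\<^sub>R ?g s) = K q (x - y + e) - K q (x - y)"
          using integral_unique[OF gradK_segment_integral[OF q(1)]] by (simp add: set_lebesgue_integral_def)
        then show ?thesis unfolding Fg by simp
      qed
    qed
  qed
  also have "\<dots> = potential q \<sigma> (x + e) - potential q \<sigma> x" by (rule potential_difference[symmetric])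
  finally show ?case
    using L lborel_pair.Fubini_integral[OF Fe] by simp
qed

text \<open>
  Both sides are continuous in \<open>x\<close> and agree almost everywhere.
\<close>
lemma potential_segment:
  assumes V: "continuous_on UNIV (conv_vec (gradK q) \<sigma>)"
  shows "potential q \<sigma> (x + e) - potential q \<sigma> x = integral {0..1} (\<lambda>s. conv_vec (gradK q) \<sigma> (x + s *\<^sub>R e) \<bullet> e)"
proof -
  define A where "A x = potential q \<sigma> (x + e) - potential q \<sigma> x" for x
  define B where "B x = integral {0..1} (\<lambda>s. conv_vec (gradK q) \<sigma> (x + s *\<^sub>R e) \<bullet> e)" for x
  have "continuous_on UNIV A" unfolding A_def[abs_def]
    by (intro continuous_intros continuous_on_compose2[OF potential_continuous]) auto
  moreover have "continuous_on UNIV (\<lambda>x. integral (cbox 0 1) (\<lambda>s. conv_vec (gradK q) \<sigma> (x + s *\<^sub>R e) \<bullet> e))"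
    by (rule integral_continuous_on_param)
      (auto simp: split_beta intro!: continuous_intros continuous_on_compose2[OF V])
  then have "continuous_on UNIV B" by (simp add: B_def[abs_def] cbox_interval)
  ultimately have "closed {x. A x = B x}" by (intro closed_Collect_eq)
  moreover have "AE x in lebesgue. x \<in> {x. A x = B x}"
    using AE_completion[OF potential_segment_AE[OF V, of e]] by (simp add: A_def B_def)
  ultimately have "x \<in> {x. A x = B x}" by (rule mem_closed_if_AE_lebesgue)
  then show ?thesis by (simp add: A_def B_def)
qed

theorem potential_gradient:
  assumes V: "continuous_on UNIV (conv_vec (gradK q) \<sigma>)"
  shows "has_continuous_gradient (potential q \<sigma>) (conv_vec (gradK q) \<sigma>)"
  unfolding has_continuous_gradient_def
proof (intro conjI allI V)
  fix x
  let ?V = "conv_vec (gradK q) \<sigma>"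
  show "(potential q \<sigma> has_derivative (\<lambda>v. ?V x \<bullet> v)) (at x)"
    unfolding has_derivative_at_alt
  proof (intro conjI allI impI)
    show "bounded_linear (\<lambda>v. ?V x \<bullet> v)" by (rule bounded_linear_inner_right)
    fix \<epsilon> :: real assume \<epsilon>: "0 < \<epsilon>"
    have "continuous (at x) ?V" using V by (simp add: continuous_on_eq_continuous_at)
    then obtain d where d: "0 < d" "\<And>y. dist y x < d \<Longrightarrow> dist (?V y) (?V x) < \<epsilon>"
      using \<epsilon> unfolding continuous_at_eps_delta by blast
    show "\<exists>d>0. \<forall>y. norm (y - x) < d \<longrightarrow>
        norm (potential q \<sigma> y - potential q \<sigma> x - ?V x \<bullet> (y - x)) \<le> \<epsilon> * norm (y - x)"
    proof (intro exI conjI allI impI)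
      fix y assume y: "norm (y - x) < d"
      define e where "e = y - x"
      have c: "continuous_on {0..1} (\<lambda>s. ?V (x + s *\<^sub>R e) \<bullet> e)"
        by (intro continuous_intros continuous_on_compose2[OF V]) auto
      have i: "(\<lambda>s. ?V (x + s *\<^sub>R e) \<bullet> e) integrable_on {0..1}" "(\<lambda>s. ?V x \<bullet> e) integrable_on {0..1::real}"
        "(\<lambda>s. (?V (x + s *\<^sub>R e) - ?V x) \<bullet> e) integrable_on {0..1}"
        by (intro integrable_continuous_interval continuous_intros continuous_on_compose2[OF V]; auto)+
      have "potential q \<sigma> y - potential q \<sigma> x - ?V x \<bullet> (y - x)
          = integral {0..1} (\<lambda>s. ?V (x + s *\<^sub>R e) \<bullet> e) - integral {0..1::real} (\<lambda>s. ?V x \<bullet> e)"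
        using potential_segment[OF V, of x e] by (simp add: e_def)
      also have "\<dots> = integral {0..1} (\<lambda>s. (?V (x + s *\<^sub>R e) - ?V x) \<bullet> e)"
        using integral_diff[OF i(1,2)] by (simp add: inner_diff_left)
      also have "norm \<dots> \<le> integral {0..1::real} (\<lambda>s. \<epsilon> * norm e)"
      proof (rule integral_norm_bound_integral[OF i(3)])
        fix s :: real assume s: "s \<in> {0..1}"
        have "dist (x + s *\<^sub>R e) x = s * norm e" using s by (simp add: dist_norm)
        also have "\<dots> \<le> 1 * norm e" using s by (intro mult_right_mono) auto
        also have "\<dots> < d" using y by (simp add: e_def)
        finally have "norm (?V (x + s *\<^sub>R e) - ?V x) < \<epsilon>" using d(2) by (simp add: dist_norm)
        then have "norm (?V (x + s *\<^sub>R e) - ?V x) * norm e \<le> \<epsilon> * norm e" by (intro mult_right_mono) auto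
        then show "norm ((?V (x + s *\<^sub>R e) - ?V x) \<bullet> e) \<le> \<epsilon> * norm e"
          using Cauchy_Schwarz_ineq2[of "?V (x + s *\<^sub>R e) - ?V x" e] by simp
      qed auto
      finally show "norm (potential q \<sigma> y - potential q \<sigma> x - ?V x \<bullet> (y - x)) \<le> \<epsilon> * norm (y - x)"
        by (simp add: e_def)
    qed (rule d(1))
  qed
qed

end

section \<open>Probability densities and the energy as a quadratic form\<close>

lemma prob_density_moment_weaken:
  assumes "f \<in> prob_density_moment r" "1 \<le> r"
  shows "f \<in> prob_density_moment 1"
proof -
  have p: "prob_space (law f)" and s: "sets (law f) = sets borel"
    and m: "(\<integral>\<^sup>+ x. ennreal (norm x powr r) \<partial>law f) < \<infinity>"
    using assms by (auto simp: prob_density_moment_def prob_moment_def)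
  interpret prob_space "law f" by (rule p)
  have [measurable_cong]: "sets (law f) = sets borel" by (rule s)
  have "(\<integral>\<^sup>+ x. ennreal (norm x powr 1) \<partial>law f) \<le> (\<integral>\<^sup>+ x. 1 + ennreal (norm x powr r) \<partial>law f)"
  proof (rule nn_integral_mono)
    fix x :: 'a
    have "norm x powr 1 \<le> 1 + norm x powr r"
    proof (cases "norm x \<le> 1")
      case False
      then have "norm x powr 1 \<le> norm x powr r" using assms(2) by (intro powr_mono) auto
      then show ?thesis by simp
    qed (simp add: add_increasing2)
    then have "ennreal (norm x powr 1) \<le> ennreal (1 + norm x powr r)" by (rule ennreal_leI)
    then show "ennreal (norm x powr 1) \<le> 1 + ennreal (norm x powr r)" by simp
  qed
  also have "\<dots> = 1 + (\<integral>\<^sup>+ x. ennreal (norm x powr r) \<partial>law f)"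
    by (subst nn_integral_add) (auto simp: emeasure_space_1)
  also have "\<dots> < \<infinity>" using m by simp
  finally show ?thesis using assms by (auto simp: prob_density_moment_def prob_moment_def)
qed

lemma prob_densityD:
  assumes "f \<in> prob_density_moment 1"
  shows "f \<in> borel_measurable borel" "AE x in lborel. 0 \<le> f x" "law f \<in> prob_moment 1"
    "integrable lborel f" "(LINT x|lborel. f x) = 1" "integrable lborel (\<lambda>x. norm x * f x)"
proof -
  show m: "f \<in> borel_measurable borel" and n: "AE x in lborel. 0 \<le> f x" and l: "law f \<in> prob_moment 1"
    using assms by (auto simp: prob_density_moment_def)
  interpret prob_space "law f" using l by (auto simp: prob_moment_def)
  have one: "(\<integral>\<^sup>+ x. ennreal (f x) \<partial>lborel) = 1"
    using emeasure_space_1 m by (simp add: law_def emeasure_density space_density)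
  show i: "integrable lborel f"
    using m n one by (intro integrableI_nonneg) auto
  show "(LINT x|lborel. f x) = 1"
    using m n one by (subst integral_eq_nn_integral) auto
  have "integrable (density lborel (\<lambda>x. ennreal (f x))) norm"
    using prob_moment_1D(3)[OF l] by (simp add: law_def)
  then show "integrable lborel (\<lambda>x. norm x * f x)"
    using m n by (simp add: integrable_density mult.commute)
qed

lemma integral_law:
  fixes u :: "'a::euclidean_space \<Rightarrow> real"
  assumes "f \<in> borel_measurable borel" "AE x in lborel. 0 \<le> f x" "u \<in> borel_measurable borel"
  shows "(LINT x|law f. u x) = (LINT x|lborel. u x * f x)"
  unfolding law_def using assms by (subst integral_density) (auto simp: mult.commute)

lemma neutral_charge_difference:
  assumes q: "0 < q" "q < 2" and f: "f \<in> prob_density_moment 1" and g: "g \<in> prob_density_moment 1"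
  shows "neutral_charge q (\<lambda>y. f y - g y)"
proof
  show "0 < q" "q < 2" by fact+
  show "integrable lborel (\<lambda>y. f y - g y)" using prob_densityD[OF f] prob_densityD[OF g] by auto
  have "integrable lborel (\<lambda>y. norm y * f y - norm y * g y)"
    using prob_densityD[OF f] prob_densityD[OF g] by (intro Bochner_Integration.integrable_diff)
  then show "integrable lborel (\<lambda>y. norm y * (f y - g y))" by (simp add: right_diff_distrib)
  show "(LINT y|lborel. f y - g y) = 0" using prob_densityD[OF f] prob_densityD[OF g] by simp
qed

text \<open>
  The symmetric bilinear form whose quadratic form is twice the energy.
\<close>
definition interaction :: "real \<Rightarrow> ('a::euclidean_space \<Rightarrow> real) \<Rightarrow> ('a \<Rightarrow> real) \<Rightarrow> real" where
  "interaction q \<sigma> \<tau> = (LINT x|lborel. \<sigma> x * potential q \<tau> x)"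

lemma interaction_Fubini:
  assumes \<sigma>: "neutral_charge q \<sigma>" and \<tau>: "neutral_charge q \<tau>"
  shows "integrable (lborel \<Otimes>\<^sub>M lborel) (\<lambda>(x, y). energy_kernel q x y * \<sigma> x * \<tau> y)"
    "(LINT (x, y)|(lborel \<Otimes>\<^sub>M lborel). energy_kernel q x y * \<sigma> x * \<tau> y) = interaction q \<sigma> \<tau>"
    "interaction q \<sigma> \<tau> = interaction q \<tau> \<sigma>"
    "integrable lborel (\<lambda>x. \<sigma> x * potential q \<tau> x)"
proof -
  interpret S: neutral_charge q \<sigma> by (rule \<sigma>)
  interpret T: neutral_charge q \<tau> by (rule \<tau>)
  note [measurable] = S.measurable_\<sigma> T.measurable_\<sigma>
  have eq: "energy_kernel q x y * \<sigma> x * \<tau> y = \<sigma> x * (energy_kernel q x y * \<tau> y)" for x y by simp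
  have m[measurable]: "(\<lambda>(x, y). energy_kernel q x y * \<sigma> x * \<tau> y) \<in> borel_measurable (lborel \<Otimes>\<^sub>M lborel)"
    unfolding energy_kernel_def by measurable
  have bm: "(\<lambda>x. \<sigma> x * potential q \<tau> x) \<in> borel_measurable borel"
    using T.potential_continuous by (intro borel_measurable_times S.measurable_\<sigma> borel_measurable_continuous_onI)
  show pot: "integrable lborel (\<lambda>x. \<sigma> x * potential q \<tau> x)"
  proof (rule Bochner_Integration.integrable_bound)
    show "integrable lborel (\<lambda>x. 5 * T.weight * ((1 + norm x) * \<bar>\<sigma> x\<bar>))"
      using S.weight_integrable by (rule integrable_mult_right)
    have "\<bar>\<sigma> x\<bar> * \<bar>potential q \<tau> x\<bar> \<le> \<bar>\<sigma> x\<bar> * (5 * (1 + norm x) * T.weight)" for x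
      by (intro mult_left_mono T.potential_bound) simp
    then show "AE x in lborel. norm (\<sigma> x * potential q \<tau> x) \<le> norm (5 * T.weight * ((1 + norm x) * \<bar>\<sigma> x\<bar>))"
      using T.weight_nonneg by (intro always_eventually allI) (simp add: abs_mult mult_ac)
  qed (use bm in simp)
  show i: "integrable (lborel \<Otimes>\<^sub>M lborel) (\<lambda>(x, y). energy_kernel q x y * \<sigma> x * \<tau> y)"
  proof (rule lborel_pair.Fubini_integrable[OF m])
    show "AE x in lborel. integrable lborel (\<lambda>y. case (x, y) of (x, y) \<Rightarrow> energy_kernel q x y * \<sigma> x * \<tau> y)"
      using T.potential_integrable by (intro always_eventually allI) (simp add: eq)
    have I: "(LINT y|lborel. \<bar>energy_kernel q x y * \<tau> y\<bar>) \<le> 5 * (1 + norm x) * T.weight" for x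
    proof -
      have "(LINT y|lborel. \<bar>energy_kernel q x y * \<tau> y\<bar>) \<le> (LINT y|lborel. 5 * (1 + norm x) * ((1 + norm y) * \<bar>\<tau> y\<bar>))"
        using T.weight_integrable by (intro integral_mono T.kernel_charge_bound integrable_abs T.potential_integrable) auto
      then show ?thesis by (simp add: T.weight_def)
    qed
    show "integrable lborel (\<lambda>x. LINT y|lborel. norm (case (x, y) of (x, y) \<Rightarrow> energy_kernel q x y * \<sigma> x * \<tau> y))"
    proof (rule Bochner_Integration.integrable_bound)
      show "integrable lborel (\<lambda>x. 5 * T.weight * ((1 + norm x) * \<bar>\<sigma> x\<bar>))"
        using S.weight_integrable by (rule integrable_mult_right)
      show "AE x in lborel. norm (LINT y|lborel. norm (case (x, y) of (x, y) \<Rightarrow> energy_kernel q x y * \<sigma> x * \<tau> y))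
          \<le> norm (5 * T.weight * ((1 + norm x) * \<bar>\<sigma> x\<bar>))"
      proof (intro always_eventually allI)
        fix x
        have "\<bar>\<sigma> x\<bar> * (LINT y|lborel. \<bar>energy_kernel q x y * \<tau> y\<bar>) \<le> \<bar>\<sigma> x\<bar> * (5 * (1 + norm x) * T.weight)"
          by (intro mult_left_mono I) simp
        moreover have "norm (LINT y|lborel. norm (case (x, y) of (x, y) \<Rightarrow> energy_kernel q x y * \<sigma> x * \<tau> y))
            = \<bar>\<sigma> x\<bar> * (LINT y|lborel. \<bar>energy_kernel q x y * \<tau> y\<bar>)"
          unfolding prod.case eq real_norm_def abs_mult[of "\<sigma> x"] by (simp add: abs_mult)
        ultimately show "norm (LINT y|lborel. norm (case (x, y) of (x, y) \<Rightarrow> energy_kernel q x y * \<sigma> x * \<tau> y))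
          \<le> norm (5 * T.weight * ((1 + norm x) * \<bar>\<sigma> x\<bar>))"
          using T.weight_nonneg by (simp add: abs_mult mult_ac)
      qed
    qed measurable
  qed
  have fst: "(LINT x|lborel. LINT y|lborel. energy_kernel q x y * \<sigma> x * \<tau> y) = interaction q \<sigma> \<tau>"
    unfolding interaction_def potential_def eq by simp
  have snd: "(LINT y|lborel. LINT x|lborel. energy_kernel q x y * \<sigma> x * \<tau> y) = interaction q \<tau> \<sigma>"
  proof -
    have eq2: "energy_kernel q x y * \<sigma> x * \<tau> y = \<tau> y * (energy_kernel q y x * \<sigma> x)" for x y
      by (simp add: energy_kernel_sym[of q x y])
    show ?thesis unfolding interaction_def potential_def eq2 by simp
  qed
  show "(LINT (x, y)|(lborel \<Otimes>\<^sub>M lborel). energy_kernel q x y * \<sigma> x * \<tau> y) = interaction q \<sigma> \<tau>"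
    using lborel_pair.integral_fst[OF i] fst by simp
  show "interaction q \<sigma> \<tau> = interaction q \<tau> \<sigma>"
    using lborel_pair.Fubini_integral[OF i] fst snd by simp
qed

text \<open>
  The diagonal coupling has cost zero.  This value is needed because a limit at a point does not
  involve the value at that point, while a curve of parameters may take the same time twice.
\<close>
lemma Wasserstein1_self:
  assumes "sets M = sets borel"
  shows "Wasserstein1 M M = 0"
proof -
  have [measurable_cong]: "sets M = sets borel" by fact
  have [measurable]: "(\<lambda>x. (x, x)) \<in> borel \<rightarrow>\<^sub>M (borel :: ('a \<times> 'a) measure)"
    by (intro borel_measurable_continuous_onI continuous_intros)
  have [measurable]: "fst \<in> (borel :: ('a \<times> 'a) measure) \<rightarrow>\<^sub>M borel" "snd \<in> (borel :: ('a \<times> 'a) measure) \<rightarrow>\<^sub>M borel"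
    by (intro borel_measurable_continuous_onI continuous_intros)+
  let ?P = "distr M borel (\<lambda>x. (x, x))"
  have "distr M borel (\<lambda>x. x) = M" by (rule distr_id2) (simp add: assms)
  then have "?P \<in> couplings M M" by (simp add: couplings_def distr_distr o_def)
  then have "Wasserstein1 M M \<le> (\<integral>\<^sup>+ z. ennreal (norm (fst z - snd z)) \<partial>?P)"
    unfolding Wasserstein1_def by (rule INF_lower)
  also have "\<dots> = 0" by (subst nn_integral_distr) auto
  finally show ?thesis by simp
qed

section \<open>The energy identity along the flow\<close>

locale mmd_flow =
  bounded_flow "\<lambda>t. law (\<rho> t)" "law \<rho>0" "\<lambda>t. velocity q (\<rho> t) \<mu>"
  for q :: real and \<rho> :: "real \<Rightarrow> 'a::euclidean_space \<Rightarrow> real" and \<rho>0 \<mu> :: "'a \<Rightarrow> real" +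
  assumes q: "0 < q" "q < 2"
    and \<mu>: "\<mu> \<in> prob_density_moment 1" and \<rho>: "\<And>t. 0 \<le> t \<Longrightarrow> \<rho> t \<in> prob_density_moment 1"
begin

abbreviation v where "v t \<equiv> velocity q (\<rho> t) \<mu>"
abbreviation \<sigma> where "\<sigma> t \<equiv> (\<lambda>y. \<rho> t y - \<mu> y)"

text \<open>
  The power of the velocity at time \<open>a\<close> along the flow at time \<open>\<tau>\<close>; on the diagonal it is the dissipation.
\<close>
definition cross_dissipation where "cross_dissipation a \<tau> = flux (v a) \<tau>"

lemma charge: "0 \<le> t \<Longrightarrow> neutral_charge q (\<sigma> t)"
  by (intro neutral_charge_difference q \<mu> \<rho>)

lemma v_slice_continuous: "0 \<le> t \<Longrightarrow> continuous_on UNIV (v t)"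
  using continuous_on_slice[OF v_continuous, of t t] by simp

lemma potential_has_gradient:
  assumes t: "0 \<le> t"
  shows "has_continuous_gradient (potential q (\<sigma> t)) (\<lambda>x. - v t x)"
proof -
  interpret neutral_charge q "\<sigma> t" by (rule charge[OF t])
  have eq: "conv_vec (gradK q) (\<sigma> t) = (\<lambda>x. - v t x)" by (simp add: velocity_def[abs_def])
  show ?thesis
    using potential_gradient unfolding eq using v_slice_continuous[OF t] by (simp add: continuous_on_minus)
qed

lemma MMD_eq_interaction: "0 \<le> t \<Longrightarrow> MMD_sq q (\<rho> t) \<mu> = 1 / 2 * interaction q (\<sigma> t) (\<sigma> t)"
  unfolding MMD_sq_def interaction_Fubini(2)[OF charge charge, symmetric] by (simp add: energy_kernel_def)

text \<open>
  Symmetry of the bilinear form \<open>B\<close> gives \<open>B(\<sigma>\<^sub>t,\<sigma>\<^sub>t) - B(\<sigma>\<^sub>s,\<sigma>\<^sub>s) = \<integral> (\<phi>\<^sub>s + \<phi>\<^sub>t) (\<sigma>\<^sub>t - \<sigma>\<^sub>s)\<close>, in which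
  \<open>\<mu>\<close> cancels; the sum of the two potentials is a Lipschitz function with gradient \<open>- (v\<^sub>s + v\<^sub>t)\<close>.
\<close>
lemma MMD_increment:
  assumes st: "0 \<le> s" "s \<le> t"
  shows "MMD_sq q (\<rho> t) \<mu> - MMD_sq q (\<rho> s) \<mu> = - 1 / 2 * integral {s..t} (\<lambda>\<tau>. cross_dissipation s \<tau> + cross_dissipation t \<tau>)"
proof -
  have t: "0 \<le> t" using st by simp
  define f where "f x = potential q (\<sigma> s) x + potential q (\<sigma> t) x" for x
  define G where "G x = - v s x + - v t x" for x
  interpret S: neutral_charge q "\<sigma> s" by (rule charge[OF st(1)])
  interpret T: neutral_charge q "\<sigma> t" by (rule charge[OF t])
  note gs = has_continuous_gradientD[OF potential_has_gradient[OF st(1)]]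
  note gt = has_continuous_gradientD[OF potential_has_gradient[OF t]]
  obtain B where B: "\<And>\<tau> x. \<tau> \<in> {0..t} \<Longrightarrow> norm (v \<tau> x) \<le> B" using v_bounded by blast
  have fG: "has_continuous_gradient f G"
    unfolding has_continuous_gradient_def f_def[abs_def] G_def[abs_def]
  proof (intro conjI allI continuous_on_add gs gt)
    fix x
    show "((\<lambda>x. potential q (\<sigma> s) x + potential q (\<sigma> t) x) has_derivative (\<lambda>w. (- v s x + - v t x) \<bullet> w)) (at x)"
      using has_derivative_add[OF gs(1) gt(1)] by (rule has_derivative_eq_rhs) (simp add: fun_eq_iff inner_diff_left)
  qed
  have GB: "norm (G x) \<le> B + B" for x
    unfolding G_def using B[of s x] B[of t x] st norm_triangle_ineq[of "- v s x" "- v t x"] by simp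
  have "duality f G" by (rule duality_Lipschitz[OF fG GB])
  then have dual: "(LINT x|law (\<rho> t). f x) - (LINT x|law (\<rho> s). f x) = integral {s..t} (flux G)"
    using st by (simp add: duality_def)
  have fm: "f \<in> borel_measurable borel"
    using has_continuous_gradientD(3)[OF fG] by (rule borel_measurable_continuous_onI)
  have fb: "\<bar>f x\<bar> \<le> 5 * (S.weight + T.weight) * (1 + norm x)" for x
    using S.potential_bound[of x] T.potential_bound[of x] by (simp add: f_def algebra_simps)
  have fi: "integrable lborel (\<lambda>x. f x * g x)" if g: "g \<in> prob_density_moment 1" for g
  proof (rule Bochner_Integration.integrable_bound)
    note g' = prob_densityD[OF g]
    have "integrable lborel (\<lambda>x. g x + norm x * g x)" using g'(4,6) by (rule Bochner_Integration.integrable_add)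
    then have "integrable lborel (\<lambda>x. (1 + norm x) * g x)" by (simp add: algebra_simps)
    then show "integrable lborel (\<lambda>x. 5 * (S.weight + T.weight) * ((1 + norm x) * g x))"
      by (rule integrable_mult_right)
    show "(\<lambda>x. f x * g x) \<in> borel_measurable lborel" using fm g'(1) by simp
    show "AE x in lborel. norm (f x * g x) \<le> norm (5 * (S.weight + T.weight) * ((1 + norm x) * g x))"
    proof (intro always_eventually allI)
      fix x
      have "\<bar>f x\<bar> * \<bar>g x\<bar> \<le> 5 * (S.weight + T.weight) * (1 + norm x) * \<bar>g x\<bar>"
        by (intro mult_right_mono fb) simp
      also have "\<dots> = norm (5 * (S.weight + T.weight) * ((1 + norm x) * g x))"
        using S.weight_nonneg T.weight_nonneg by (simp add: abs_mult)
      finally show "norm (f x * g x) \<le> norm (5 * (S.weight + T.weight) * ((1 + norm x) * g x))" by (simp add: abs_mult)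
    qed
  qed
  have law: "(LINT x|law (\<rho> r). f x) = (LINT x|lborel. f x * \<rho> r x)" if "0 \<le> r" for r
    using prob_densityD[OF \<rho>[OF that]] fm by (intro integral_law)
  have pair: "(LINT x|lborel. f x * \<sigma> r x) = interaction q (\<sigma> r) (\<sigma> s) + interaction q (\<sigma> r) (\<sigma> t)"
    if r: "0 \<le> r" for r
  proof -
    have "(LINT x|lborel. f x * \<sigma> r x) = (LINT x|lborel. \<sigma> r x * potential q (\<sigma> s) x + \<sigma> r x * potential q (\<sigma> t) x)"
      by (simp add: f_def algebra_simps)
    also have "\<dots> = interaction q (\<sigma> r) (\<sigma> s) + interaction q (\<sigma> r) (\<sigma> t)"
      unfolding interaction_def
      by (intro Bochner_Integration.integral_add interaction_Fubini(4) charge r st t)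
    finally show ?thesis .
  qed
  have "(LINT x|law (\<rho> t). f x) - (LINT x|law (\<rho> s). f x)
      = (LINT x|lborel. f x * \<sigma> t x) - (LINT x|lborel. f x * \<sigma> s x)"
    using fi[OF \<rho>[OF t]] fi[OF \<rho>[OF st(1)]] fi[OF \<mu>] by (simp add: law[OF t] law[OF st(1)] right_diff_distrib)
  also have "\<dots> = interaction q (\<sigma> t) (\<sigma> t) - interaction q (\<sigma> s) (\<sigma> s)"
    using interaction_Fubini(3)[OF charge[OF st(1)] charge[OF t]] by (simp add: pair[OF t] pair[OF st(1)])
  finally have "interaction q (\<sigma> t) (\<sigma> t) - interaction q (\<sigma> s) (\<sigma> s) = integral {s..t} (flux G)"
    using dual by simp
  also have "\<dots> = integral {s..t} (\<lambda>\<tau>. - (cross_dissipation s \<tau> + cross_dissipation t \<tau>))"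
  proof (rule integral_cong)
    fix \<tau> assume \<tau>: "\<tau> \<in> {s..t}"
    have r: "0 \<le> \<tau>" "\<tau> \<in> {0..t}" using \<tau> st by auto
    have i: "integrable (law (\<rho> \<tau>)) (\<lambda>x. v \<tau> x \<bullet> v a x)" if "a \<in> {0..t}" for a
      by (rule integrable_bounded_continuous[of _ _ "B * B"])
        (use r that in \<open>auto intro!: continuous_intros v_slice_continuous abs_inner_le B\<close>)
    show "flux G \<tau> = - (cross_dissipation s \<tau> + cross_dissipation t \<tau>)"
      using i[of s] i[of t] st unfolding flux_def cross_dissipation_def G_def by (simp add: inner_diff_right)
  qed
  also have "\<dots> = - integral {s..t} (\<lambda>\<tau>. cross_dissipation s \<tau> + cross_dissipation t \<tau>)" by (rule integral_neg)
  finally show ?thesis by (simp add: MMD_eq_interaction[OF st(1)] MMD_eq_interaction[OF t] field_simps)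
qed

lemma cross_dissipation_continuous: "continuous_on ({0..T} \<times> {0..T}) (\<lambda>(a, \<tau>). cross_dissipation a \<tau>)"
proof -
  let ?S = "{0..T} \<times> {0..T}"
  obtain B where B: "\<And>\<tau> x. \<tau> \<in> {0..T} \<Longrightarrow> norm (v \<tau> x) \<le> B" using v_bounded by blast
  have "continuous_on ?S (\<lambda>p. LINT x|law (\<rho> (snd p)). v (snd p) x \<bullet> v (fst p) x)"
  proof (rule continuous_on_pairing[where B = "B * B"])
    have "continuous_on (?S \<times> UNIV) (\<lambda>z. (\<lambda>(t, x). v t x) (snd (fst z), snd z) \<bullet> (\<lambda>(t, x). v t x) (fst (fst z), snd z))"
      by (intro continuous_intros continuous_on_compose2[OF v_continuous[of T]]) auto
    then show "continuous_on (?S \<times> UNIV) (\<lambda>(p, x). v (snd p) x \<bullet> v (fst p) x)"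
      by (simp add: case_prod_unfold)
    show "\<bar>v (snd p) x \<bullet> v (fst p) x\<bar> \<le> B * B" if "p \<in> ?S" for p x
      using that by (intro abs_inner_le B) auto
    show "law (\<rho> (snd p)) \<in> prob_moment 1" if "p \<in> ?S" for p using that moment by auto
    show "((\<lambda>p'. Wasserstein1 (law (\<rho> (snd p'))) (law (\<rho> (snd p)))) \<longlongrightarrow> 0) (at p within ?S)" if p: "p \<in> ?S" for p
    proof -
      have t: "snd p \<in> {0..T}" using p by auto
      then have z: "Wasserstein1 (law (\<rho> (snd p))) (law (\<rho> (snd p))) = 0"
        using \<nu>_sets by (intro Wasserstein1_self) auto
      have "continuous (at (snd p) within {0..T}) (\<lambda>s. Wasserstein1 (law (\<rho> s)) (law (\<rho> (snd p))))"
        unfolding continuous_within z using t W1_continuous by auto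
      moreover have "\<forall>\<^sub>F p' in at p within ?S. snd p' \<in> {0..T}"
        unfolding eventually_at_filter by (rule always_eventually) auto
      moreover have "(snd \<longlongrightarrow> snd p) (at p within ?S)" by (intro tendsto_intros)
      ultimately show ?thesis
        using continuous_within_tendsto_compose[of "snd p" "{0..T}"
            "\<lambda>s. Wasserstein1 (law (\<rho> s)) (law (\<rho> (snd p)))" snd "at p within ?S"] z by simp
    qed
  qed (simp add: compact_Times)
  then show ?thesis by (simp add: cross_dissipation_def flux_def case_prod_unfold)
qed

lemma dissipation_eq: "dissipation q (\<rho> t) \<mu> = cross_dissipation t t"
  by (simp add: dissipation_def cross_dissipation_def flux_def velocity_def dot_square_norm)

lemma cross_dissipation_section_continuous:
  assumes a: "a \<in> {0..T}" shows "continuous_on {0..T} (cross_dissipation a)"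
proof -
  have "continuous_on {0..T} (\<lambda>\<tau>. (\<lambda>(a, \<tau>). cross_dissipation a \<tau>) (a, \<tau>))"
    by (rule continuous_on_compose2[OF cross_dissipation_continuous[of T]]) (use a in \<open>auto intro!: continuous_intros\<close>)
  then show ?thesis by simp
qed

lemma cross_dissipation_diagonal_continuous: "continuous_on {0..T} (\<lambda>t. cross_dissipation t t)"
proof -
  have "continuous_on {0..T} (\<lambda>t. (\<lambda>(a, \<tau>). cross_dissipation a \<tau>) (t, t))"
    by (rule continuous_on_compose2[OF cross_dissipation_continuous[of T]]) (auto intro!: continuous_intros)
  then show ?thesis by simp
qed

lemma dissipation_continuous: "continuous_on {0..} (\<lambda>t. dissipation q (\<rho> t) \<mu>)"
  unfolding dissipation_eq continuous_on_eq_continuous_within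
proof
  fix t :: real assume "t \<in> {0..}"
  then have "continuous (at t within {0..t + 1}) (\<lambda>t. cross_dissipation t t)"
    using cross_dissipation_diagonal_continuous[of "t + 1"] by (auto simp: continuous_on_eq_continuous_within)
  moreover have "at t within {0..t + 1} = at t within {0..}"
    by (rule at_within_nhd[of t "{..<t + 1}"]) auto
  ultimately show "continuous (at t within {0..}) (\<lambda>t. cross_dissipation t t)" by simp
qed

text \<open>
  Stated for two times \<open>s \<le> t\<close> so that it covers the left and the right difference quotient, according to
  which of them is the point of differentiation.
\<close>
lemma increment_estimate:
  assumes st: "0 \<le> s" "s \<le> t" and e: "\<And>a \<tau>. a \<in> {s, t} \<Longrightarrow> \<tau> \<in> {s..t} \<Longrightarrow> \<bar>cross_dissipation a \<tau> - D\<bar> \<le> e"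
  shows "\<bar>MMD_sq q (\<rho> t) \<mu> - MMD_sq q (\<rho> s) \<mu> + D * (t - s)\<bar> \<le> e * (t - s)"
proof -
  have c: "continuous_on {s..t} (\<lambda>\<tau>. cross_dissipation s \<tau> + cross_dissipation t \<tau>)"
    by (intro continuous_intros continuous_on_subset[OF cross_dissipation_section_continuous[of _ t]]) (use st in auto)
  have i: "(\<lambda>\<tau>. cross_dissipation s \<tau> + cross_dissipation t \<tau>) integrable_on {s..t}" "(\<lambda>\<tau>. 2 * D) integrable_on {s..t}"
    by (intro integrable_continuous_interval c continuous_intros)+
  have "integral {s..t} (\<lambda>\<tau>. cross_dissipation s \<tau> + cross_dissipation t \<tau> - 2 * D) = integral {s..t} (\<lambda>\<tau>. cross_dissipation s \<tau> + cross_dissipation t \<tau>) - 2 * D * (t - s)"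
    using integral_diff[OF i] st by simp
  moreover have "norm (integral {s..t} (\<lambda>\<tau>. cross_dissipation s \<tau> + cross_dissipation t \<tau> - 2 * D)) \<le> 2 * e * (t - s)"
  proof (rule integral_bound[OF st(2)])
    show "continuous_on {s..t} (\<lambda>\<tau>. cross_dissipation s \<tau> + cross_dissipation t \<tau> - 2 * D)" by (intro continuous_intros c)
    show "norm (cross_dissipation s \<tau> + cross_dissipation t \<tau> - 2 * D) \<le> 2 * e" if "\<tau> \<in> {s..t}" for \<tau>
      using e[of s \<tau>] e[of t \<tau>] that by (auto simp: abs_le_iff)
  qed
  ultimately show ?thesis using MMD_increment[OF st] by (auto simp: abs_le_iff field_simps)
qed

lemma MMD_has_derivative:
  assumes t: "0 \<le> t"
  shows "((\<lambda>\<tau>. MMD_sq q (\<rho> \<tau>) \<mu>) has_real_derivative - dissipation q (\<rho> t) \<mu>) (at t within {0..})"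
  unfolding has_field_derivative_def has_derivative_within_alt dissipation_eq
proof (intro conjI allI impI)
  show "bounded_linear ((*) (- cross_dissipation t t))" by (rule bounded_linear_mult_right)
  fix e :: real assume e: "0 < e"
  obtain d where d: "0 < d" and dQ: "\<And>a \<tau>. a \<in> {0..t + 1} \<Longrightarrow> \<tau> \<in> {0..t + 1} \<Longrightarrow> dist (a, \<tau>) (t, t) < d \<Longrightarrow> dist (cross_dissipation a \<tau>) (cross_dissipation t t) < e"
    using cross_dissipation_continuous[of "t + 1", unfolded continuous_on_iff, rule_format, of "(t, t)" e] e t by auto
  define d' where "d' = min 1 (d / 2)"
  have d': "0 < d'" "d' \<le> 1" "2 * d' \<le> d" using d by (auto simp: d'_def)
  have near: "\<bar>cross_dissipation a \<tau> - cross_dissipation t t\<bar> \<le> e" if "0 \<le> a" "0 \<le> \<tau>" "\<bar>a - t\<bar> < d'" "\<bar>\<tau> - t\<bar> < d'" for a \<tau>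
  proof -
    have "dist (a, \<tau>) (t, t) \<le> dist a t + dist \<tau> t" by (simp add: dist_Pair_Pair sqrt_sum_squares_le_sum)
    also have "\<dots> < d" using that d' by (simp add: dist_real_def)
    finally have "dist (cross_dissipation a \<tau>) (cross_dissipation t t) < e" using that d' by (intro dQ) auto
    then show ?thesis by (simp add: dist_real_def)
  qed
  show "\<exists>d>0. \<forall>y\<in>{0..}. norm (y - t) < d \<longrightarrow>
      norm (MMD_sq q (\<rho> y) \<mu> - MMD_sq q (\<rho> t) \<mu> - - cross_dissipation t t * (y - t)) \<le> e * norm (y - t)"
  proof (intro exI conjI ballI impI)
    fix y :: real assume y: "y \<in> {0..}" "norm (y - t) < d'"
    show "norm (MMD_sq q (\<rho> y) \<mu> - MMD_sq q (\<rho> t) \<mu> - - cross_dissipation t t * (y - t)) \<le> e * norm (y - t)"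
    proof (cases "t \<le> y")
      case True
      have "\<bar>MMD_sq q (\<rho> y) \<mu> - MMD_sq q (\<rho> t) \<mu> + cross_dissipation t t * (y - t)\<bar> \<le> e * (y - t)"
        by (rule increment_estimate[OF t True]) (use y True t d' in \<open>auto intro!: near\<close>)
      then show ?thesis using True by simp
    next
      case False
      have "\<bar>MMD_sq q (\<rho> t) \<mu> - MMD_sq q (\<rho> y) \<mu> + cross_dissipation t t * (t - y)\<bar> \<le> e * (t - y)"
        by (rule increment_estimate) (use y False t d' in \<open>auto intro!: near\<close>)
      then show ?thesis using False by (simp add: algebra_simps abs_le_iff)
    qed
  qed (rule d'(1))
qed

lemma energy_identity:
  assumes st: "0 \<le> s" "s \<le> t"
  shows "set_integrable lborel {s..t} (\<lambda>\<tau>. dissipation q (\<rho> \<tau>) \<mu>)"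
    "MMD_sq q (\<rho> t) \<mu> + (LINT \<tau>:{s..t}|lborel. dissipation q (\<rho> \<tau>) \<mu>) = MMD_sq q (\<rho> s) \<mu>"
proof -
  have c: "continuous_on {s..t} (\<lambda>\<tau>. dissipation q (\<rho> \<tau>) \<mu>)"
    using st by (intro continuous_on_subset[OF dissipation_continuous]) auto
  show si: "set_integrable lborel {s..t} (\<lambda>\<tau>. dissipation q (\<rho> \<tau>) \<mu>)"
    unfolding set_integrable_def by (rule borel_integrable_compact[OF compact_Icc c])
  have "((\<lambda>\<tau>. - dissipation q (\<rho> \<tau>) \<mu>) has_integral MMD_sq q (\<rho> t) \<mu> - MMD_sq q (\<rho> s) \<mu>) {s..t}"
  proof (rule fundamental_theorem_of_calculus[OF st(2)])
    fix \<tau> assume "\<tau> \<in> {s..t}"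
    then have "((\<lambda>\<tau>. MMD_sq q (\<rho> \<tau>) \<mu>) has_real_derivative - dissipation q (\<rho> \<tau>) \<mu>) (at \<tau> within {s..t})"
      using st by (intro has_field_derivative_subset[OF MMD_has_derivative]) auto
    then show "((\<lambda>\<tau>. MMD_sq q (\<rho> \<tau>) \<mu>) has_vector_derivative - dissipation q (\<rho> \<tau>) \<mu>) (at \<tau> within {s..t})"
      by (simp add: has_real_derivative_iff_has_vector_derivative)
  qed
  from has_integral_neg[OF this] have "integral {s..t} (\<lambda>\<tau>. dissipation q (\<rho> \<tau>) \<mu>) = MMD_sq q (\<rho> s) \<mu> - MMD_sq q (\<rho> t) \<mu>"
    by (simp add: integral_unique)
  then show "MMD_sq q (\<rho> t) \<mu> + (LINT \<tau>:{s..t}|lborel. dissipation q (\<rho> \<tau>) \<mu>) = MMD_sq q (\<rho> s) \<mu>"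
    using set_borel_integral_eq_integral(2)[OF si] by simp
qed

end

section \<open>Weak solutions\<close>

text \<open>
  The essential supremum bounds the norm almost everywhere, hence everywhere by continuity.
\<close>
lemma W1inf_bound:
  fixes u :: "'a::euclidean_space \<Rightarrow> 'b::euclidean_space"
  assumes u: "continuous_on UNIV u" and C: "W1p_norm \<infinity> u \<le> ennreal C"
  shows "norm (u x) \<le> max 0 C"
proof -
  have [measurable]: "u \<in> borel_measurable borel" using u by (rule borel_measurable_continuous_onI)
  have "Lp_norm \<infinity> u \<le> W1p_norm \<infinity> u"
    unfolding W1p_norm_def by (rule INF_greatest) (simp add: add_increasing2)
  then have "esssup lborel (\<lambda>x. ennreal (norm (u x))) \<le> ennreal C" using C by (simp add: Lp_norm_def)
  moreover have "AE x in lborel. ennreal (norm (u x)) \<le> esssup lborel (\<lambda>x. ennreal (norm (u x)))"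
    by (rule esssup_AE)
  ultimately have "AE x in lborel. ennreal (norm (u x)) \<le> ennreal C"
    by (auto elim!: eventually_mono intro: order_trans)
  then have "AE x in lborel. x \<in> {x. norm (u x) \<le> max 0 C}"
  proof eventually_elim
    case (elim x)
    also have "ennreal C \<le> ennreal (max 0 C)" by (rule ennreal_leI) simp
    finally show ?case by (simp only: ennreal_le_iff mem_Collect_eq max.cobounded1)
  qed
  then have "AE x in lebesgue. x \<in> {x. norm (u x) \<le> max 0 C}" by (rule AE_completion)
  moreover have "closed {x. norm (u x) \<le> max 0 C}"
    using u by (intro closed_Collect_le continuous_intros)
  ultimately have "x \<in> {x. norm (u x) \<le> max 0 C}" by (intro mem_closed_if_AE_lebesgue)
  then show ?thesis by simp
qed

text \<open>
  The bound holds for almost every time, and at all the others by continuity in time; \<open>{0<..<T}\<close> is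
  used because a null set cannot contain an open interval, and its closure contains the end points.
\<close>
lemma Linf_W1inf_bound:
  fixes v :: "real \<Rightarrow> 'a::euclidean_space \<Rightarrow> 'a"
  assumes T: "0 < T" and v: "continuous_on ({0..T} \<times> UNIV) (\<lambda>(t, x). v t x)" and b: "in_Linf_W1inf T v"
  obtains B where "\<And>t x. t \<in> {0..T} \<Longrightarrow> norm (v t x) \<le> B"
proof -
  obtain C where C: "AE t in lborel. t \<in> {0..T} \<longrightarrow> W1p_norm \<infinity> (v t) \<le> ennreal C"
    using b by (auto simp: in_Linf_W1inf_def)
  have "norm (v t x) \<le> max 0 C" if t: "t \<in> {0..T}" for t x
  proof -
    let ?A = "{s \<in> {0..T}. norm (v s x) \<le> max 0 C}"
    have c: "continuous_on {0..T} (\<lambda>s. v s x)"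
    proof -
      have "continuous_on {0..T} (\<lambda>s. (\<lambda>(t, x). v t x) (s, x))"
        by (rule continuous_on_compose2[OF v]) (auto intro!: continuous_intros)
      then show ?thesis by simp
    qed
    then have cl: "closed ?A" by (intro continuous_on_closed_Collect_le continuous_intros) auto
    have "AE s in lborel. s \<in> {0<..<T} \<longrightarrow> s \<in> ?A"
      using C by eventually_elim (auto intro!: W1inf_bound[OF continuous_on_slice[OF v]])
    then have ae: "AE s \<in> {0<..<T} in lebesgue. s \<in> ?A" by (rule AE_completion)
    have "{0<..<T} \<subseteq> ?A"
    proof
      fix s assume "s \<in> {0<..<T}"
      then show "s \<in> ?A" by (rule mem_closed_if_AE_lebesgue_open[OF open_greaterThanLessThan cl ae])
    qed
    then have "closure {0<..<T} \<subseteq> ?A" using cl by (rule closure_minimal)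
    then show ?thesis using T t by (auto simp: closure_greaterThanLessThan)
  qed
  then show thesis by (rule that)
qed

lemma weak_equation_tensor:
  assumes w: "weak_equation q T \<mu> \<rho>0 \<rho>"
    and v: "continuous_on ({0..T} \<times> UNIV) (\<lambda>(t, x). velocity q (\<rho> t) \<mu> x)"
    and \<rho>: "\<And>t. t \<in> {0..T} \<Longrightarrow> \<rho> t \<in> prob_density_moment 1" and \<rho>0: "\<rho>0 \<in> prob_density_moment 1"
    and \<theta>: "smooth \<theta>" "{s. \<theta> s \<noteq> 0} \<subseteq> {a..b}" and b: "b < T" and \<psi>: "\<psi> \<in> test_functions"
  shows "(LINT t:{0..T}|lborel. LINT x|law (\<rho> t). deriv \<theta> t * \<psi> x + \<theta> t * (velocity q (\<rho> t) \<mu> x \<bullet> grad \<psi> x))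
        + \<theta> 0 * (LINT x|law \<rho>0. \<psi> x) = 0"
proof -
  have "smooth \<psi>" using \<psi> by (simp add: test_functions_def)
  note g = has_continuous_gradientD[OF smooth_has_continuous_gradient[OF this]]
  have k: "Ck k \<theta>" for k using \<theta>(1) by (simp add: smooth_def)
  note D = Ck_Suc_real_deriv(1)[OF k]
  have 1: "deriv (\<lambda>s. \<theta> s * \<psi> x) t = deriv \<theta> t * \<psi> x" for x t
    by (rule DERIV_imp_deriv) (auto intro!: derivative_eq_intros D)
  have 2: "grad (\<lambda>y. \<theta> t * \<psi> y) x = \<theta> t *\<^sub>R grad \<psi> x" for x t
    by (rule grad_eq) (use has_derivative_mult_right[OF g(1), of "\<theta> t"] in simp)
  have i: "(LINT x|lborel. (deriv (\<lambda>s. \<theta> s * \<psi> x) t + velocity q (\<rho> t) \<mu> x \<bullet> grad (\<lambda>y. \<theta> t * \<psi> y) x) * \<rho> t x)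
      = (LINT x|law (\<rho> t). deriv \<theta> t * \<psi> x + \<theta> t * (velocity q (\<rho> t) \<mu> x \<bullet> grad \<psi> x))" if t: "t \<in> {0..T}" for t
  proof -
    have "continuous_on UNIV (\<lambda>x. deriv \<theta> t * \<psi> x + \<theta> t * (velocity q (\<rho> t) \<mu> x \<bullet> grad \<psi> x))"
      by (intro continuous_intros g continuous_on_slice[OF v t])
    then have m: "(\<lambda>x. deriv \<theta> t * \<psi> x + \<theta> t * (velocity q (\<rho> t) \<mu> x \<bullet> grad \<psi> x)) \<in> borel_measurable borel"
      by (rule borel_measurable_continuous_onI)
    show ?thesis
      by (subst integral_law[OF prob_densityD(1,2)[OF \<rho>[OF t]] m]) (simp add: 1 2)
  qed
  have "(LINT t:{0..T}|lborel. LINT x|lborel. (deriv (\<lambda>s. \<theta> s * \<psi> x) t + velocity q (\<rho> t) \<mu> x \<bullet> grad (\<lambda>y. \<theta> t * \<psi> y) x) * \<rho> t x)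
      + (LINT x|lborel. \<theta> 0 * \<psi> x * \<rho>0 x) = 0"
    using w tensor_test_function[OF \<theta> b \<psi>] unfolding weak_equation_def by fastforce
  moreover have "(LINT t:{0..T}|lborel. LINT x|lborel. (deriv (\<lambda>s. \<theta> s * \<psi> x) t + velocity q (\<rho> t) \<mu> x \<bullet> grad (\<lambda>y. \<theta> t * \<psi> y) x) * \<rho> t x)
      = (LINT t:{0..T}|lborel. LINT x|law (\<rho> t). deriv \<theta> t * \<psi> x + \<theta> t * (velocity q (\<rho> t) \<mu> x \<bullet> grad \<psi> x))"
    by (rule set_lebesgue_integral_cong) (use i in auto)
  moreover have "(LINT x|lborel. \<theta> 0 * \<psi> x * \<rho>0 x) = \<theta> 0 * (LINT x|law \<rho>0. \<psi> x)"
    using integral_law[OF prob_densityD(1,2)[OF \<rho>0] borel_measurable_continuous_onI[OF g(3)]] by (simp add: mult.assoc)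
  ultimately show ?thesis by simp
qed

lemma mmd_flow_of_weak_solution:
  assumes q: "0 < q" "q < 2" and r: "1 \<le> r"
    and \<mu>: "\<mu> \<in> prob_density_moment r" and \<rho>0: "\<rho>0 \<in> prob_density_moment r"
    and sol: "global_weak_solution q r p \<mu> \<rho>0 \<rho>"
  shows "mmd_flow q \<rho> \<rho>0 \<mu>"
proof -
  have L: "in_Linf_W1inf T (\<lambda>t. velocity q (\<rho> t) \<mu>)"
    and vc: "continuous_on ({0..T} \<times> UNIV) (\<lambda>(t, x). velocity q (\<rho> t) \<mu> x)"
    and w: "weak_equation q T \<mu> \<rho>0 \<rho>" and P: "in_C_P1 T \<rho>" if "0 < T" for T
    using sol that unfolding global_weak_solution_def by blast+
  have \<rho>: "\<rho> t \<in> prob_density_moment 1" if "0 \<le> t" for t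
    using P[of "t + 1"] that by (simp add: in_C_P1_def)
  have \<rho>0': "\<rho>0 \<in> prob_density_moment 1" and \<mu>': "\<mu> \<in> prob_density_moment 1"
    using \<rho>0 \<mu> r prob_density_moment_weaken by blast+
  have sub: "{0..T} \<subseteq> {0..max 1 T}" for T :: real by auto
  show ?thesis
  proof
    show "law (\<rho> t) \<in> prob_moment 1" if "0 \<le> t" for t using prob_densityD(3)[OF \<rho>[OF that]] .
    show "((\<lambda>s. Wasserstein1 (law (\<rho> s)) (law (\<rho> t))) \<longlongrightarrow> 0) (at t within {0..T})" if "0 \<le> t" "t \<le> T" for T t
    proof -
      have "((\<lambda>s. Wasserstein1 (law (\<rho> s)) (law (\<rho> t))) \<longlongrightarrow> 0) (at t within {0..max 1 T})"
        using P[of "max 1 T"] that by (simp add: in_C_P1_def continuous_wrt_def)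
      then show ?thesis using tendsto_within_subset sub by blast
    qed
    show "continuous_on ({0..T} \<times> UNIV) (\<lambda>(t, x). velocity q (\<rho> t) \<mu> x)" for T
      by (rule continuous_on_subset[OF vc[of "max 1 T"]]) auto
    show "\<exists>B. \<forall>t\<in>{0..T}. \<forall>x. norm (velocity q (\<rho> t) \<mu> x) \<le> B" for T
    proof -
      have T: "0 < max 1 T" by simp
      obtain B where "\<And>t x. t \<in> {0..max 1 T} \<Longrightarrow> norm (velocity q (\<rho> t) \<mu> x) \<le> B"
        using Linf_W1inf_bound[OF T vc[OF T] L[OF T]] by blast
      then show ?thesis using sub by blast
    qed
    show "(LINT t:{0..T}|lborel. LINT x|law (\<rho> t). deriv \<theta> t * \<psi> x + \<theta> t * (velocity q (\<rho> t) \<mu> x \<bullet> grad \<psi> x))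
        + \<theta> 0 * (LINT x|law \<rho>0. \<psi> x) = 0"
      if "smooth \<theta>" "{s. \<theta> s \<noteq> 0} \<subseteq> {a..b}" "b < T" "0 < T" "\<psi> \<in> test_functions" for T \<theta> a b \<psi>
      by (rule weak_equation_tensor[OF w[OF that(4)] vc[OF that(4)] _ \<rho>0' that(1,2,3,5)]) (use \<rho> in auto)
  qed (use q \<mu>' \<rho> in auto)
qed

theorem proposition3p8:
  fixes q r :: real and p :: ennreal
    and \<mu> \<rho>0 :: "'a::euclidean_space \<Rightarrow> real" and \<rho> :: "real \<Rightarrow> 'a \<Rightarrow> real"
  assumes "1 \<le> r"
    and "0 < q" and "q < 2" and "real DIM('a) + q - 2 \<ge> 0"
    and "critical_exponent DIM('a) q \<le> p"
    and "real DIM('a) + q - 2 > 0 \<Longrightarrow> critical_exponent DIM('a) q < p"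
    and "\<mu> \<in> prob_density_moment r" and "\<mu> \<in> Lp p"
    and "\<rho>0 \<in> prob_density_moment r" and "\<rho>0 \<in> Lp p"
    and "global_weak_solution q r p \<mu> \<rho>0 \<rho>"
  shows "(\<exists>F'. continuous_on {0..} F' \<and>
            (\<forall>t\<ge>0. ((\<lambda>\<tau>. MMD_sq q (\<rho> \<tau>) \<mu>) has_real_derivative F' t) (at t within {0..})))
       \<and> (\<forall>s t. 0 \<le> s \<and> s \<le> t \<longrightarrow>
            set_integrable lborel {s..t} (\<lambda>\<tau>. dissipation q (\<rho> \<tau>) \<mu>) \<and>
            MMD_sq q (\<rho> t) \<mu> + (LINT \<tau>:{s..t}|lborel. dissipation q (\<rho> \<tau>) \<mu>)
              = MMD_sq q (\<rho> s) \<mu>)"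
proof -
  interpret mmd_flow q \<rho> \<rho>0 \<mu> by (rule mmd_flow_of_weak_solution[OF assms(2,3,1,7,9,11)])
  show ?thesis
  proof (intro conjI allI impI exI[of _ "\<lambda>t. - dissipation q (\<rho> t) \<mu>"])
    show "continuous_on {0..} (\<lambda>t. - dissipation q (\<rho> t) \<mu>)"
      by (intro continuous_intros dissipation_continuous)
  qed (auto intro: MMD_has_derivative energy_identity)
qed

end
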